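(* Let $n,N\in\mathbb N_+$ and consider the leader-follower multi-agent system $\dot x_i=Ax_i+Bu_i$, $i=0,\dots,N$, $u_0=0$, with communication weights $w_{ij}$, as described in the context. Let $\mu\in[-1,\tfrac1{n-1})$ and $G_{\mathbf d}=\mathrm{diag}\{1-\mu(n-k)\}_{k=1}^n$. Let $(X,Y)\in\mathbb R^{n\times n}\times\mathbb R^{1\times n}$ be a solution of the linear matrix inequalities $$X\succ0,\qquad G_{\mathbf d}X+XG_{\mathbf d}\succ0,\qquad AX+XA^\top-BY-Y^\top B^\top\prec0 .$$ Let $\mathbf d(s)=\exp(sG_{\mathbf d})$, $s\in\mathbb R$, let $P=X^{-1}$, $K=YX^{-1}$, and let $\|\cdot\|_{\mathbf d}$ be the canonical homogeneous norm induced by $\|x\|_P=\sqrt{x^\top Px}$. Let the transmitted vectors $v_i\in\mathbb R^n$ be defined by $$v_0=\mathbf 0_n,\qquad v_i=\frac{1}{\sum_{j=0}^N w_{ij}}\sum_{j=0}^N w_{ij}\,(x_i-x_j+v_j),\quad i=1,\dots,N, \tag{V}$$ and let the control protocol be $$u_i=-\|v_i\|_{\mathbf d}^{1+\mu}K\,\mathbf d(-\ln\|v_i\|_{\mathbf d})\,v_i,\quad i=1,\dots,N. \tag{U}$$ Then: (1) The algebraic system (V), the control equations (U), and the closed-loop error equation $\dot e=f(e)$ have unique solutions $v_i$, $u_i$ and $e_i$, $i=1,\dots,N$, respectively. (2) For $\mu\in[-1,0)$ the closed-loop error equation $\dot e=f(e)$ is globally finite-time stable.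
   Context: Agents: $x_i(t)\in\mathbb R^n$, $i=0,\dots,N$; agent $0$ is the leader with $u_0=0$, agents $1,\dots,N$ are followers with scalar inputs $u_i$. $A=\begin{pmatrix}\mathbf 0_{n-1}&I_{n-1}\\0&\mathbf 0_{n-1}^\top\end{pmatrix}\in\mathbb R^{n\times n}$, $B=\begin{pmatrix}\mathbf 0_{n-1}\\1\end{pmatrix}\in\mathbb R^n$ (integrator chain). For $n=1$, $\tfrac1{n-1}$ is read as $+\infty$. Communication graph: a fixed directed graph on vertices $\{0,\dots,N\}$ with edge set $\mathcal E$; $(i,j)\in\mathcal E$ means that $j$ sends information to $i$; $w_{ij}=1$ if $(i,j)\in\mathcal E$ and $w_{ij}=0$ otherwise; no self-loops ($w_{ii}=0$). Vertex $0$ is the root: it has no incoming edges ($w_{0j}=0$ for all $j$), and every vertex $1,\dots,N$ is the endpoint of at least one directed path starting at $0$. Consensus error: $e_i=x_i-x_0$, $e=(e_1^\top,\dots,e_N^\top)^\top\in\mathbb R^{Nn}$. The closed-loop error equation $\dot e=f(e)$ is the differential equation obtained from $\dot e_i=Ae_i+Bu_i$, $i=1,\dots,N$, by substituting the control protocol. "Unique solution" for this equation means for each initial condition $e(0)$, in forward time. Canonical homogeneous norm: $\|\mathbf 0\|_{\mathbf d}=0$, and for $x\neq\mathbf 0$, $\|x\|_{\mathbf d}=\exp(s_x)$ where $s_x\in\mathbb R$ is such that $\|\mathbf d(-s_x)x\|_P=1$ (it is unique because $G_{\mathbf d}X+XG_{\mathbf d}\succ0$). For $\mu>-1$ the control at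 $v_i=\mathbf 0$ is defined by continuity, i.e. $u_i=0$. For $\mu=-1$ the control is discontinuous at $v_i=\mathbf 0$ and solutions of the closed-loop system are understood in the sense of Filippov. Globally finite-time stable: the origin is Lyapunov stable and there is a settling-time function $T:\mathbb R^{Nn}\to\mathbb R_{\ge0}$ such that $e(t)=\mathbf 0$ for all $t\ge T(e(0))$, for every $e(0)\in\mathbb R^{Nn}$. $\succ0$ ($\prec0$) means symmetric positive (negative) definite. *)

theory Defs
  imports "HOL-Analysis.Analysis"
begin

section \<open>Matrices\<close>

(* The same types as real^'n, real^'n^'n and real^'n^1, but usable when 'n carries a sort
   other than finite. *)
type_synonym 'n rvec = "(real, 'n) vec"
type_synonym 'n sqmat = "((real, 'n) vec, 'n) vec"
type_synonym 'n rowmat = "((real, 'n) vec, 1) vec"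

definition pos_def :: "real^'n^'n \<Rightarrow> bool" where
  "pos_def M \<longleftrightarrow> transpose M = M \<and> (\<forall>x. x \<noteq> 0 \<longrightarrow> 0 < x \<bullet> (M *v x))"

definition neg_def :: "real^'n^'n \<Rightarrow> bool" where
  "neg_def M \<longleftrightarrow> transpose M = M \<and> (\<forall>x. x \<noteq> 0 \<longrightarrow> x \<bullet> (M *v x) < 0)"

(* Multiplication on real^'n^'n as a type-class operation is componentwise, so the library's
   power and exp do not denote the matrix power and the matrix exponential. *)
primrec mat_pow :: "real^'n^'n \<Rightarrow> nat \<Rightarrow> real^'n^'n" where
  "mat_pow M 0 = mat 1"
| "mat_pow M (Suc k) = M ** mat_pow M k"

definition mat_exp :: "real^'n^'n \<Rightarrow> real^'n^'n" where
  "mat_exp M = (\<Sum>k. (1 / fact k) *\<^sub>R mat_pow M k)"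

(* The coordinates of R^n are indexed by a finite linearly ordered type of cardinality n;
   idx i, between 1 and n, is the rank of i in that order. *)
definition idx :: "'n::{finite,linorder} \<Rightarrow> nat" where
  "idx i = card {j. j \<le> i}"

definition chain_A :: "'n::{finite,linorder} sqmat" where
  "chain_A = (\<chi> i j. if idx j = idx i + 1 then 1 else 0)"

definition chain_B :: "real^1^'n::{finite,linorder}" where
  "chain_B = (\<chi> i j. if idx i = CARD('n) then 1 else 0)"

section \<open>Dilation and canonical homogeneous norm\<close>

definition dil_gen :: "real \<Rightarrow> 'n::{finite,linorder} sqmat" where
  "dil_gen \<mu> = (\<chi> i j. if i = j then 1 - \<mu> * (real CARD('n) - real (idx i)) else 0)"

definition dil :: "real \<Rightarrow> real \<Rightarrow> 'n::{finite,linorder} sqmat" where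
  "dil \<mu> s = mat_exp (s *\<^sub>R dil_gen \<mu>)"

definition wnorm :: "real^'n^'n \<Rightarrow> real^'n \<Rightarrow> real" where
  "wnorm P x = sqrt (x \<bullet> (P *v x))"

definition hnorm :: "real \<Rightarrow> 'n sqmat \<Rightarrow> 'n::{finite,linorder} rvec \<Rightarrow> real" where
  "hnorm \<mu> P x =
     (if x = 0 then 0 else exp (THE s. wnorm P (dil \<mu> (- s) *v x) = 1))"

section \<open>Communication graph and control protocol\<close>

(* Agents are the elements of 'm option, with CARD('m) = N: None is the leader (agent 0) and
   Some i are the followers.  (i, j) \<in> E means that j sends information to i, so that
   information flows along the edges of the converse relation. *)
definition leader_graph :: "('m option \<times> 'm option) set \<Rightarrow> bool" where
  "leader_graph E \<longleftrightarrow>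
     (\<forall>i. (i, i) \<notin> E) \<and> (\<forall>j. (None, j) \<notin> E) \<and> (\<forall>i. (None, Some i) \<in> (E\<inverse>)\<^sup>+)"

definition weight :: "('m option \<times> 'm option) set \<Rightarrow> 'm option \<Rightarrow> 'm option \<Rightarrow> real" where
  "weight E i j = (if (i, j) \<in> E then 1 else 0)"

definition transmitted ::
    "('m::finite option \<times> 'm option) set \<Rightarrow> ('m option \<Rightarrow> real^'n) \<Rightarrow> ('m option \<Rightarrow> real^'n) \<Rightarrow> bool" where
  "transmitted E x v \<longleftrightarrow>
     v None = 0 \<and>
     (\<forall>i. v (Some i) =
        (1 / (\<Sum>j\<in>UNIV. weight E (Some i) j)) *\<^sub>R
        (\<Sum>j\<in>UNIV. weight E (Some i) j *\<^sub>R (x (Some i) - x j + v j)))"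

(* For \<mu> > -1 the value 0 at the origin is the continuous extension.  For \<mu> = -1 it is an
   arbitrary choice, to which the Filippov regularization below is insensitive. *)
definition feedback :: "real \<Rightarrow> 'n sqmat \<Rightarrow> 'n rowmat \<Rightarrow> 'n::{finite,linorder} rvec \<Rightarrow> real" where
  "feedback \<mu> P K z =
     (if z = 0 then 0
      else - (hnorm \<mu> P z powr (1 + \<mu>)) * (K *v (dil \<mu> (- ln (hnorm \<mu> P z)) *v z)) $ 1)"

definition control ::
    "real \<Rightarrow> 'n sqmat \<Rightarrow> 'n rowmat \<Rightarrow> ('m option \<Rightarrow> 'n::{finite,linorder} rvec) \<Rightarrow> ('m \<Rightarrow> real) \<Rightarrow> bool" where
  "control \<mu> P K v u \<longleftrightarrow> (\<forall>i. u i = feedback \<mu> P K (v (Some i)))"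

definition consensus_error :: "('m::finite option \<Rightarrow> real^'n) \<Rightarrow> (real^'n)^'m" where
  "consensus_error x = (\<chi> i. x (Some i) - x None)"

(* The right-hand side f(e): the value of (A e_i + B u_i)_i for every state x of the network
   whose consensus error is e, with v and u solving the protocol at x.  It does not depend on
   the choice of x, because the protocol involves only differences of states. *)
definition error_field ::
    "('m::finite option \<times> 'm option) set \<Rightarrow> real \<Rightarrow> 'n sqmat \<Rightarrow> 'n rowmat \<Rightarrow>
     ('n::{finite,linorder} rvec)^'m \<Rightarrow> ('n rvec)^'m" where
  "error_field E \<mu> P K e =
     (THE y. \<exists>x v u. consensus_error x = e \<and> transmitted E x v \<and> control \<mu> P K v u \<and>
        y = (\<chi> i. chain_A *v (e $ i) + chain_B *v vec (u i)))"

section \<open>Solutions of differential equations\<close>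

definition classical_solution ::
    "('a::euclidean_space \<Rightarrow> 'a) \<Rightarrow> real set \<Rightarrow> (real \<Rightarrow> 'a) \<Rightarrow> bool" where
  "classical_solution f S e \<longleftrightarrow>
     (\<forall>t\<in>S. (e has_vector_derivative f (e t)) (at t within S))"

definition filippov :: "('a::euclidean_space \<Rightarrow> 'a) \<Rightarrow> 'a \<Rightarrow> 'a set" where
  "filippov f x =
     (\<Inter>\<delta>\<in>{0<..}. \<Inter>Z\<in>{Z. negligible Z}. closure (convex hull (f ` (ball x \<delta> - Z))))"

(* Absolute continuity of a function; absolutely_continuous in the library is the relation
   between measures. *)
definition abs_cont_on :: "real set \<Rightarrow> (real \<Rightarrow> 'a::euclidean_space) \<Rightarrow> bool" where
  "abs_cont_on S e \<longleftrightarrow>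
     (\<forall>\<epsilon>>0. \<exists>\<delta>>0. \<forall>D U. D division_of U \<and> U \<subseteq> S \<and> (\<Sum>k\<in>D. Sup k - Inf k) < \<delta> \<longrightarrow>
        (\<Sum>k\<in>D. norm (e (Sup k) - e (Inf k))) < \<epsilon>)"

definition filippov_solution ::
    "('a::euclidean_space \<Rightarrow> 'a) \<Rightarrow> real set \<Rightarrow> (real \<Rightarrow> 'a) \<Rightarrow> bool" where
  "filippov_solution f S e \<longleftrightarrow>
     (\<forall>a b. {a..b} \<subseteq> S \<longrightarrow> abs_cont_on {a..b} e) \<and>
     (\<exists>Z. negligible Z \<and>
        (\<forall>t\<in>S - Z. \<exists>y\<in>filippov f (e t). (e has_vector_derivative y) (at t within S)))"

definition solution ::
    "real \<Rightarrow> ('a::euclidean_space \<Rightarrow> 'a) \<Rightarrow> real set \<Rightarrow> (real \<Rightarrow> 'a) \<Rightarrow> bool" where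
  "solution \<mu> f S e =
     (if \<mu> = -1 then filippov_solution f S e else classical_solution f S e)"

(* Global existence in forward time, and uniqueness also against solutions that are
   defined only on a bounded interval. *)
definition unique_forward_solutions ::
    "(real set \<Rightarrow> (real \<Rightarrow> 'a::euclidean_space) \<Rightarrow> bool) \<Rightarrow> bool" where
  "unique_forward_solutions sol \<longleftrightarrow>
     (\<forall>e0. \<exists>e. sol {0..} e \<and> e 0 = e0 \<and>
        (\<forall>T>0. \<forall>e'. sol {0..<T} e' \<and> e' 0 = e0 \<longrightarrow> (\<forall>t\<in>{0..<T}. e' t = e t)))"

definition lyapunov_stable ::
    "(real set \<Rightarrow> (real \<Rightarrow> 'a::euclidean_space) \<Rightarrow> bool) \<Rightarrow> bool" where
  "lyapunov_stable sol \<longleftrightarrow>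
     (\<forall>\<epsilon>>0. \<exists>\<delta>>0. \<forall>e. sol {0..} e \<and> norm (e 0) < \<delta> \<longrightarrow> (\<forall>t\<ge>0. norm (e t) < \<epsilon>))"

definition globally_finite_time_stable ::
    "(real set \<Rightarrow> (real \<Rightarrow> 'a::euclidean_space) \<Rightarrow> bool) \<Rightarrow> bool" where
  "globally_finite_time_stable sol \<longleftrightarrow>
     lyapunov_stable sol \<and>
     (\<exists>T :: 'a \<Rightarrow> real. (\<forall>e0. 0 \<le> T e0) \<and> (\<forall>e. sol {0..} e \<longrightarrow> (\<forall>t\<ge>T (e 0). e t = 0)))"

end

(* Since every follower has a path from the leader, (V) has the unique solution v_i = x_i - x_0 = e_i.
   Hence the followers decouple: each error obeys z' = g(z) = A z + B u(z), a field that is homogeneous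
   with respect to the dilation d.  Writing z = d(s) y with y on the unit sphere of P and dividing time
   by exp(mu s), the equation becomes an autonomous Lipschitz equation for y on the sphere together with
   s' <= -c < 0.  This gives global forward solutions, which decrease in the homogeneous norm and, for
   mu < 0, reach the origin in finite time because the original time is the convergent integral of
   exp(-mu s).  Uniqueness holds away from the origin because g is locally Lipschitz there, and at the
   origin because the homogeneous norm cannot increase; both arguments only use that the solution is
   absolutely continuous and satisfies the equation at almost all times where it does not vanish, so they
   cover Filippov solutions as well. *)

theory Submission
  imports Defs
begin

section \<open>Absolutely continuous functions\<close>

text \<open>The two matrix inequalities have separate jobs. Tested at \<open>P *v x\<close>, the one
  with the generator makes the \<open>P\<close>-norm strictly monotone along dilations, so that
  polar coordinates exist; the one with \<open>chain_A\<close> makes the linear closed loop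
  \<open>H\<close> point inwards on the unit sphere. The logarithmic radius drops out of the
  equation on the sphere because one step along the chain changes the weight by exactly \<mu>. The
  rate c comes from the quotient \<open>\<kappa>\<close> of the two forms, bounded away from 0 by
  compactness. The obstacle is the origin: there \<open>\<sigma>\<close> tends to minus infinity,
  and for \<mu> = -1 the field is discontinuous. Monotonicity of the homogeneous norm is therefore
  tested with a quadratic form at one frozen dilation, which is smooth, and only just after one
  crossing time. Since the equation holds merely almost everywhere, this requires a mean value
  inequality for absolutely continuous functions. For \<mu> = -1 existence also requires that 0 be
  an admissible velocity of the followers that have already settled; this comes from the oddness of
  \<open>g\<close>.\<close>

lemma division_of_real_interval:
  fixes k :: "real set"
  assumes "D division_of U" "k \<in> D"
  shows "Inf k \<le> Sup k" "Inf k \<in> U" "Sup k \<in> U" "k = {Inf k..Sup k}"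
proof -
  obtain a b where "k = cbox a b" using division_ofD(4)[OF assms] by metis
  moreover have "k \<noteq> {}" "k \<subseteq> U" using division_ofD(2,3)[OF assms] by simp_all
  ultimately show "Inf k \<le> Sup k" "Inf k \<in> U" "Sup k \<in> U" "k = {Inf k..Sup k}" by auto
qed

lemma abs_cont_onE:
  assumes "abs_cont_on S u" "\<epsilon> > 0"
  obtains \<delta> where "\<delta> > 0" "\<And>D U. D division_of U \<Longrightarrow> U \<subseteq> S \<Longrightarrow> (\<Sum>k\<in>D. Sup k - Inf k) < \<delta>
      \<Longrightarrow> (\<Sum>k\<in>D. norm (u (Sup k) - u (Inf k))) < \<epsilon>"
proof -
  have "\<exists>\<delta>>0. \<forall>D U. D division_of U \<and> U \<subseteq> S \<and> (\<Sum>k\<in>D. Sup k - Inf k) < \<delta> \<longrightarrow>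
        (\<Sum>k\<in>D. norm (u (Sup k) - u (Inf k))) < \<epsilon>"
    using assms by (simp add: abs_cont_on_def)
  then show thesis by (elim exE conjE) (rule that, assumption, blast)
qed

text \<open>Increments of \<open>\<phi>\<close> are compared with those of \<open>u\<close>
  directly, without naming an outer map; components, inner products and quadratic forms of a
  trajectory are all covered.\<close>

lemma abs_cont_on_lipschitz_comp:
  fixes u :: "real \<Rightarrow> 'a::euclidean_space" and \<phi> :: "real \<Rightarrow> 'b::euclidean_space"
  assumes u: "abs_cont_on S u"
    and le: "\<And>x y. x \<in> S \<Longrightarrow> y \<in> S \<Longrightarrow> norm (\<phi> x - \<phi> y) \<le> C * norm (u x - u y)"
  shows "abs_cont_on S \<phi>"
  unfolding abs_cont_on_def
proof (intro allI impI)
  fix \<epsilon> :: real assume "\<epsilon> > 0"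
  \<comment> \<open>\<open>C\<close> may be zero or negative, while \<epsilon> has to be divided by
    a positive number.\<close>
  define C' where "C' = max C 1"
  have C': "C' > 0" "C \<le> C'" by (auto simp: C'_def)
  have "\<epsilon> / C' > 0" using \<open>\<epsilon> > 0\<close> C' by simp
  obtain \<delta> where "\<delta> > 0" and \<delta>: "\<And>D U. D division_of U \<Longrightarrow> U \<subseteq> S \<Longrightarrow> (\<Sum>k\<in>D. Sup k - Inf k) < \<delta>
      \<Longrightarrow> (\<Sum>k\<in>D. norm (u (Sup k) - u (Inf k))) < \<epsilon> / C'"
    by (rule abs_cont_onE[OF u \<open>\<epsilon> / C' > 0\<close>]) blast
  show "\<exists>\<delta>>0. \<forall>D U. D division_of U \<and> U \<subseteq> S \<and> (\<Sum>k\<in>D. Sup k - Inf k) < \<delta> \<longrightarrow>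
          (\<Sum>k\<in>D. norm (\<phi> (Sup k) - \<phi> (Inf k))) < \<epsilon>"
  proof (intro exI[of _ \<delta>] conjI allI impI)
    fix D U assume D: "D division_of U \<and> U \<subseteq> S \<and> (\<Sum>k\<in>D. Sup k - Inf k) < \<delta>"
    have "Sup k \<in> S \<and> Inf k \<in> S" if "k \<in> D" for k
      using D that by (meson division_of_real_interval subsetD)
    then have "(\<Sum>k\<in>D. norm (\<phi> (Sup k) - \<phi> (Inf k))) \<le> (\<Sum>k\<in>D. C' * norm (u (Sup k) - u (Inf k)))"
      by (intro sum_mono order_trans[OF le]) (auto intro!: mult_right_mono C')
    also have "\<dots> = C' * (\<Sum>k\<in>D. norm (u (Sup k) - u (Inf k)))" by (simp add: sum_distrib_left)
    also have "\<dots> < \<epsilon>" using \<delta>[of D U] D C' by (auto simp: field_simps)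
    finally show "(\<Sum>k\<in>D. norm (\<phi> (Sup k) - \<phi> (Inf k))) < \<epsilon>" .
  qed (rule \<open>\<delta> > 0\<close>)
qed

lemma abs_cont_on_ident: "abs_cont_on S (\<lambda>t::real. t)"
  unfolding abs_cont_on_def
proof (intro allI impI)
  fix \<epsilon> :: real assume "\<epsilon> > 0"
  show "\<exists>\<delta>>0. \<forall>D U. D division_of U \<and> U \<subseteq> S \<and> (\<Sum>k\<in>D. Sup k - Inf k) < \<delta> \<longrightarrow>
          (\<Sum>k\<in>D. norm (Sup k - Inf k)) < \<epsilon>"
  proof (intro exI[of _ \<epsilon>] conjI allI impI)
    fix D U assume D: "D division_of U \<and> U \<subseteq> S \<and> (\<Sum>k\<in>D. Sup k - Inf k) < \<epsilon>"
    have "norm (Sup k - Inf k) = Sup k - Inf k" if "k \<in> D" for k :: "real set"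
      using D that division_of_real_interval(1)[of D U k] by simp
    then show "(\<Sum>k\<in>D. norm (Sup k - Inf k)) < \<epsilon>" using D by (simp cong: sum.cong)
  qed (rule \<open>\<epsilon> > 0\<close>)
qed

lemma abs_cont_on_lipschitz:
  fixes \<phi> :: "real \<Rightarrow> 'b::euclidean_space"
  assumes "\<And>x y. x \<in> S \<Longrightarrow> y \<in> S \<Longrightarrow> norm (\<phi> x - \<phi> y) \<le> C * \<bar>x - y\<bar>"
  shows "abs_cont_on S \<phi>"
  using abs_cont_on_lipschitz_comp[OF abs_cont_on_ident, of S \<phi> C] assms by simp

text \<open>Each part gets an equal share of \<epsilon>, and the smallest of the finitely many
  \<delta> serves all of them. Differences and finite vectors are instances.\<close>

lemma abs_cont_on_by_parts:
  fixes u :: "'i \<Rightarrow> real \<Rightarrow> 'a::euclidean_space" and \<phi> :: "real \<Rightarrow> 'b::euclidean_space"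
  assumes fin: "finite I" and u: "\<And>i. i \<in> I \<Longrightarrow> abs_cont_on S (u i)"
    and le: "\<And>x y. x \<in> S \<Longrightarrow> y \<in> S \<Longrightarrow> norm (\<phi> x - \<phi> y) \<le> (\<Sum>i\<in>I. norm (u i x - u i y))"
  shows "abs_cont_on S \<phi>"
  unfolding abs_cont_on_def
proof (intro allI impI)
  fix \<epsilon> :: real assume "\<epsilon> > 0"
  define \<epsilon>' where "\<epsilon>' = \<epsilon> / (real (card I) + 1)"
  have "\<epsilon>' > 0" using \<open>\<epsilon> > 0\<close> by (simp add: \<epsilon>'_def)
  have "\<forall>i\<in>I. \<exists>\<delta>>0. \<forall>D U. D division_of U \<and> U \<subseteq> S \<and> (\<Sum>k\<in>D. Sup k - Inf k) < \<delta> \<longrightarrow>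
        (\<Sum>k\<in>D. norm (u i (Sup k) - u i (Inf k))) < \<epsilon>'"
    using u \<open>\<epsilon>' > 0\<close> by (simp add: abs_cont_on_def)
  then obtain d where d: "\<And>i. i \<in> I \<Longrightarrow> d i > 0"
      "\<And>i D U. i \<in> I \<Longrightarrow> D division_of U \<Longrightarrow> U \<subseteq> S \<Longrightarrow> (\<Sum>k\<in>D. Sup k - Inf k) < d i \<Longrightarrow>
        (\<Sum>k\<in>D. norm (u i (Sup k) - u i (Inf k))) < \<epsilon>'"
    by metis
  \<comment> \<open>The element 1 keeps \<open>Min\<close> meaningful for empty \<open>I\<close>, as
    the summand 1 in \<open>\<epsilon>'\<close> avoids a division by zero.\<close>
  define \<delta> where "\<delta> = Min (insert 1 (d ` I))"
  have "\<delta> > 0" using fin d(1) by (simp add: \<delta>_def)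
  show "\<exists>\<delta>>0. \<forall>D U. D division_of U \<and> U \<subseteq> S \<and> (\<Sum>k\<in>D. Sup k - Inf k) < \<delta> \<longrightarrow>
          (\<Sum>k\<in>D. norm (\<phi> (Sup k) - \<phi> (Inf k))) < \<epsilon>"
  proof (intro exI[of _ \<delta>] conjI allI impI)
    fix D U assume D: "D division_of U \<and> U \<subseteq> S \<and> (\<Sum>k\<in>D. Sup k - Inf k) < \<delta>"
    have di: "(\<Sum>k\<in>D. Sup k - Inf k) < d i" if "i \<in> I" for i
    proof -
      have "\<delta> \<le> d i" unfolding \<delta>_def using fin that by (intro Min_le) auto
      then show ?thesis using D by linarith
    qed
    have "Sup k \<in> S \<and> Inf k \<in> S" if "k \<in> D" for k
      using D that by (meson division_of_real_interval subsetD)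
    then have "(\<Sum>k\<in>D. norm (\<phi> (Sup k) - \<phi> (Inf k))) \<le> (\<Sum>k\<in>D. \<Sum>i\<in>I. norm (u i (Sup k) - u i (Inf k)))"
      by (intro sum_mono le) auto
    also have "\<dots> = (\<Sum>i\<in>I. \<Sum>k\<in>D. norm (u i (Sup k) - u i (Inf k)))" by (rule sum.swap)
    also have "\<dots> \<le> (\<Sum>i\<in>I. \<epsilon>')"
      using d(2) D di by (intro sum_mono less_imp_le) auto
    also have "\<dots> < \<epsilon>" using \<open>\<epsilon> > 0\<close> by (simp add: \<epsilon>'_def field_simps)
    finally show "(\<Sum>k\<in>D. norm (\<phi> (Sup k) - \<phi> (Inf k))) < \<epsilon>" .
  qed (rule \<open>\<delta> > 0\<close>)
qed

lemma abs_cont_on_diff: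
  fixes u v :: "real \<Rightarrow> 'a::euclidean_space"
  assumes "abs_cont_on S u" "abs_cont_on S v"
  shows "abs_cont_on S (\<lambda>t. u t - v t)"
proof (rule abs_cont_on_by_parts[of "{True, False}" S "\<lambda>b. if b then u else v"])
  fix x y
  have "norm ((u x - v x) - (u y - v y)) = norm ((u x - u y) - (v x - v y))" by (simp add: algebra_simps)
  also have "\<dots> \<le> norm (u x - u y) + norm (v x - v y)" by (rule norm_triangle_ineq4)
  finally show "norm ((u x - v x) - (u y - v y))
      \<le> (\<Sum>i\<in>{True, False}. norm ((if i then u else v) x - (if i then u else v) y))" by simp
qed (use assms in auto)

lemma abs_cont_on_vec_lambda:
  fixes u :: "'m::finite \<Rightarrow> real \<Rightarrow> 'a::euclidean_space"
  assumes "\<And>i. abs_cont_on S (u i)"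
  shows "abs_cont_on S (\<lambda>t. \<chi> i. u i t)"
proof (rule abs_cont_on_by_parts[of UNIV S u])
  fix x y
  have "norm ((\<chi> i. u i x) - (\<chi> i. u i y)) \<le> (\<Sum>i\<in>UNIV. norm (((\<chi> i. u i x) - (\<chi> i. u i y)) $ i))"
    unfolding norm_vec_def by (rule L2_set_le_sum) simp
  then show "norm ((\<chi> i. u i x) - (\<chi> i. u i y)) \<le> (\<Sum>i\<in>UNIV. norm (u i x - u i y))" by simp
qed (use assms in auto)

text \<open>A single interval between two points is already a division.\<close>

lemma abs_cont_on_continuous:
  fixes u :: "real \<Rightarrow> 'a::euclidean_space"
  assumes "abs_cont_on {a..b} u"
  shows "continuous_on {a..b} u"
  unfolding continuous_on_iff
proof (intro ballI allI impI)
  fix x \<epsilon> :: real assume x: "x \<in> {a..b}" and "\<epsilon> > 0"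
  obtain \<delta> where "\<delta> > 0" and \<delta>: "\<And>D U. D division_of U \<Longrightarrow> U \<subseteq> {a..b} \<Longrightarrow> (\<Sum>k\<in>D. Sup k - Inf k) < \<delta>
      \<Longrightarrow> (\<Sum>k\<in>D. norm (u (Sup k) - u (Inf k))) < \<epsilon>"
    by (rule abs_cont_onE[OF assms \<open>\<epsilon> > 0\<close>]) blast
  have *: "norm (u q - u p) < \<epsilon>" if "p \<le> q" "p \<in> {a..b}" "q \<in> {a..b}" "q - p < \<delta>" for p q
  proof -
    have "{cbox p q} division_of cbox p q" using that by (intro division_of_self) auto
    from \<delta>[OF this] that show ?thesis by auto
  qed
  show "\<exists>d>0. \<forall>x'\<in>{a..b}. dist x' x < d \<longrightarrow> dist (u x') (u x) < \<epsilon>"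
  proof (intro exI[of _ \<delta>] conjI ballI impI)
    fix x' assume "x' \<in> {a..b}" "dist x' x < \<delta>"
    then show "dist (u x') (u x) < \<epsilon>"
      using *[of x' x] *[of x x'] x by (cases "x \<le> x'") (auto simp: dist_norm norm_minus_commute dist_real_def)
  qed (rule \<open>\<delta> > 0\<close>)
qed

text \<open>Cousin's lemma applied to a gauge which keeps the intervals tagged in the exceptional set
  inside an open set of small measure, so that absolute continuity controls their contribution.\<close>

lemma abs_cont_increment_le:
  fixes \<phi> :: "real \<Rightarrow> real"
  assumes ab: "a \<le> b" and ac: "abs_cont_on {a..b} \<phi>" and Z: "negligible Z"
    and der: "\<And>t. t \<in> {a..b} - Z \<Longrightarrow> \<exists>d\<le>M. (\<phi> has_vector_derivative d) (at t within {a..b})"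
  shows "\<phi> b - \<phi> a \<le> M * (b - a)"
proof -
  \<comment> \<open>One \<epsilon> bounds the increments over intervals tagged in \<open>Z\<close>.
    The other \<bar>M\<bar> + 1 pay for leaving the length of these intervals, less than \<epsilon>,
    out of b - a: the slope M + \<epsilon> may be negative, but its modulus is at most \<bar>M\<bar>
    + 1.\<close>
  have main: "\<phi> b - \<phi> a \<le> (M + \<epsilon>) * (b - a) + (\<bar>M\<bar> + 2) * \<epsilon>" if "\<epsilon> > 0" "\<epsilon> \<le> 1" for \<epsilon>
  proof -
    obtain \<delta>0 where "\<delta>0 > 0" and \<delta>0: "\<And>D U. D division_of U \<Longrightarrow> U \<subseteq> {a..b} \<Longrightarrow> (\<Sum>k\<in>D. Sup k - Inf k) < \<delta>0
        \<Longrightarrow> (\<Sum>k\<in>D. norm (\<phi> (Sup k) - \<phi> (Inf k))) < \<epsilon>"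
      by (rule abs_cont_onE[OF ac \<open>\<epsilon> > 0\<close>]) blast
    define \<delta> where "\<delta> = min \<delta>0 \<epsilon>"
    have "\<delta> > 0" "\<delta> \<le> \<delta>0" "\<delta> \<le> \<epsilon>" using \<open>\<delta>0 > 0\<close> that by (auto simp: \<delta>_def)
    obtain U where U: "open U" "Z \<subseteq> U" "U - Z \<in> lmeasurable" "emeasure lebesgue (U - Z) < ennreal \<delta>"
      using sets_lebesgue_outer_open[of Z \<delta>] Z \<open>\<delta> > 0\<close> by (auto simp: negligible_imp_sets)
    have Zn: "Z \<in> null_sets lebesgue" using Z by (simp add: negligible_iff_null_sets)
    have "U \<in> lmeasurable"
      using fmeasurable.Un[OF U(3) negligible_imp_measurable[OF Z]] U(2) by (simp add: Un_absorb2)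
    have "emeasure lebesgue U = emeasure lebesgue (U - Z)"
      using Zn \<open>U \<in> lmeasurable\<close> by (simp add: emeasure_Diff_null_set)
    then have mU: "measure lebesgue U < \<delta>"
      using U(4) \<open>\<delta> > 0\<close> \<open>U \<in> lmeasurable\<close>
      by (metis emeasure_eq_measure2 ennreal_less_iff measure_nonneg)
    have "\<exists>\<eta>>0. (t \<in> Z \<longrightarrow> ball t \<eta> \<subseteq> U) \<and>
       (t \<in> {a..b} - Z \<longrightarrow> (\<forall>p q. p \<le> t \<longrightarrow> t \<le> q \<longrightarrow> {p..q} \<subseteq> {a..b} \<longrightarrow> {p..q} \<subseteq> ball t \<eta> \<longrightarrow> \<phi> q - \<phi> p \<le> (M + \<epsilon>) * (q - p)))" for t
    proof (cases "t \<in> {a..b} - Z")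
      case True
      then obtain d where d: "d \<le> M" "(\<phi> has_vector_derivative d) (at t within {a..b})" using der by blast
      then have "(\<phi> has_derivative (\<lambda>x. x * d)) (at t within {a..b})"
        by (simp add: has_vector_derivative_def)
      then obtain \<eta> where \<eta>: "\<eta> > 0" "\<And>y. y \<in> {a..b} \<Longrightarrow> \<bar>y - t\<bar> < \<eta> \<Longrightarrow> \<bar>\<phi> y - \<phi> t - (y - t) * d\<bar> \<le> \<epsilon> * \<bar>y - t\<bar>"
        unfolding has_derivative_within_alt using \<open>\<epsilon> > 0\<close> by auto
      have "\<phi> q - \<phi> p \<le> (M + \<epsilon>) * (q - p)" if pq: "p \<le> t" "t \<le> q" "{p..q} \<subseteq> {a..b}" "{p..q} \<subseteq> ball t \<eta>" for p q
      proof -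
        have "p \<in> {p..q}" "q \<in> {p..q}" using pq by auto
        then have m: "p \<in> {a..b}" "q \<in> {a..b}" "\<bar>p - t\<bar> < \<eta>" "\<bar>q - t\<bar> < \<eta>"
          using subsetD[OF pq(3)] subsetD[OF pq(4)] by (auto simp: dist_real_def abs_minus_commute)
        have "\<phi> q - \<phi> t - (q - t) * d \<le> \<epsilon> * (q - t)" "- (\<phi> p - \<phi> t - (p - t) * d) \<le> \<epsilon> * (t - p)"
          using \<eta>(2)[OF m(1,3)] \<eta>(2)[OF m(2,4)] pq by auto
        then have "\<phi> q - \<phi> p \<le> d * (q - p) + \<epsilon> * (q - p)" by (simp add: algebra_simps)
        also have "\<dots> \<le> M * (q - p) + \<epsilon> * (q - p)" using d pq by (intro add_right_mono mult_right_mono) auto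
        finally show ?thesis by (simp add: algebra_simps)
      qed
      with \<eta> True show ?thesis by auto
    next
      case False
      show ?thesis
      proof (cases "t \<in> Z")
        case True
        then have "t \<in> U" using U by auto
        then show ?thesis using U(1) True by (auto simp: open_contains_ball)
      next
        case F2: False
        with False show ?thesis by (intro exI[of _ 1]) auto
      qed
    qed
    then obtain \<eta> where \<eta>: "\<And>t. \<eta> t > 0" "\<And>t. t \<in> Z \<Longrightarrow> ball t (\<eta> t) \<subseteq> U"
       "\<And>t p q. t \<in> {a..b} - Z \<Longrightarrow> p \<le> t \<Longrightarrow> t \<le> q \<Longrightarrow> {p..q} \<subseteq> {a..b} \<Longrightarrow> {p..q} \<subseteq> ball t (\<eta> t) \<Longrightarrow> \<phi> q - \<phi> p \<le> (M + \<epsilon>) * (q - p)"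
      by metis
    have "gauge (\<lambda>t. ball t (\<eta> t))" using \<eta>(1) by (simp add: gauge_def)
    then obtain p where p: "p tagged_division_of {a..b}" "(\<lambda>t. ball t (\<eta> t)) fine p"
      using fine_division_exists_real by blast
    have finp: "finite p" using p(1) by blast
    define p1 where "p1 = {(x,K) \<in> p. x \<in> Z}"
    define p2 where "p2 = {(x,K) \<in> p. x \<notin> Z}"
    have pp: "p = p1 \<union> p2" "p1 \<inter> p2 = {}" "finite p1" "finite p2" "p1 \<subseteq> p"
      using finp by (auto simp: p1_def p2_def elim: finite_subset[rotated])
    have ivl: "\<exists>u v. u \<le> v \<and> K = {u..v} \<and> x \<in> {u..v} \<and> {u..v} \<subseteq> {a..b} \<and> {u..v} \<subseteq> ball x (\<eta> x)" if "(x, K) \<in> p" for x K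
    proof -
      have "\<exists>u v. K = cbox u v" using tagged_division_ofD(4)[OF p(1) that] .
      then obtain u v where uv: "K = cbox u v" by blast
      have "K \<subseteq> ball x (\<eta> x)" using p(2) that unfolding fine_def by blast
      moreover have "x \<in> K" "K \<subseteq> {a..b}" using tagged_division_ofD(2,3)[OF p(1) that] by auto
      ultimately show ?thesis using uv by (intro exI[of _ u] exI[of _ v]) auto
    qed
    have len_eq: "0 \<le> Sup K - Inf K" "K \<noteq> {}" "Sup K - Inf K = measure lebesgue K" if "(x, K) \<in> p" for x K
      using ivl[OF that] by auto
    have "\<phi> b - \<phi> a = (\<Sum>(x,K)\<in>p. \<phi> (Sup K) - \<phi> (Inf K))"
      using additive_tagged_division_1[OF ab p(1), of \<phi>] by simp
    also have "\<dots> = (\<Sum>(x,K)\<in>p1. \<phi> (Sup K) - \<phi> (Inf K)) + (\<Sum>(x,K)\<in>p2. \<phi> (Sup K) - \<phi> (Inf K))"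
      unfolding pp(1) by (rule sum.union_disjoint[OF pp(3,4,2)])
    finally have split: "\<phi> b - \<phi> a = \<dots>" .
    have "b - a = (\<Sum>(x,K)\<in>p. Sup K - Inf K)"
      using additive_tagged_division_1[OF ab p(1), of "\<lambda>x. x"] by simp
    also have "\<dots> = (\<Sum>(x,K)\<in>p1. Sup K - Inf K) + (\<Sum>(x,K)\<in>p2. Sup K - Inf K)"
      unfolding pp(1) by (rule sum.union_disjoint[OF pp(3,4,2)])
    finally have split': "b - a = \<dots>" .
    have tp1: "p1 tagged_partial_division_of {a..b}"
      using p(1) pp(5) tagged_partial_division_subset by (metis tagged_division_of_def)
    have td1: "p1 tagged_division_of (\<Union>(snd ` p1))"
      using tagged_partial_division_of_Union_self[OF tp1] .
    have dv1: "(snd ` p1) division_of (\<Union>(snd ` p1))" using division_of_tagged_division[OF td1] .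
    have subU: "\<Union>(snd ` p1) \<subseteq> U"
    proof
      fix y assume "y \<in> \<Union>(snd ` p1)"
      then obtain x K where "(x, K) \<in> p" "x \<in> Z" "y \<in> K" by (auto simp: p1_def)
      then show "y \<in> U" using ivl[of x K] \<eta>(2)[of x] by blast
    qed
    have subab: "\<Union>(snd ` p1) \<subseteq> {a..b}"
    proof
      fix y assume "y \<in> \<Union>(snd ` p1)"
      then obtain x K where "(x, K) \<in> p" "y \<in> K" by (auto simp: p1_def)
      then show "y \<in> {a..b}" using ivl[of x K] by blast
    qed
    have sumlen: "(\<Sum>k\<in>snd ` p1. Sup k - Inf k) = sum (measure lebesgue) (snd ` p1)"
    proof (rule sum.cong)
      fix K assume "K \<in> snd ` p1"
      then obtain x where "(x, K) \<in> p" using pp(5) by auto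
      from len_eq(3)[OF this] show "Sup K - Inf K = measure lebesgue K" .
    qed simp
    also have "\<dots> = measure lebesgue (\<Union>(snd ` p1))"
      using content_division[OF dv1] by simp
    also have "\<dots> \<le> measure lebesgue U"
      using subU \<open>U \<in> lmeasurable\<close> lmeasurable_division[OF dv1] by (intro measure_mono_fmeasurable) auto
    finally have len: "(\<Sum>k\<in>snd ` p1. Sup k - Inf k) < \<delta>" using mU by simp
    \<comment> \<open>Distinct tags can share an interval only if it is degenerate, so a function
      vanishing there may be summed over the intervals alone. The functions \<open>?f\<close> below
      are set to 0 at the empty set, where \<open>Sup\<close> and \<open>Inf\<close> mean
      nothing.\<close>
    have conv: "(\<Sum>(x,K)\<in>p1. f K) = (\<Sum>K\<in>snd ` p1. f K)" if "\<And>u v. u = v \<Longrightarrow> f {u..v} = 0" "f {} = 0" for f :: "real set \<Rightarrow> real"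
    proof (rule sum.over_tagged_division_lemma[OF td1])
      fix u v :: real assume "box u v = {}"
      then show "f (cbox u v) = 0" using that by (cases "u = v") auto
    qed
    have len2: "(\<Sum>(x,K)\<in>p1. Sup K - Inf K) < \<delta>"
    proof -
      let ?f = "\<lambda>K::real set. if K = {} then 0 else Sup K - Inf K"
      have "(\<Sum>(x,K)\<in>p1. Sup K - Inf K) = (\<Sum>(x,K)\<in>p1. ?f K)"
        using len_eq(2) by (intro sum.cong) (auto simp: p1_def)
      also have "\<dots> = (\<Sum>K\<in>snd ` p1. ?f K)" by (rule conv) auto
      also have "\<dots> = (\<Sum>K\<in>snd ` p1. Sup K - Inf K)"
        using len_eq(2) by (intro sum.cong) (auto simp: p1_def)
      finally show ?thesis using len by simp
    qed
    have len0: "(\<Sum>(x,K)\<in>p1. Sup K - Inf K) \<ge> 0"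
      using len_eq(1) by (intro sum_nonneg) (auto simp: p1_def)
    have s1: "(\<Sum>(x,K)\<in>p1. \<phi> (Sup K) - \<phi> (Inf K)) \<le> \<epsilon>"
    proof -
      let ?f = "\<lambda>K::real set. if K = {} then 0 else norm (\<phi> (Sup K) - \<phi> (Inf K))"
      have "(\<Sum>(x,K)\<in>p1. \<phi> (Sup K) - \<phi> (Inf K)) \<le> (\<Sum>(x,K)\<in>p1. ?f K)"
        using len_eq(2) by (intro sum_mono) (auto simp: p1_def)
      also have "\<dots> = (\<Sum>K\<in>snd ` p1. ?f K)" by (rule conv) auto
      also have "\<dots> = (\<Sum>K\<in>snd ` p1. norm (\<phi> (Sup K) - \<phi> (Inf K)))"
        using len_eq(2) by (intro sum.cong) (auto simp: p1_def)
      also have "\<dots> < \<epsilon>" using \<delta>0[OF dv1 subab] len \<open>\<delta> \<le> \<delta>0\<close> by simp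
      finally show ?thesis by simp
    qed
    have "(\<Sum>(x,K)\<in>p2. \<phi> (Sup K) - \<phi> (Inf K)) \<le> (\<Sum>(x,K)\<in>p2. (M + \<epsilon>) * (Sup K - Inf K))"
    proof (rule sum_mono, clarify)
      fix x K assume xK: "(x, K) \<in> p2"
      then have "(x, K) \<in> p" "x \<notin> Z" by (auto simp: p2_def)
      from ivl[OF this(1)] obtain u v where "u \<le> v" "K = {u..v}" "x \<in> {u..v}" "{u..v} \<subseteq> {a..b}" "{u..v} \<subseteq> ball x (\<eta> x)"
        by blast
      then show "\<phi> (Sup K) - \<phi> (Inf K) \<le> (M + \<epsilon>) * (Sup K - Inf K)"
        using \<eta>(3)[of x u v] \<open>x \<notin> Z\<close> by auto
    qed
    also have "\<dots> = (M + \<epsilon>) * (\<Sum>(x,K)\<in>p2. Sup K - Inf K)"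
      by (simp add: sum_distrib_left case_prod_unfold)
    also have "\<dots> = (M + \<epsilon>) * (b - a) - (M + \<epsilon>) * (\<Sum>(x,K)\<in>p1. Sup K - Inf K)"
      by (simp add: split' algebra_simps)
    finally have s2: "(\<Sum>(x,K)\<in>p2. \<phi> (Sup K) - \<phi> (Inf K)) \<le> \<dots>" .
    have "- (M + \<epsilon>) * (\<Sum>(x,K)\<in>p1. Sup K - Inf K) \<le> (\<bar>M\<bar> + 1) * \<epsilon>"
      using len0 len2 \<open>\<delta> \<le> \<epsilon>\<close> that by (intro mult_mono) auto
    with s1 s2 split show ?thesis by (simp add: algebra_simps)
  qed
  have "((\<lambda>\<epsilon>. (M + \<epsilon>) * (b - a) + (\<bar>M\<bar> + 2) * \<epsilon>) \<longlongrightarrow> (M + 0) * (b - a) + (\<bar>M\<bar> + 2) * 0) (at_right 0)"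
    by (intro tendsto_intros)
  moreover have "\<forall>\<^sub>F \<epsilon> in at_right (0::real). \<phi> b - \<phi> a \<le> (M + \<epsilon>) * (b - a) + (\<bar>M\<bar> + 2) * \<epsilon>"
    using eventually_at_right_real[OF zero_less_one] by (rule eventually_mono) (use main in auto)
  ultimately show ?thesis
    using tendsto_lowerbound[of _ _ "at_right (0::real)" "\<phi> b - \<phi> a"] by fastforce
qed

text \<open>Testing the increment against its own unit direction reduces it to the scalar
  inequality, without a factor depending on the dimension.\<close>

lemma abs_cont_norm_increment_le:
  fixes \<phi> :: "real \<Rightarrow> 'a::euclidean_space"
  assumes ab: "a \<le> b" and ac: "abs_cont_on {a..b} \<phi>" and Z: "negligible Z"
    and der: "\<And>t. t \<in> {a..b} - Z \<Longrightarrow> \<exists>d. norm d \<le> M \<and> (\<phi> has_vector_derivative d) (at t within {a..b})"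
  shows "norm (\<phi> b - \<phi> a) \<le> M * (b - a)"
proof -
  define u where "u = sgn (\<phi> b - \<phi> a)"
  have u: "norm u \<le> 1" by (auto simp: u_def norm_sgn)
  have "u \<bullet> \<phi> b - u \<bullet> \<phi> a \<le> M * (b - a)"
  proof (rule abs_cont_increment_le[OF ab _ Z])
    show "abs_cont_on {a..b} (\<lambda>t. u \<bullet> \<phi> t)"
    proof (rule abs_cont_on_lipschitz_comp[OF ac, of _ 1])
      fix x y
      have "\<bar>u \<bullet> (\<phi> x - \<phi> y)\<bar> \<le> norm u * norm (\<phi> x - \<phi> y)" by (rule Cauchy_Schwarz_ineq2)
      also have "\<dots> \<le> 1 * norm (\<phi> x - \<phi> y)" using u by (intro mult_right_mono) auto
      finally show "norm (u \<bullet> \<phi> x - u \<bullet> \<phi> y) \<le> 1 * norm (\<phi> x - \<phi> y)" by (simp add: inner_diff_right)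
    qed
    fix t assume "t \<in> {a..b} - Z"
    then obtain d where d: "norm d \<le> M" "(\<phi> has_vector_derivative d) (at t within {a..b})" using der by blast
    have "u \<bullet> d \<le> norm u * norm d" by (rule norm_cauchy_schwarz)
    also have "\<dots> \<le> 1 * norm d" using u by (intro mult_right_mono) auto
    finally have "u \<bullet> d \<le> M" using d by simp
    moreover have "((\<lambda>t. u \<bullet> \<phi> t) has_vector_derivative (u \<bullet> d)) (at t within {a..b})"
      using bounded_linear.has_vector_derivative[OF bounded_linear_inner_right d(2)] .
    ultimately show "\<exists>d\<le>M. ((\<lambda>t. u \<bullet> \<phi> t) has_vector_derivative d) (at t within {a..b})" by blast
  qed
  then have "u \<bullet> (\<phi> b - \<phi> a) \<le> M * (b - a)" by (simp add: inner_diff_right)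
  moreover have "u \<bullet> (\<phi> b - \<phi> a) = norm (\<phi> b - \<phi> a)"
    by (cases "\<phi> b = \<phi> a") (auto simp: u_def sgn_div_norm inner_commute dot_square_norm power2_eq_square)
  ultimately show ?thesis by simp
qed

section \<open>Differential equations with a Lipschitz right-hand side\<close>

text \<open>The oriented integral is a primitive on the whole line, with a two-sided derivative at
  0; \<open>integral {0..t} F\<close> alone would be constant for negative t.\<close>

lemma continuous_antiderivative:
  fixes F :: "real \<Rightarrow> 'a::euclidean_space"
  assumes F: "continuous_on UNIV F"
  obtains \<Phi> where "\<Phi> 0 = 0" "\<And>t. (\<Phi> has_vector_derivative F t) (at t)"
    "\<And>t. 0 \<le> t \<Longrightarrow> integral {0..t} F = \<Phi> t"
proof -
  define \<Phi> where "\<Phi> u = (LBINT y=0..u. F y)" for u :: real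
  have 0: "\<Phi> 0 = 0" by (simp add: \<Phi>_def flip: zero_ereal_def)
  have der: "(\<Phi> has_vector_derivative F t) (at t)" for t
  proof -
    define a where "a = - \<bar>t\<bar> - 1"
    define b where "b = \<bar>t\<bar> + 1"
    have "(\<Phi> has_vector_derivative F t) (at t within {a..b})"
      using interval_integral_FTC2[of a 0 b F t] continuous_on_subset[OF F, of "{a..b}"] unfolding \<Phi>_def
      by (auto simp: a_def b_def zero_ereal_def)
    moreover have "at t within {a..b} = at t"
      by (rule at_within_interior) (auto simp: a_def b_def)
    ultimately show ?thesis by simp
  qed
  moreover have "integral {0..t} F = \<Phi> t" if "0 \<le> t" for t
  proof -
    have "(F has_integral (\<Phi> t - \<Phi> 0)) {0..t}"
      using that der by (intro fundamental_theorem_of_calculus) (auto intro: has_vector_derivative_at_within)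
    then show ?thesis using 0 by (simp add: integral_unique)
  qed
  ultimately show thesis using that 0 by blast
qed

text \<open>Integrating exp (\<kappa> s) gains a factor 1 / \<kappa>; this gain is what beats the
  Lipschitz constant in the Picard estimate.\<close>

lemma exp_weighted_integral_le:
  fixes f :: "real \<Rightarrow> 'a::euclidean_space"
  assumes "0 \<le> m" "0 < \<kappa>" "0 \<le> C" "continuous_on {0..m} f"
    and "\<And>s. s \<in> {0..m} \<Longrightarrow> norm (f s) \<le> C * exp (\<kappa> * s)"
  shows "norm (exp (- \<kappa> * m) *\<^sub>R integral {0..m} f) \<le> C / \<kappa>"
proof -
  have I: "((\<lambda>s. C * exp (\<kappa> * s)) has_integral (C * exp (\<kappa> * m) / \<kappa> - C * exp (\<kappa> * 0) / \<kappa>)) {0..m}"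
    using assms(1,2) by (intro fundamental_theorem_of_calculus)
      (auto intro!: derivative_eq_intros simp: has_real_derivative_iff_has_vector_derivative[symmetric])
  have "norm (integral {0..m} f) \<le> integral {0..m} (\<lambda>s. C * exp (\<kappa> * s))"
    using assms I by (intro integral_norm_bound_integral) (auto intro: integrable_continuous_interval)
  also have "\<dots> = C * exp (\<kappa> * m) / \<kappa> - C / \<kappa>" using integral_unique[OF I] by simp
  also have "\<dots> \<le> C * exp (\<kappa> * m) / \<kappa>" using assms by simp
  finally have "exp (- \<kappa> * m) * norm (integral {0..m} f) \<le> exp (- \<kappa> * m) * (C * exp (\<kappa> * m) / \<kappa>)"
    by (rule mult_left_mono) simp
  also have "\<dots> = C / \<kappa>" by (simp add: exp_minus field_simps)
  finally show ?thesis by simp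
qed

text \<open>Weighting the supremum norm by exp (- \<kappa> t), with \<kappa> twice the Lipschitz constant, makes the
  Picard operator a contraction on the whole half line at once, so that no continuation is needed.\<close>

lemma lipschitz_ode_solution:
  fixes h :: "'a::euclidean_space \<Rightarrow> 'a"
  assumes "\<And>x y. norm (h x - h y) \<le> L * norm (x - y)"
  obtains y where "y 0 = y0" "\<And>t. (y has_vector_derivative h (y (max 0 t))) (at t)"
proof -
  define L' where "L' = max L 1"
  have L': "L' > 0" by (simp add: L'_def)
  have lip: "norm (h x - h y) \<le> L' * norm (x - y)" for x y
    using assms[of x y] by (rule order_trans) (auto simp: L'_def intro: mult_right_mono)
  have "L'-lipschitz_on UNIV h"
    using lip L' by (auto simp: lipschitz_on_def dist_norm)
  then have hc: "continuous_on UNIV h" by (rule lipschitz_on_continuous_on)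
  define \<kappa> where "\<kappa> = 2 * L'"
  have \<kappa>: "\<kappa> > 0" using L' by (simp add: \<kappa>_def)
  \<comment> \<open>\<open>R w\<close> is the trajectory itself and \<open>w\<close> its weighted
    form: only \<open>w\<close> has to be bounded, the trajectory may grow exponentially.\<close>
  define R where "R w t = exp (\<kappa> * t) *\<^sub>R apply_bcontfun w t" for w :: "real \<Rightarrow>\<^sub>C 'a" and t
  \<comment> \<open>The space of bounded continuous functions lives on the whole line, so the value
    \<open>y0\<close> is kept for negative times.\<close>
  define Op where "Op w t = exp (- \<kappa> * max 0 t) *\<^sub>R (y0 + integral {0..max 0 t} (\<lambda>s. h (R w s)))" for w t
  have cR: "continuous_on S (\<lambda>s. h (R w s))" for S w
    unfolding R_def by (intro continuous_on_compose2[OF hc] continuous_intros) auto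
  have "Op w \<in> bcontfun" for w
    unfolding bcontfun_def
  proof (intro CollectI conjI)
    obtain \<Phi> where \<Phi>: "\<And>t. (\<Phi> has_vector_derivative h (R w t)) (at t)"
        "\<And>t. 0 \<le> t \<Longrightarrow> integral {0..t} (\<lambda>s. h (R w s)) = \<Phi> t"
      by (rule continuous_antiderivative[OF cR[of UNIV w]]) (rule that)
    have "continuous_on UNIV \<Phi>"
      by (intro continuous_at_imp_continuous_on ballI has_vector_derivative_continuous[OF \<Phi>(1)])
    then have "continuous_on UNIV (\<lambda>t. exp (- \<kappa> * max 0 t) *\<^sub>R (y0 + \<Phi> (max 0 t)))"
      by (intro continuous_intros continuous_on_compose2[of UNIV \<Phi> UNIV "\<lambda>t. max 0 t"]) simp_all
    then show "continuous_on UNIV (Op w)" unfolding Op_def by (simp add: \<Phi>(2))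
    define b where "b = dist w (const_bcontfun 0)"
    have b: "norm (apply_bcontfun w t) \<le> b" for t
      using dist_bounded[of w t "const_bcontfun 0"] by (simp add: b_def const_bcontfun.rep_eq)
    have b0: "b \<ge> 0" by (simp add: b_def)
    have "norm (Op w t) \<le> norm y0 + (norm (h 0) + L' * b) / \<kappa>" for t
    proof -
      let ?m = "max 0 t"
      have "norm (exp (- \<kappa> * ?m) *\<^sub>R integral {0..?m} (\<lambda>s. h (R w s))) \<le> (norm (h 0) + L' * b) / \<kappa>"
      proof (rule exp_weighted_integral_le)
        fix s assume s: "s \<in> {0..?m}"
        have "norm (h (R w s)) \<le> norm (h 0) + norm (h (R w s) - h 0)"
          using norm_triangle_sub by blast
        also have "\<dots> \<le> norm (h 0) * 1 + L' * norm (R w s)" using lip[of "R w s" 0] by simp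
        also have "\<dots> \<le> norm (h 0) * exp (\<kappa> * s) + L' * (exp (\<kappa> * s) * b)"
          using s \<kappa> L' b by (intro add_mono mult_left_mono) (auto simp: R_def)
        finally show "norm (h (R w s)) \<le> (norm (h 0) + L' * b) * exp (\<kappa> * s)" by (simp add: algebra_simps)
      qed (use \<kappa> L' b0 cR in auto)
      moreover have "norm (exp (- \<kappa> * ?m) *\<^sub>R y0) \<le> 1 * norm y0"
        unfolding norm_scaleR using \<kappa> by (intro mult_right_mono) auto
      ultimately show ?thesis
        unfolding Op_def scaleR_add_right by (intro order_trans[OF norm_triangle_ineq]) linarith
    qed
    then show "bounded (range (Op w))" by (auto simp: bounded_iff)
  qed
  then have Op: "apply_bcontfun (Bcontfun (Op w)) = Op w" for w by (simp add: Bcontfun_inverse)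
  have "\<exists>!w. Bcontfun (Op w) = w"
  proof (rule banach_fix_type[of "1/2"])
    show "\<forall>w w'. dist (Bcontfun (Op w)) (Bcontfun (Op w')) \<le> 1 / 2 * dist w w'"
    proof (intro allI dist_bound)
      fix w w' :: "real \<Rightarrow>\<^sub>C 'a" and t :: real
      let ?m = "max 0 t"
      have "Op w t - Op w' t = exp (- \<kappa> * ?m) *\<^sub>R (integral {0..?m} (\<lambda>s. h (R w s)) - integral {0..?m} (\<lambda>s. h (R w' s)))"
        by (simp add: Op_def algebra_simps)
      also have "\<dots> = exp (- \<kappa> * ?m) *\<^sub>R integral {0..?m} (\<lambda>s. h (R w s) - h (R w' s))"
        by (subst integral_diff) (auto intro!: integrable_continuous_interval cR)
      finally have e: "Op w t - Op w' t = \<dots>" .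
      have "norm \<dots> \<le> (L' * dist w w') / \<kappa>"
      proof (rule exp_weighted_integral_le)
        fix s assume s: "s \<in> {0..?m}"
        have "norm (h (R w s) - h (R w' s)) \<le> L' * norm (R w s - R w' s)" by (rule lip)
        also have "norm (R w s - R w' s) = exp (\<kappa> * s) * dist (apply_bcontfun w s) (apply_bcontfun w' s)"
          by (simp add: R_def dist_norm flip: scaleR_diff_right)
        also have "L' * \<dots> \<le> L' * (exp (\<kappa> * s) * dist w w')"
          using L' by (intro mult_left_mono dist_bounded) auto
        finally show "norm (h (R w s) - h (R w' s)) \<le> L' * dist w w' * exp (\<kappa> * s)" by (simp add: algebra_simps)
      qed (use \<kappa> L' cR in \<open>auto intro!: continuous_intros\<close>)
      also have "\<dots> = 1 / 2 * dist w w'" using L' by (simp add: \<kappa>_def)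
      finally show "dist (apply_bcontfun (Bcontfun (Op w)) t) (apply_bcontfun (Bcontfun (Op w')) t) \<le> 1 / 2 * dist w w'"
        unfolding Op dist_norm e .
    qed
  qed auto
  then obtain w where "Bcontfun (Op w) = w" by blast
  then have w: "Op w t = apply_bcontfun w t" for t :: real using Op by metis
  have R: "R w t = y0 + integral {0..t} (\<lambda>s. h (R w s))" if "t \<ge> 0" for t
    using that unfolding R_def[of w t] w[of t, symmetric] Op_def
    by (simp add: mult_exp_exp)
  \<comment> \<open>Freezing the right-hand side before time 0 continues the solution by a straight
    line, which gives a two-sided derivative at 0.\<close>
  have cont: "continuous_on UNIV (\<lambda>t. h (R w (max 0 t)))"
    by (rule continuous_on_compose2[OF cR[of UNIV w]]) (auto intro!: continuous_intros)
  obtain \<Phi> where \<Phi>: "\<Phi> 0 = 0" "\<And>t. (\<Phi> has_vector_derivative h (R w (max 0 t))) (at t)"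
      "\<And>t. 0 \<le> t \<Longrightarrow> integral {0..t} (\<lambda>t. h (R w (max 0 t))) = \<Phi> t"
    by (rule continuous_antiderivative[OF cont]) (rule that)
  have eq: "y0 + \<Phi> t = R w t" if "t \<ge> 0" for t
  proof -
    have "integral {0..t} (\<lambda>s. h (R w (max 0 s))) = integral {0..t} (\<lambda>s. h (R w s))"
      by (intro integral_cong) auto
    then show ?thesis using R[OF that] \<Phi>(3)[OF that] by simp
  qed
  show thesis
  proof (rule that[of "\<lambda>t. y0 + \<Phi> t"])
    show "y0 + \<Phi> 0 = y0" using \<Phi> by simp
    fix t
    show "((\<lambda>t. y0 + \<Phi> t) has_vector_derivative h (y0 + \<Phi> (max 0 t))) (at t)"
      unfolding eq[OF max.cobounded1] using \<Phi>(2)[of t] by (auto intro!: derivative_eq_intros)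
  qed
qed

section \<open>Diagonal dilations\<close>

text \<open>This is exp (s diag r) applied to z, and \<open>scl r\<close> is its generator. The
  weights are a parameter because the map is needed with \<open>r\<close> for states and with
  \<open>r + \<mu>\<close> for velocities.\<close>

definition dl :: "('n::finite \<Rightarrow> real) \<Rightarrow> real \<Rightarrow> real^'n \<Rightarrow> real^'n" where
  "dl r s z = (\<chi> k. exp (s * r k) * z $ k)"

definition scl :: "('n::finite \<Rightarrow> real) \<Rightarrow> real^'n \<Rightarrow> real^'n" where
  "scl r z = (\<chi> k. r k * z $ k)"

lemma dl_nth [simp]: "dl r s z $ k = exp (s * r k) * z $ k"
  by (simp add: dl_def)

lemma scl_nth [simp]: "scl r z $ k = r k * z $ k"
  by (simp add: scl_def)

lemma dl_0 [simp]: "dl r 0 z = z" "dl r s 0 = 0"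
  by (simp_all add: vec_eq_iff)

lemma dl_dl [simp]: "dl r s (dl r t z) = dl r (s + t) z"
  by (simp add: vec_eq_iff distrib_right exp_add)

lemma dl_eq_0_iff [simp]: "dl r s z = 0 \<longleftrightarrow> z = 0"
  by (simp add: vec_eq_iff)

lemma linear_dl: "linear (dl r s)"
  by (rule linearI) (simp_all add: vec_eq_iff algebra_simps)

lemmas dl_diff = linear_diff[OF linear_dl] and dl_minus = linear_neg[OF linear_dl]
  and dl_scaleR = linear_scale[OF linear_dl]

lemma linear_scl: "linear (scl r)"
  by (rule linearI) (simp_all add: vec_eq_iff algebra_simps)

lemma norm_le_nth_mult:
  fixes x y :: "real^'n::finite"
  assumes "\<And>k. \<bar>x $ k\<bar> \<le> c * \<bar>y $ k\<bar>" "0 \<le> c"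
  shows "norm x \<le> c * norm y"
proof -
  have "norm x \<le> norm (c *\<^sub>R y)"
    using assms by (intro norm_le_componentwise_cart) (auto simp: abs_mult)
  then show ?thesis using assms by simp
qed

lemma norm_scl_le: "norm (scl r z) \<le> (\<Sum>k\<in>UNIV. \<bar>r k\<bar>) * norm z"
  by (rule norm_le_nth_mult)
     (auto simp: abs_mult intro!: mult_right_mono sum_nonneg member_le_sum[where f="\<lambda>k. \<bar>r k\<bar>"])

lemma norm_dl_le:
  assumes "\<bar>s\<bar> \<le> S"
  shows "norm (dl r s z) \<le> exp (S * (\<Sum>k\<in>UNIV. \<bar>r k\<bar>)) * norm z"
proof (rule norm_le_nth_mult)
  fix k
  have "s * r k \<le> \<bar>s\<bar> * \<bar>r k\<bar>" by (metis abs_ge_self abs_mult)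
  also have "\<dots> \<le> S * (\<Sum>k\<in>UNIV. \<bar>r k\<bar>)"
    using assms by (intro mult_mono member_le_sum) auto
  finally show "\<bar>dl r s z $ k\<bar> \<le> exp (S * (\<Sum>k\<in>UNIV. \<bar>r k\<bar>)) * \<bar>z $ k\<bar>"
    by (auto simp: abs_mult intro!: mult_right_mono)
qed simp

lemma has_vector_derivative_vec_iff:
  fixes f :: "real \<Rightarrow> ('a::real_normed_vector)^'n::finite"
  shows "(f has_vector_derivative f') (at t within T) \<longleftrightarrow>
    (\<forall>i. ((\<lambda>t. f t $ i) has_vector_derivative f' $ i) (at t within T))" (is "?l \<longleftrightarrow> ?r")
proof
  assume ?l then show ?r
    by (auto intro: bounded_linear.has_vector_derivative[OF bounded_linear_vec_nth])
next
  assume r: ?r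
  show ?l
    unfolding has_vector_derivative_def has_derivative_within
  proof (intro conjI vec_tendstoI)
    fix i
    show "((\<lambda>y. ((1 / norm (y - t)) *\<^sub>R (f y - (f t + (y - t) *\<^sub>R f'))) $ i) \<longlongrightarrow> 0 $ i) (at t within T)"
      using r unfolding has_vector_derivative_def has_derivative_within by simp
  qed (rule bounded_linear_scaleR_left)
qed

text \<open>In polar coordinates the dilation parameter and the point move together; the second
  summand is the motion along the dilation orbit.\<close>

lemma dl_comp_has_vector_derivative:
  assumes "(s has_real_derivative s') (at t within T)" "(w has_vector_derivative w') (at t within T)"
  shows "((\<lambda>t. dl r (s t) (w t)) has_vector_derivative
    dl r (s t) w' + s' *\<^sub>R scl r (dl r (s t) (w t))) (at t within T)"
  unfolding has_vector_derivative_vec_iff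
proof
  fix k
  have w: "((\<lambda>t. w t $ k) has_real_derivative w' $ k) (at t within T)"
    using assms(2) by (simp add: has_vector_derivative_vec_iff has_real_derivative_iff_has_vector_derivative)
  have "((\<lambda>t. exp (s t * r k) * w t $ k) has_real_derivative
      exp (s t * r k) * w' $ k + s' * (r k * (exp (s t * r k) * w t $ k))) (at t within T)"
    using assms(1) w by (auto intro!: derivative_eq_intros)
  then show "((\<lambda>t. dl r (s t) (w t) $ k) has_vector_derivative
      (dl r (s t) w' + s' *\<^sub>R scl r (dl r (s t) (w t))) $ k) (at t within T)"
    by (simp add: has_real_derivative_iff_has_vector_derivative)
qed

lemma dl_has_vector_derivative:
  "((\<lambda>s. dl r s z) has_vector_derivative scl r (dl r s z)) (at s within T)"
  using dl_comp_has_vector_derivative[where s="\<lambda>s. s" and s'=1 and w="\<lambda>_. z" and w'=0 and t=s and T=T and r=r]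
  by (simp add: linear_0[OF linear_dl])

lemma norm_dl_diff_le:
  assumes "\<bar>s\<bar> \<le> S" "\<bar>t\<bar> \<le> S"
  shows "norm (dl r s z - dl r t z)
    \<le> (\<Sum>k\<in>UNIV. \<bar>r k\<bar>) * exp (S * (\<Sum>k\<in>UNIV. \<bar>r k\<bar>)) * norm z * \<bar>s - t\<bar>"
proof -
  have "norm (dl r s z - dl r t z) \<le> (\<Sum>k\<in>UNIV. \<bar>r k\<bar>) * (exp (S * (\<Sum>k\<in>UNIV. \<bar>r k\<bar>)) * norm z) * norm (s - t)"
  proof (rule differentiable_bound[of "{-S..S}" _ "\<lambda>s h. h *\<^sub>R scl r (dl r s z)"])
    fix x assume "x \<in> {-S..S}"
    show "((\<lambda>s. dl r s z) has_derivative (\<lambda>h. h *\<^sub>R scl r (dl r x z))) (at x within {-S..S})"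
      using dl_has_vector_derivative by (simp add: has_vector_derivative_def)
    have "norm (scl r (dl r x z)) \<le> (\<Sum>k\<in>UNIV. \<bar>r k\<bar>) * (exp (S * (\<Sum>k\<in>UNIV. \<bar>r k\<bar>)) * norm z)"
      using \<open>x \<in> {-S..S}\<close>
      by (intro order_trans[OF norm_scl_le] mult_left_mono norm_dl_le sum_nonneg) auto
    then show "onorm (\<lambda>h. h *\<^sub>R scl r (dl r x z)) \<le> (\<Sum>k\<in>UNIV. \<bar>r k\<bar>) * (exp (S * (\<Sum>k\<in>UNIV. \<bar>r k\<bar>)) * norm z)"
      by (intro onorm_le) (simp add: mult.commute mult_left_mono)
  qed (use assms in auto)
  then show ?thesis by (simp add: mult_ac)
qed

section \<open>The homogeneous closed loop of one follower\<close>

text \<open>What remains of the control problem: \<open>H\<close> is the closed loop on the unit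
  sphere, and \<open>scl_pos\<close> and \<open>H_neg\<close> are the two matrix inequalities read
  at P x. The weights \<open>r k + \<mu>\<close> govern the field near 0; they are allowed to vanish
  in order to include \<mu> = -1.\<close>

locale homogeneous_loop =
  fixes r :: "'n::finite \<Rightarrow> real" and \<mu> :: real and P :: "real^'n^'n" and H :: "real^'n \<Rightarrow> real^'n"
  assumes linear_H: "linear H"
    and P_sym: "x \<bullet> (P *v y) = y \<bullet> (P *v x)"
    and P_pos: "x \<noteq> 0 \<Longrightarrow> 0 < x \<bullet> (P *v x)"
    and scl_pos: "x \<noteq> 0 \<Longrightarrow> 0 < (P *v x) \<bullet> scl r x"
    and H_neg: "x \<noteq> 0 \<Longrightarrow> (P *v x) \<bullet> H x < 0"
    and r_pos: "0 < r k"
    and r_mu: "0 \<le> r k + \<mu>"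
begin

text \<open>The square of \<open>wnorm P\<close>: it has the same unit sphere, but is smooth at 0 as
  well.\<close>

definition q :: "real^'n \<Rightarrow> real" where "q x = x \<bullet> (P *v x)"

text \<open>Both sides are quadratic, so it is enough to compare the minimum of the form with the
  maximum of \<open>q\<close> on the compact Euclidean unit sphere.\<close>

lemma form_bound:
  fixes f :: "real^'n \<Rightarrow> real^'n"
  assumes f: "linear f" and pos: "\<And>x. x \<noteq> 0 \<Longrightarrow> 0 < (P *v x) \<bullet> f x"
  obtains c where "0 < c" "\<And>x. c * q x \<le> (P *v x) \<bullet> f x"
proof -
  have cont: "continuous_on S (\<lambda>x. (P *v x) \<bullet> f x)" "continuous_on S q" for S
    unfolding q_def
    by (intro continuous_intros linear_continuous_on linear_linear[THEN iffD2] f matrix_vector_mul_linear)+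
  have ne: "sphere (0::real^'n) 1 \<noteq> {}" by simp
  obtain x0 where x0: "x0 \<in> sphere 0 1" "\<And>x. x \<in> sphere 0 1 \<Longrightarrow> (P *v x0) \<bullet> f x0 \<le> (P *v x) \<bullet> f x"
    using continuous_attains_inf[OF compact_sphere ne cont(1)] by auto
  obtain x1 where x1: "x1 \<in> sphere 0 1" "\<And>x. x \<in> sphere 0 1 \<Longrightarrow> q x \<le> q x1"
    using continuous_attains_sup[OF compact_sphere ne cont(2)] by auto
  have "x0 \<noteq> 0" "x1 \<noteq> 0" using x0(1) x1(1) by force+
  then have p: "0 < (P *v x0) \<bullet> f x0" "0 < q x1"
    using pos[of x0] P_pos[of x1] by (auto simp: q_def)
  show thesis
  proof (rule that)
    show "0 < (P *v x0) \<bullet> f x0 / q x1" using p by simp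
    fix x
    show "(P *v x0) \<bullet> f x0 / q x1 * q x \<le> (P *v x) \<bullet> f x"
    proof (cases "x = 0")
      case False
      define y where "y = (1 / norm x) *\<^sub>R x"
      have y: "y \<in> sphere 0 1" "x = norm x *\<^sub>R y" using False by (auto simp: y_def)
      have "(P *v x0) \<bullet> f x0 / q x1 * q y \<le> (P *v x0) \<bullet> f x0 / q x1 * q x1"
        using p x1(2)[OF y(1)] by (intro mult_left_mono) auto
      also have "\<dots> \<le> (P *v y) \<bullet> f y" using x0(2)[OF y(1)] p by simp
      finally have "(norm x)\<^sup>2 * ((P *v x0) \<bullet> f x0 / q x1 * q y) \<le> (norm x)\<^sup>2 * ((P *v y) \<bullet> f y)"
        by (rule mult_left_mono) simp
      moreover have "q x = (norm x)\<^sup>2 * q y"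
        by (subst y(2)) (simp add: q_def matrix_vector_mult_scaleR power2_eq_square)
      moreover have "(P *v x) \<bullet> f x = (norm x)\<^sup>2 * ((P *v y) \<bullet> f y)"
        by (subst (1 2) y(2)) (simp add: linear_scale[OF f] matrix_vector_mult_scaleR power2_eq_square)
      ultimately show ?thesis by (simp add: mult_ac)
    qed (simp add: q_def linear_0[OF f])
  qed
qed

lemma q_pos: "x \<noteq> 0 \<Longrightarrow> 0 < q x" and q_0 [simp]: "q 0 = 0"
  using P_pos by (auto simp: q_def)

lemma q_nonneg: "0 \<le> q x"
  by (cases "x = 0") (auto intro: less_imp_le[OF q_pos])

lemma q_minus [simp]: "q (- x) = q x"
  by (simp add: q_def linear_neg[OF matrix_vector_mul_linear])

lemma continuous_q: "continuous_on S q"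
  unfolding q_def
  by (intro continuous_intros linear_continuous_on linear_linear[THEN iffD2] matrix_vector_mul_linear)

lemma norm_sq_le_q:
  obtains c where "0 < c" "\<And>x. c * (norm x)\<^sup>2 \<le> q x"
proof -
  have ne: "sphere (0::real^'n) 1 \<noteq> {}" by simp
  obtain x0 where x0: "x0 \<in> sphere 0 1" "\<And>x. x \<in> sphere 0 1 \<Longrightarrow> q x0 \<le> q x"
    using continuous_attains_inf[OF compact_sphere ne continuous_q] by auto
  show thesis
  proof (rule that)
    show "0 < q x0" using x0(1) q_pos[of x0] by force
    fix x
    show "q x0 * (norm x)\<^sup>2 \<le> q x"
    proof (cases "x = 0")
      case False
      define y where "y = (1 / norm x) *\<^sub>R x"
      have y: "y \<in> sphere 0 1" "x = norm x *\<^sub>R y" using False by (auto simp: y_def)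
      have "q x = (norm x)\<^sup>2 * q y"
        by (subst y(2)) (simp add: q_def matrix_vector_mult_scaleR power2_eq_square)
      then show ?thesis using mult_right_mono[OF x0(2)[OF y(1)], of "(norm x)\<^sup>2"] by (simp add: mult_ac)
    qed simp
  qed
qed

text \<open>By symmetry of \<open>P\<close>, q x - q y factors as (x - y) \<bullet> P (x +
  y).\<close>

lemma q_diff_le:
  obtains c where "0 < c" "\<And>x y. \<bar>q x - q y\<bar> \<le> c * norm (x - y) * (norm x + norm y)"
proof -
  have "bounded_linear (\<lambda>x. P *v x)" by (simp add: linear_linear matrix_vector_mul_linear)
  then obtain c where c: "0 < c" "\<And>x. norm (P *v x) \<le> norm x * c"
    using bounded_linear.pos_bounded by blast
  show thesis
  proof (rule that[OF c(1)])
    fix x y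
    have "q x - q y = (x - y) \<bullet> (P *v (x + y))"
      using P_sym[of x y] by (simp add: q_def matrix_vector_right_distrib inner_diff_left inner_add_right)
    then have "\<bar>q x - q y\<bar> \<le> norm (x - y) * norm (P *v (x + y))" using Cauchy_Schwarz_ineq2 by metis
    also have "\<dots> \<le> norm (x - y) * ((norm x + norm y) * c)"
      by (intro mult_left_mono order_trans[OF c(2)] mult_right_mono norm_triangle_ineq) (use c in auto)
    finally show "\<bar>q x - q y\<bar> \<le> c * norm (x - y) * (norm x + norm y)" by (simp add: mult_ac)
  qed
qed

lemma q_has_real_derivative:
  assumes "(w has_vector_derivative w') (at t within T)"
  shows "((\<lambda>t. q (w t)) has_real_derivative 2 * ((P *v w t) \<bullet> w')) (at t within T)"
proof -
  have "((\<lambda>t. P *v w t) has_vector_derivative P *v w') (at t within T)"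
    by (rule bounded_linear.has_vector_derivative[OF _ assms]) (simp add: linear_linear matrix_vector_mul_linear)
  then have "((\<lambda>t. w t \<bullet> (P *v w t)) has_derivative
      (\<lambda>h. w t \<bullet> (h *\<^sub>R (P *v w')) + (h *\<^sub>R w') \<bullet> (P *v w t))) (at t within T)"
    using assms unfolding has_vector_derivative_def by (intro has_derivative_inner)
  moreover have "w t \<bullet> (P *v w') = (P *v w t) \<bullet> w'" "w' \<bullet> (P *v w t) = (P *v w t) \<bullet> w'"
    using P_sym[of "w t" w'] by (simp_all add: inner_commute)
  ultimately have "((\<lambda>t. w t \<bullet> (P *v w t)) has_derivative (\<lambda>h. h * (2 * ((P *v w t) \<bullet> w')))) (at t within T)"
    by (simp add: algebra_simps)
  then show ?thesis
    unfolding q_def has_field_derivative_def by (rule has_derivative_eq_rhs) (simp add: fun_eq_iff)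
qed

section \<open>The canonical homogeneous norm\<close>

text \<open>Half the exponential rate at which \<open>q\<close> shrinks under contracting dilations,
  fixed once so that all later estimates share it.\<close>

definition c_r :: real where "c_r = (SOME c. 0 < c \<and> (\<forall>x. c * q x \<le> (P *v x) \<bullet> scl r x))"

lemma c_r: "0 < c_r" "c_r * q x \<le> (P *v x) \<bullet> scl r x"
proof -
  obtain c where "0 < c" "\<And>x. c * q x \<le> (P *v x) \<bullet> scl r x"
    using form_bound[OF linear_scl scl_pos] by blast
  then have "\<exists>c. 0 < c \<and> (\<forall>x. c * q x \<le> (P *v x) \<bullet> scl r x)" by blast
  from someI_ex[OF this] show "0 < c_r" "c_r * q x \<le> (P *v x) \<bullet> scl r x" by (auto simp: c_r_def)
qed

lemma q_dl_has_real_derivative: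
  "((\<lambda>s. q (dl r (- s) z)) has_real_derivative
     - 2 * ((P *v dl r (- s) z) \<bullet> scl r (dl r (- s) z))) (at s within T)"
proof -
  have "(uminus has_real_derivative - 1) (at s within T)" by (auto intro!: derivative_eq_intros)
  then have "((\<lambda>s. dl r (- s) z) has_vector_derivative - scl r (dl r (- s) z)) (at s within T)"
    using dl_comp_has_vector_derivative[where s=uminus and s'="-1" and w="\<lambda>_. z" and w'=0 and t=s and T=T and r=r]
    by (simp add: linear_0[OF linear_dl])
  from q_has_real_derivative[OF this] show ?thesis by simp
qed

text \<open>The derivative of q times exp (2 c_r s) is a positive multiple of c_r q minus the form
  of \<open>scl r\<close>, hence not positive. This quantitative monotonicity yields existence and
  uniqueness of the dilation onto the unit sphere, and also the Lipschitz bound for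
  \<open>\<sigma>\<close>.\<close>

lemma q_dl_decay:
  assumes "s \<le> t"
  shows "q (dl r (- t) z) * exp (2 * c_r * (t - s)) \<le> q (dl r (- s) z)"
proof -
  have "q (dl r (- t) z) * exp (2 * c_r * t) \<le> q (dl r (- s) z) * exp (2 * c_r * s)"
  proof (rule DERIV_nonpos_imp_nonincreasing[OF assms])
    fix x
    let ?w = "dl r (- x) z"
    have d: "((\<lambda>s. q (dl r (- s) z) * exp (2 * c_r * s)) has_real_derivative
       (- 2 * ((P *v ?w) \<bullet> scl r ?w)) * exp (2 * c_r * x) + q ?w * (exp (2 * c_r * x) * (2 * c_r))) (at x)"
      by (auto intro!: derivative_eq_intros q_dl_has_real_derivative)
    have "(- 2 * ((P *v ?w) \<bullet> scl r ?w)) * exp (2 * c_r * x) + q ?w * (exp (2 * c_r * x) * (2 * c_r))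
        = 2 * exp (2 * c_r * x) * (c_r * q ?w - (P *v ?w) \<bullet> scl r ?w)" by (simp add: algebra_simps)
    also have "\<dots> \<le> 0" using c_r(2)[of ?w] by (intro mult_nonneg_nonpos) auto
    finally show "\<exists>y. ((\<lambda>s. q (dl r (- s) z) * exp (2 * c_r * s)) has_real_derivative y) (at x) \<and> y \<le> 0"
      using d by blast
  qed
  then have "q (dl r (- t) z) * exp (2 * c_r * t) * exp (- (2 * c_r * s)) \<le> q (dl r (- s) z) * exp (2 * c_r * s) * exp (- (2 * c_r * s))"
    by (rule mult_right_mono) simp
  then show ?thesis by (simp add: mult.assoc algebra_simps flip: exp_add)
qed

lemma q_dl_strict_decay:
  assumes "s < t" "z \<noteq> 0"
  shows "q (dl r (- t) z) < q (dl r (- s) z)"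
proof -
  have "q (dl r (- t) z) * 1 < q (dl r (- t) z) * exp (2 * c_r * (t - s))"
    using assms c_r(1) q_pos[of "dl r (- t) z"] by (intro mult_strict_left_mono) auto
  then show ?thesis using q_dl_decay[of s t z] assms by simp
qed

lemma continuous_q_dl: "continuous_on S (\<lambda>s. q (dl r (- s) z))"
  unfolding continuous_on_eq_continuous_within
  by (intro ballI DERIV_continuous[OF q_dl_has_real_derivative])

lemma ex1_dilation:
  assumes "z \<noteq> 0"
  shows "\<exists>!s. q (dl r (- s) z) = 1"
proof -
  \<comment> \<open>At this parameter the exponential factor of \<open>q_dl_decay\<close> equals q
    z, so the value 1 is passed between 0 and \<open>s0\<close>, on whichever side \<open>s0\<close>
    lies.\<close>
  define s0 where "s0 = ln (q z) / (2 * c_r)"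
  have qz: "q z > 0" using q_pos assms by simp
  have e: "exp (2 * c_r * s0) = q z" using c_r(1) qz by (simp add: s0_def)
  have "\<exists>s. q (dl r (- s) z) = 1"
  proof (cases "q z \<ge> 1")
    case True
    then have "s0 \<ge> 0" using c_r(1) by (simp add: s0_def)
    have "q (dl r (- s0) z) * q z \<le> q z" using q_dl_decay[OF \<open>s0 \<ge> 0\<close>, of z] e by simp
    then have "q (dl r (- s0) z) \<le> 1" using qz by simp
    then show ?thesis
      using IVT2'[of "\<lambda>s. q (dl r (- s) z)" s0 1 0] True \<open>s0 \<ge> 0\<close> continuous_q_dl by auto
  next
    case False
    then have "s0 \<le> 0" using c_r(1) qz by (simp add: s0_def divide_nonpos_pos)
    have "q z * exp (2 * c_r * (- s0)) \<le> q (dl r (- s0) z)" using q_dl_decay[OF \<open>s0 \<le> 0\<close>, of z] by simp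
    moreover have "exp (2 * c_r * (- s0)) = 1 / q z" using e by (simp add: exp_minus field_simps)
    ultimately have "1 \<le> q (dl r (- s0) z)" using qz by simp
    then show ?thesis
      using IVT2'[of "\<lambda>s. q (dl r (- s) z)" 0 1 s0] False \<open>s0 \<le> 0\<close> continuous_q_dl by auto
  qed
  moreover have "s = t" if "q (dl r (- s) z) = 1" "q (dl r (- t) z) = 1" for s t
    using q_dl_strict_decay[of s t z] q_dl_strict_decay[of t s z] assms that by (cases s t rule: linorder_cases) auto
  ultimately show ?thesis by blast
qed

text \<open>The logarithm of the canonical homogeneous norm, on which dilations act by
  translation.\<close>

definition \<sigma> :: "real^'n \<Rightarrow> real" where "\<sigma> z = (THE s. q (dl r (- s) z) = 1)"

lemma q_sigma: "z \<noteq> 0 \<Longrightarrow> q (dl r (- \<sigma> z) z) = 1"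
  unfolding \<sigma>_def by (rule theI'[OF ex1_dilation])

lemma sigma_eqI: "q (dl r (- s) z) = 1 \<Longrightarrow> \<sigma> z = s"
proof -
  assume s: "q (dl r (- s) z) = 1"
  then have "z \<noteq> 0" by auto
  then show "\<sigma> z = s" using s q_sigma ex1_dilation by metis
qed

text \<open>Replaces the implicitly defined \<open>\<sigma>\<close> by a quadratic inequality at a
  fixed dilation, which remains meaningful at 0.\<close>

lemma sigma_le_iff:
  assumes "z \<noteq> 0"
  shows "\<sigma> z \<le> s \<longleftrightarrow> q (dl r (- s) z) \<le> 1"
  using q_dl_strict_decay[of s "\<sigma> z" z] q_dl_strict_decay[of "\<sigma> z" s z] q_sigma[OF assms] assms
  by (cases s "\<sigma> z" rule: linorder_cases) auto

lemma sigma_minus: "z \<noteq> 0 \<Longrightarrow> \<sigma> (- z) = \<sigma> z"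
  using q_sigma[of z] by (intro sigma_eqI) (simp add: dl_minus)

text \<open>The closed-loop field in homogeneous form: project to the unit sphere, apply the linear
  map \<open>H\<close>, and transport the velocity back with weights raised by the degree
  \<mu>.\<close>

definition g :: "real^'n \<Rightarrow> real^'n" where
  "g z = (if z = 0 then 0 else dl (\<lambda>k. r k + \<mu>) (\<sigma> z) (H (dl r (- \<sigma> z) z)))"

lemma g_0 [simp]: "g 0 = 0" by (simp add: g_def)

lemma g_minus: "g (- z) = - g z"
  by (simp add: g_def sigma_minus dl_minus linear_neg[OF linear_H])

end

text \<open>The difference is split into a change of the vector at a fixed dilation and a change of
  the dilation at a fixed vector. The result has the shape of the hypotheses on \<open>u\<close>, so
  the lemma can be applied to the inner and then to the outer dilation in \<open>g\<close>.\<close>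

lemma dl_lipschitz:
  fixes u :: "'a::real_normed_vector \<Rightarrow> real^'n::finite"
  assumes \<tau>: "\<forall>x\<in>B. \<bar>\<tau> x\<bar> \<le> S" "\<forall>x\<in>B. \<forall>y\<in>B. \<bar>\<tau> x - \<tau> y\<bar> \<le> L * norm (x - y)"
    and u: "\<forall>x\<in>B. norm (u x) \<le> M" "\<forall>x\<in>B. \<forall>y\<in>B. norm (u x - u y) \<le> L' * norm (x - y)"
  shows "\<exists>L'' M''. (\<forall>x\<in>B. norm (dl r (\<tau> x) (u x)) \<le> M'') \<and>
    (\<forall>x\<in>B. \<forall>y\<in>B. norm (dl r (\<tau> x) (u x) - dl r (\<tau> y) (u y)) \<le> L'' * norm (x - y))"
proof -
  let ?R = "\<Sum>k\<in>UNIV. \<bar>r k\<bar>"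
  let ?E = "exp (S * ?R)"
  have R: "?R \<ge> 0" by (simp add: sum_nonneg)
  show ?thesis
  proof (intro exI conjI ballI)
    fix x assume x: "x \<in> B"
    show "norm (dl r (\<tau> x) (u x)) \<le> ?E * M"
      using norm_dl_le[OF \<tau>(1)[rule_format, OF x], of r "u x"] u(1) x by (meson exp_ge_zero mult_left_mono order_trans)
  next
    fix x y assume x: "x \<in> B" and y: "y \<in> B"
    have M: "0 \<le> M" using u(1)[rule_format, OF y] norm_ge_zero order_trans by blast
    have "dl r (\<tau> x) (u x) - dl r (\<tau> y) (u y) = dl r (\<tau> x) (u x - u y) + (dl r (\<tau> x) (u y) - dl r (\<tau> y) (u y))"
      by (simp add: dl_diff)
    also have "norm \<dots> \<le> norm (dl r (\<tau> x) (u x - u y)) + norm (dl r (\<tau> x) (u y) - dl r (\<tau> y) (u y))"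
      by (rule norm_triangle_ineq)
    also have "\<dots> \<le> ?E * norm (u x - u y) + ?R * ?E * norm (u y) * \<bar>\<tau> x - \<tau> y\<bar>"
      by (intro add_mono norm_dl_le norm_dl_diff_le \<tau>(1)[rule_format] x y)
    also have "\<dots> \<le> ?E * (L' * norm (x - y)) + ?R * ?E * M * (L * norm (x - y))"
      using u(1)[rule_format, OF y] norm_ge_zero[of "u y"] R M
      by (intro add_mono mult_mono mult_left_mono u(2)[rule_format] \<tau>(2)[rule_format] x y mult_nonneg_nonneg) auto
    finally show "norm (dl r (\<tau> x) (u x) - dl r (\<tau> y) (u y)) \<le> (?E * L' + ?R * ?E * M * L) * norm (x - y)"
      by (simp add: algebra_simps)
  qed
qed

text \<open>Nonnegative weights make only an upper bound on s necessary. Near 0 this is essential,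
  since \<open>\<sigma>\<close> has no lower bound there.\<close>

lemma norm_dl_le_of_nonneg:
  assumes "\<And>k. 0 \<le> r k" "s \<le> S" "0 \<le> S"
  shows "norm (dl r s z) \<le> exp (S * (\<Sum>k\<in>UNIV. r k)) * norm z"
proof (rule norm_le_nth_mult)
  fix k
  have "s * r k \<le> S * (\<Sum>k\<in>UNIV. r k)"
    using assms by (intro order_trans[OF mult_right_mono[of s S]] mult_left_mono member_le_sum) auto
  then show "\<bar>dl r s z $ k\<bar> \<le> exp (S * (\<Sum>k\<in>UNIV. r k)) * \<bar>z $ k\<bar>"
    by (auto simp: abs_mult intro!: mult_right_mono)
qed simp

section \<open>Boundedness and local Lipschitz continuity of the logarithmic norm and of the
  field\<close>

context homogeneous_loop
begin

lemma H_bound: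
  obtains h where "0 < h" "\<And>x. norm (H x) \<le> h * norm x"
  using bounded_linear.pos_bounded[OF linear_linear[THEN iffD2, OF linear_H]] by (auto simp: mult.commute)

lemma sigma_bounded_above:
  obtains S where "0 \<le> S" "\<And>z. z \<noteq> 0 \<Longrightarrow> norm z \<le> R \<Longrightarrow> \<sigma> z \<le> S"
proof -
  obtain c where c: "0 < c" "\<And>x y. \<bar>q x - q y\<bar> \<le> c * norm (x - y) * (norm x + norm y)" by (rule q_diff_le) (rule that)
  \<comment> \<open>Contracting by \<open>S\<close> divides \<open>q\<close> by at least its bound c
    R^2 on the ball; the maximum with 1 keeps \<open>S\<close> nonnegative.\<close>
  define S where "S = ln (max 1 (c * R * R)) / (2 * c_r)"
  have S: "S \<ge> 0" "exp (2 * c_r * S) = max 1 (c * R * R)" using c_r(1) by (auto simp: S_def)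
  show thesis
  proof (rule that[OF S(1)])
    fix z :: "real^'n" assume z: "z \<noteq> 0" "norm z \<le> R"
    have "0 \<le> R" using z(2) norm_ge_zero order_trans by blast
    have "q z \<le> c * norm z * norm z" using c(2)[of z 0] q_nonneg[of z] by simp
    also have "\<dots> \<le> c * R * R" using c(1) z(2) \<open>0 \<le> R\<close> by (intro mult_mono) auto
    also have "\<dots> \<le> exp (2 * c_r * S)" unfolding S(2) by simp
    finally have "q z \<le> exp (2 * c_r * S)" .
    moreover have "q (dl r (- S) z) * exp (2 * c_r * S) \<le> q z"
      using q_dl_decay[OF S(1), of z] by simp
    ultimately have "q (dl r (- S) z) * exp (2 * c_r * S) \<le> 1 * exp (2 * c_r * S)" by linarith
    then have "q (dl r (- S) z) \<le> 1" using mult_right_le_imp_le exp_gt_zero by blast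
    then show "\<sigma> z \<le> S" using sigma_le_iff z by blast
  qed
qed

lemma norm_le_of_q_le_1:
  obtains W where "0 < W" "\<And>w. q w \<le> 1 \<Longrightarrow> norm w \<le> W"
proof -
  obtain c where c: "0 < c" "\<And>x. c * (norm x)\<^sup>2 \<le> q x" by (rule norm_sq_le_q) (rule that)
  show thesis
  proof (rule that)
    show "0 < sqrt (1 / c)" using c by simp
    fix w assume "q w \<le> 1"
    then have "c * (norm w)\<^sup>2 \<le> 1" using c(2)[of w] by simp
    then have "(norm w)\<^sup>2 \<le> 1 / c" using c(1) by (simp add: field_simps)
    then show "norm w \<le> sqrt (1 / c)" by (rule real_le_rsqrt)
  qed
qed

text \<open>Holds on balls around 0 although \<open>g\<close> may be discontinuous there: points of
  the unit sphere are bounded, and nonnegative weights do not amplify as \<open>\<sigma>\<close>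
  decreases. It is the source of absolute continuity of solutions.\<close>

lemma g_bounded:
  obtains b where "\<And>z. norm z \<le> R \<Longrightarrow> norm (g z) \<le> b"
proof -
  obtain S where S: "0 \<le> S" "\<And>z. z \<noteq> 0 \<Longrightarrow> norm z \<le> R \<Longrightarrow> \<sigma> z \<le> S" by (rule sigma_bounded_above) (rule that)
  obtain W where W: "0 < W" "\<And>w. q w \<le> 1 \<Longrightarrow> norm w \<le> W" by (rule norm_le_of_q_le_1) (rule that)
  obtain h where h: "0 < h" "\<And>x. norm (H x) \<le> h * norm x" by (rule H_bound) (rule that)
  show thesis
  proof (rule that)
    fix z :: "real^'n" assume z: "norm z \<le> R"
    let ?E = "exp (S * (\<Sum>k\<in>UNIV. r k + \<mu>))"
    show "norm (g z) \<le> ?E * (h * W)"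
    proof (cases "z = 0")
      case False
      have "norm (g z) \<le> ?E * norm (H (dl r (- \<sigma> z) z))"
        unfolding g_def using False S z r_mu by (auto intro!: norm_dl_le_of_nonneg)
      also have "\<dots> \<le> ?E * (h * W)"
        using W(2)[of "dl r (- \<sigma> z) z"] q_sigma[OF False] h
        by (intro mult_left_mono order_trans[OF h(2)]) auto
      finally show ?thesis .
    qed (use h W in auto)
  qed
qed

text \<open>No implicit function theorem is needed: if \<open>\<sigma>\<close> differs at two
  points, then at the dilation fitting one of them \<open>q_dl_decay\<close> turns the gap into a
  gap of \<open>q\<close>, which is Lipschitz on bounded sets.\<close>

lemma sigma_locally_lipschitz:
  assumes p: "p \<noteq> 0"
  obtains \<rho> S L where "0 < \<rho>" "\<And>x. x \<in> ball p \<rho> \<Longrightarrow> x \<noteq> 0" "\<And>x. x \<in> ball p \<rho> \<Longrightarrow> \<bar>\<sigma> x\<bar> \<le> S"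
    "\<And>x y. x \<in> ball p \<rho> \<Longrightarrow> y \<in> ball p \<rho> \<Longrightarrow> \<bar>\<sigma> x - \<sigma> y\<bar> \<le> L * norm (x - y)"
proof -
  \<comment> \<open>The two inequalities say that \<open>\<sigma>\<close> differs from
    \<open>\<sigma> p\<close> by less than 1, in a form that is visibly open.\<close>
  let ?U = "{z. 1 < q (dl r (- (\<sigma> p - 1)) z)} \<inter> {z. q (dl r (- (\<sigma> p + 1)) z) < 1}"
  have cq: "continuous_on UNIV (\<lambda>z. q (dl r s z))" for s
    by (intro continuous_on_compose2[OF continuous_q[of UNIV]] linear_continuous_on linear_linear[THEN iffD2] linear_dl) auto
  have "open ?U" by (intro open_Int open_Collect_less cq continuous_intros)
  moreover have "p \<in> ?U"
    using q_dl_strict_decay[of "\<sigma> p - 1" "\<sigma> p" p] q_dl_strict_decay[of "\<sigma> p" "\<sigma> p + 1" p] q_sigma[OF p] p by auto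
  ultimately obtain \<rho> where \<rho>: "0 < \<rho>" "ball p \<rho> \<subseteq> ?U" by (meson open_contains_ball)
  have ne: "x \<noteq> 0" if "x \<in> ball p \<rho>" for x
  proof -
    have "x \<in> ?U" using that \<rho>(2) by blast
    then show ?thesis by auto
  qed
  define S where "S = \<bar>\<sigma> p\<bar> + 1"
  have S: "\<bar>\<sigma> x\<bar> \<le> S" if "x \<in> ball p \<rho>" for x
    using sigma_le_iff[OF ne[OF that], of "\<sigma> p + 1"] sigma_le_iff[OF ne[OF that], of "\<sigma> p - 1"] \<rho> that
    by (force simp: S_def)
  obtain c where c: "0 < c" "\<And>x y. \<bar>q x - q y\<bar> \<le> c * norm (x - y) * (norm x + norm y)" by (rule q_diff_le) (rule that)
  define E where "E = exp (S * (\<Sum>k\<in>UNIV. \<bar>r k\<bar>))"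
  define M where "M = norm p + \<rho>"
  define L where "L = c * E * (E * M + E * M) / (2 * c_r)"
  have M: "norm x \<le> M" if "x \<in> ball p \<rho>" for x
    using that norm_triangle_ineq2[of x p] by (auto simp: M_def dist_norm norm_minus_commute)
  have *: "\<sigma> y - \<sigma> x \<le> L * norm (x - y)" if x: "x \<in> ball p \<rho>" and y: "y \<in> ball p \<rho>" and le: "\<sigma> x \<le> \<sigma> y" for x y
  proof -
    let ?D = "dl r (- \<sigma> x)"
    have D: "norm (?D v) \<le> E * norm v" for v unfolding E_def using S[OF x] by (intro norm_dl_le) auto
    \<comment> \<open>The tangent line of the exponential makes the decay estimate linear in the
      gap.\<close>
    have "1 + 2 * c_r * (\<sigma> y - \<sigma> x) \<le> exp (2 * c_r * (\<sigma> y - \<sigma> x))" by (rule exp_ge_add_one_self)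
    also have "\<dots> \<le> q (?D y)" using q_dl_decay[OF le, of y] q_sigma[OF ne[OF y]] by simp
    finally have "2 * c_r * (\<sigma> y - \<sigma> x) \<le> q (?D y) - q (?D x)" using q_sigma[OF ne[OF x]] by simp
    also have "\<dots> \<le> c * norm (?D (y - x)) * (norm (?D y) + norm (?D x))" using c(2)[of "?D y" "?D x"] by (simp add: dl_diff)
    also have "\<dots> \<le> c * (E * norm (y - x)) * (E * M + E * M)"
      using c(1) M[OF x] M[OF y]
      by (intro mult_mono add_mono mult_left_mono order_trans[OF D] mult_nonneg_nonneg) (auto simp: E_def)
    finally show ?thesis using c_r(1) by (simp add: L_def field_simps norm_minus_commute)
  qed
  show thesis
  proof (rule that[OF \<rho>(1) ne S])
    fix x y assume "x \<in> ball p \<rho>" "y \<in> ball p \<rho>"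
    then show "\<bar>\<sigma> x - \<sigma> y\<bar> \<le> L * norm (x - y)"
      using *[of x y] *[of y x] by (cases "\<sigma> x \<le> \<sigma> y") (auto simp: norm_minus_commute)
  qed
qed

lemma g_locally_lipschitz:
  assumes p: "p \<noteq> 0"
  obtains \<rho> L where "0 < \<rho>" "\<And>x. x \<in> ball p \<rho> \<Longrightarrow> x \<noteq> 0"
    "\<And>x y. x \<in> ball p \<rho> \<Longrightarrow> y \<in> ball p \<rho> \<Longrightarrow> norm (g x - g y) \<le> L * norm (x - y)"
proof -
  obtain \<rho> S L where \<rho>: "0 < \<rho>" "\<And>x. x \<in> ball p \<rho> \<Longrightarrow> x \<noteq> 0" "\<And>x. x \<in> ball p \<rho> \<Longrightarrow> \<bar>\<sigma> x\<bar> \<le> S"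
    "\<And>x y. x \<in> ball p \<rho> \<Longrightarrow> y \<in> ball p \<rho> \<Longrightarrow> \<bar>\<sigma> x - \<sigma> y\<bar> \<le> L * norm (x - y)"
    by (rule sigma_locally_lipschitz[OF p]) (rule that)
  obtain h where h: "0 < h" "\<And>x. norm (H x) \<le> h * norm x" by (rule H_bound) (rule that)
  have n: "norm x \<le> norm p + \<rho>" if "x \<in> ball p \<rho>" for x
    using that norm_triangle_ineq2[of x p] by (auto simp: dist_norm norm_minus_commute)
  obtain L1 M1 where 1: "\<forall>x\<in>ball p \<rho>. norm (dl r (- \<sigma> x) x) \<le> M1"
    "\<forall>x\<in>ball p \<rho>. \<forall>y\<in>ball p \<rho>. norm (dl r (- \<sigma> x) x - dl r (- \<sigma> y) y) \<le> L1 * norm (x - y)"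
    using dl_lipschitz[of "ball p \<rho>" "\<lambda>x. - \<sigma> x" S L "\<lambda>x. x" "norm p + \<rho>" 1 r] \<rho>(3,4) n
    by (auto simp: abs_minus_commute)
  have HM: "\<forall>x\<in>ball p \<rho>. norm (H (dl r (- \<sigma> x) x)) \<le> h * M1"
    using h(1) 1(1) by (intro ballI order_trans[OF h(2)] mult_left_mono) auto
  have HL: "\<forall>x\<in>ball p \<rho>. \<forall>y\<in>ball p \<rho>. norm (H (dl r (- \<sigma> x) x) - H (dl r (- \<sigma> y) y)) \<le> h * L1 * norm (x - y)"
  proof (intro ballI)
    fix x y assume "x \<in> ball p \<rho>" "y \<in> ball p \<rho>"
    then have "norm (H (dl r (- \<sigma> x) x - dl r (- \<sigma> y) y)) \<le> h * (L1 * norm (x - y))"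
      using h(1) 1(2) by (intro order_trans[OF h(2)] mult_left_mono) auto
    then show "norm (H (dl r (- \<sigma> x) x) - H (dl r (- \<sigma> y) y)) \<le> h * L1 * norm (x - y)"
      by (simp add: linear_diff[OF linear_H])
  qed
  obtain L2 where 2: "\<forall>x\<in>ball p \<rho>. \<forall>y\<in>ball p \<rho>. norm (dl (\<lambda>k. r k + \<mu>) (\<sigma> x) (H (dl r (- \<sigma> x) x))
      - dl (\<lambda>k. r k + \<mu>) (\<sigma> y) (H (dl r (- \<sigma> y) y))) \<le> L2 * norm (x - y)"
    using dl_lipschitz[OF _ _ HM HL, of \<sigma> S L "\<lambda>k. r k + \<mu>"] \<rho>(3,4) by auto
  show thesis
  proof (rule that[OF \<rho>(1,2)])
    fix x y assume "x \<in> ball p \<rho>" "y \<in> ball p \<rho>"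
    then show "norm (g x - g y) \<le> L2 * norm (x - y)" using 2 \<rho>(2)[of x] \<rho>(2)[of y] by (simp add: g_def)
  qed
qed

lemma isCont_g: "p \<noteq> 0 \<Longrightarrow> isCont g p"
proof -
  assume "p \<noteq> 0"
  then obtain \<rho> L where \<rho>: "0 < \<rho>"
    "\<And>x y. x \<in> ball p \<rho> \<Longrightarrow> y \<in> ball p \<rho> \<Longrightarrow> norm (g x - g y) \<le> L * norm (x - y)"
    using g_locally_lipschitz by metis
  have "(max L 0)-lipschitz_on (ball p \<rho>) g"
    using \<rho>(2) by (fastforce simp: lipschitz_on_def dist_norm intro: order_trans[OF _ mult_right_mono[of L "max L 0"]])
  then have "continuous_on (ball p \<rho>) g" by (rule lipschitz_on_continuous_on)
  then show ?thesis using \<rho>(1) by (simp add: continuous_on_eq_continuous_at)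
qed

end

section \<open>Forward uniqueness\<close>

lemma last_time:
  fixes \<psi> :: "real \<Rightarrow> 'a::metric_space"
  assumes "continuous_on {a..b} \<psi>" "closed C" "a \<le> b" "\<psi> a \<in> C"
  obtains s where "a \<le> s" "s \<le> b" "\<psi> s \<in> C" "\<And>t. s < t \<Longrightarrow> t \<le> b \<Longrightarrow> \<psi> t \<notin> C"
proof -
  let ?A = "{a..b} \<inter> \<psi> -` C"
  have "closed ?A" by (rule continuous_closed_preimage[OF assms(1) _ assms(2)]) simp
  then have "compact ?A" by (meson bounded_Int bounded_closed_interval compact_eq_bounded_closed)
  moreover have "?A \<noteq> {}" using assms by auto
  ultimately obtain s where s: "s \<in> ?A" "\<And>t. t \<in> ?A \<Longrightarrow> t \<le> s" by (meson compact_attains_sup)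
  show thesis
  proof (rule that)
    fix t assume "s < t" "t \<le> b"
    then show "\<psi> t \<notin> C" using s(1) s(2)[of t] by auto
  qed (use s in auto)
qed

text \<open>This scalar factor is the whole effect of the degree: a frozen dilation applied to
  \<open>g\<close> leaves a positive multiple of \<open>H\<close>, and a change of time can remove
  the factor.\<close>

lemma dl_shift: "dl (\<lambda>k. r k + \<mu>) s x = exp (s * \<mu>) *\<^sub>R dl r s x"
  by (simp add: vec_eq_iff distrib_left exp_add)

context homogeneous_loop
begin

text \<open>The common content of classical and of Filippov solutions of one follower.\<close>

definition weak_solution :: "real set \<Rightarrow> (real \<Rightarrow> real^'n) \<Rightarrow> bool" where
  "weak_solution S z \<longleftrightarrow> (\<forall>a b. {a..b} \<subseteq> S \<longrightarrow> abs_cont_on {a..b} z) \<and>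
    (\<exists>Z. negligible Z \<and> (\<forall>t\<in>S - Z. z t \<noteq> 0 \<longrightarrow> (z has_vector_derivative g (z t)) (at t within S)))"

lemma weak_solutionE:
  assumes "weak_solution S z"
  obtains Z where "negligible Z" "\<And>a b t. {a..b} \<subseteq> S \<Longrightarrow> t \<in> {a..b} - Z \<Longrightarrow> z t \<noteq> 0 \<Longrightarrow>
    (z has_vector_derivative g (z t)) (at t within {a..b})"
proof -
  obtain Z where Z: "negligible Z" "\<And>t. t \<in> S - Z \<Longrightarrow> z t \<noteq> 0 \<Longrightarrow> (z has_vector_derivative g (z t)) (at t within S)"
    using assms by (auto simp: weak_solution_def)
  show thesis
  proof (rule that[OF Z(1)])
    fix a b t assume "{a..b} \<subseteq> S" "t \<in> {a..b} - Z" "z t \<noteq> 0"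
    then show "(z has_vector_derivative g (z t)) (at t within {a..b})"
      using Z(2)[of t] has_vector_derivative_within_subset by blast
  qed
qed

lemma weak_solution_continuous: "weak_solution S z \<Longrightarrow> {a..b} \<subseteq> S \<Longrightarrow> continuous_on {a..b} z"
  by (auto simp: weak_solution_def intro: abs_cont_on_continuous)

lemma weak_solution_stays_at_0:
  assumes z: "weak_solution {0..<T} z" and t: "0 \<le> t0" "t0 \<le> t1" "t1 < T" and z0: "z t0 = 0"
  shows "z t1 = 0"
proof (rule ccontr)
  assume z1: "z t1 \<noteq> 0"
  obtain Z where Z: "negligible Z" "\<And>a b t. {a..b} \<subseteq> {0..<T} \<Longrightarrow> t \<in> {a..b} - Z \<Longrightarrow> z t \<noteq> 0 \<Longrightarrow>
    (z has_vector_derivative g (z t)) (at t within {a..b})"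
    by (rule weak_solutionE[OF z]) (rule that)
  \<comment> \<open>A level strictly below that of \<open>z t1\<close>, hence one that has to be
    crossed.\<close>
  define s where "s = \<sigma> (z t1) - 1"
  define D where "D = dl r (- s)"
  have D: "bounded_linear D" unfolding D_def using linear_dl linear_linear by blast
  have D0: "D x = 0 \<longleftrightarrow> x = 0" for x by (simp add: D_def)
  have zc: "continuous_on {t0..t1} z" using t by (intro weak_solution_continuous[OF z]) auto
  define \<psi> where "\<psi> t = q (D (z t))" for t
  have "continuous_on {t0..t1} (\<lambda>t. D (z t))"
    using D zc by (rule bounded_linear.continuous_on)
  then have \<psi>c: "continuous_on {t0..t1} \<psi>"
    unfolding \<psi>_def by (intro continuous_on_compose2[OF continuous_q[of UNIV]]) auto
  have \<psi>1: "1 < \<psi> t1"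
    using q_dl_strict_decay[of s "\<sigma> (z t1)" "z t1"] q_sigma[OF z1] z1 by (simp add: \<psi>_def D_def s_def)
  have "\<psi> t0 \<in> {..1}" using z0 by (simp add: \<psi>_def D_def)
  then obtain t2 where t2: "t0 \<le> t2" "t2 \<le> t1" "\<psi> t2 \<in> {..1}" "\<And>t. t2 < t \<Longrightarrow> t \<le> t1 \<Longrightarrow> \<psi> t \<notin> {..1}"
    using last_time[OF \<psi>c, of "{..1}"] t by auto
  have "t2 < t1" using t2 \<psi>1 by (cases "t2 = t1") auto
  have \<psi>2: "\<psi> t2 = 1"
  proof -
    obtain u where "t2 \<le> u" "u \<le> t1" "\<psi> u = 1"
      using IVT'[of \<psi> t2 1 t1] t2 \<psi>1 continuous_on_subset[OF \<psi>c, of "{t2..t1}"] by auto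
    then show ?thesis using t2(4)[of u] by (cases "u = t2") auto
  qed
  then have z2: "z t2 \<noteq> 0" by (auto simp: \<psi>_def D_def)
  have nz: "z t \<noteq> 0" if "t2 \<le> t" "t \<le> t1" for t
    using t2(4)[of t] z2 that by (cases "t = t2") (auto simp: \<psi>_def D_def)
  have \<sigma>2: "\<sigma> (z t2) = s" using \<psi>2 by (intro sigma_eqI) (simp add: \<psi>_def D_def)
  let ?w = "D (z t2)"
  have "g (z t2) = dl (\<lambda>k. r k + \<mu>) s (H ?w)" using z2 \<sigma>2 by (simp add: g_def D_def)
  then have "D (g (z t2)) = exp (s * \<mu>) *\<^sub>R H ?w" by (simp add: D_def dl_shift dl_scaleR)
  then have neg: "(P *v ?w) \<bullet> D (g (z t2)) < 0"
    using H_neg[of ?w] z2 by (simp add: D_def mult_pos_neg)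
  have gc: "continuous (at t2 within {t2..t1}) (\<lambda>t. (P *v D (z t)) \<bullet> D (g (z t)))"
  proof -
    have zct: "continuous (at t2 within {t2..t1}) z"
      using continuous_on_subset[OF zc, of "{t2..t1}"] t2 by (auto simp: continuous_on_eq_continuous_within)
    have "continuous (at t2 within {t2..t1}) (\<lambda>t. g (z t))"
      using continuous_within_compose3[OF isCont_g[OF z2] zct] .
    then show ?thesis
      using zct by (intro continuous_intros bounded_linear.continuous[OF D] bounded_linear.continuous[OF matrix_vector_mul_bounded_linear])
  qed
  have "\<forall>\<^sub>F t in at t2 within {t2..t1}. (P *v D (z t)) \<bullet> D (g (z t)) < 0"
    using gc neg unfolding continuous_within by (rule order_tendstoD)
  then obtain \<eta> where \<eta>: "0 < \<eta>" "\<And>t. t \<in> {t2..t1} \<Longrightarrow> t \<noteq> t2 \<Longrightarrow> dist t t2 < \<eta> \<Longrightarrow> (P *v D (z t)) \<bullet> D (g (z t)) < 0"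
    unfolding eventually_at by blast
  define t3 where "t3 = min t1 (t2 + \<eta> / 2)"
  have t3: "t2 < t3" "t3 \<le> t1" "t3 < t2 + \<eta>" using \<open>t2 < t1\<close> \<eta>(1) by (auto simp: t3_def)
  have sub: "{t2..t3} \<subseteq> {0..<T}" using t t2 t3 by auto
  have "\<psi> t3 - \<psi> t2 \<le> 0 * (t3 - t2)"
  \<comment> \<open>The sign was obtained from a punctured neighbourhood of \<open>t2\<close>, so
    \<open>t2\<close> joins the null set.\<close>
  proof (rule abs_cont_increment_le[where Z="insert t2 Z"])
    obtain c where c: "0 < c" "\<And>x y. \<bar>q x - q y\<bar> \<le> c * norm (x - y) * (norm x + norm y)" by (rule q_diff_le) (rule that)
    obtain d where d: "0 < d" "\<And>x. norm (D x) \<le> norm x * d" using bounded_linear.pos_bounded[OF D] by blast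
    have "compact (z ` {t2..t3})" using zc t2 t3 by (intro compact_continuous_image continuous_on_subset[OF zc]) auto
    then obtain M where M: "0 < M" "\<And>t. t \<in> {t2..t3} \<Longrightarrow> norm (z t) \<le> M"
      using compact_imp_bounded bounded_pos by (metis image_eqI)
    have ac: "abs_cont_on {t2..t3} z" using z sub by (auto simp: weak_solution_def)
    show "abs_cont_on {t2..t3} \<psi>"
    proof (rule abs_cont_on_lipschitz_comp[OF ac])
      fix x y assume xy: "x \<in> {t2..t3}" "y \<in> {t2..t3}"
      have "norm (\<psi> x - \<psi> y) \<le> c * norm (D (z x - z y)) * (norm (D (z x)) + norm (D (z y)))"
        using c(2)[of "D (z x)" "D (z y)"] by (simp add: \<psi>_def linear_diff[OF bounded_linear.linear[OF D]])
      also have "\<dots> \<le> c * (norm (z x - z y) * d) * (M * d + M * d)"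
        using c(1) d(1) M(1) xy
        by (intro mult_mono add_mono mult_left_mono order_trans[OF d(2)] mult_right_mono M(2)) auto
      finally show "norm (\<psi> x - \<psi> y) \<le> (c * d * (M * d + M * d)) * norm (z x - z y)"
        by (simp add: mult_ac)
    qed
    fix u assume u: "u \<in> {t2..t3} - insert t2 Z"
    have "((\<lambda>t. D (z t)) has_vector_derivative D (g (z u))) (at u within {t2..t3})"
      using u t3 nz[of u] by (intro bounded_linear.has_vector_derivative[OF D] Z(2)[OF sub]) auto
    from q_has_real_derivative[OF this]
    have "(\<psi> has_vector_derivative 2 * ((P *v D (z u)) \<bullet> D (g (z u)))) (at u within {t2..t3})"
      by (simp add: \<psi>_def[abs_def] has_real_derivative_iff_has_vector_derivative)
    moreover have "(P *v D (z u)) \<bullet> D (g (z u)) < 0" using u t3 by (intro \<eta>(2)) (auto simp: dist_real_def)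
    ultimately show "\<exists>d\<le>0. (\<psi> has_vector_derivative d) (at u within {t2..t3})"
      by (intro exI[of _ "2 * ((P *v D (z u)) \<bullet> D (g (z u)))"]) simp
  qed (use t3 Z(1) in auto)
  then show False using t2(4)[of t3] t3 \<psi>2 by auto
qed

text \<open>At the last time of agreement the common value is not 0, since otherwise both solutions
  would stay at 0. So \<open>g\<close> is Lipschitz nearby, and on a short interval the largest
  distance is at most half of itself.\<close>

lemma weak_solution_unique:
  assumes z: "weak_solution {0..<T} z" and z': "weak_solution {0..<T} z'"
    and "z 0 = z' 0" and t: "t \<in> {0..<T}"
  shows "z t = z' t"
proof (rule ccontr)
  assume ne: "z t \<noteq> z' t"
  have cont: "continuous_on {0..t} z" "continuous_on {0..t} z'"
    using t by (auto intro!: weak_solution_continuous[OF z] weak_solution_continuous[OF z'])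
  obtain t0 where t0: "0 \<le> t0" "t0 \<le> t" "z t0 = z' t0" "\<And>u. t0 < u \<Longrightarrow> u \<le> t \<Longrightarrow> z u \<noteq> z' u"
    using last_time[of 0 t "\<lambda>u. z u - z' u" "{0}"] cont assms(3) t
    by (auto intro!: continuous_intros)
  have "t0 < t" using t0 ne by (cases "t0 = t") auto
  define p where "p = z t0"
  have "p \<noteq> 0"
    using weak_solution_stays_at_0[OF z, of t0 t] weak_solution_stays_at_0[OF z', of t0 t] t0 t ne by (auto simp: p_def)
  then obtain \<rho> L0 where \<rho>: "0 < \<rho>" "\<And>x. x \<in> ball p \<rho> \<Longrightarrow> x \<noteq> 0"
    "\<And>x y. x \<in> ball p \<rho> \<Longrightarrow> y \<in> ball p \<rho> \<Longrightarrow> norm (g x - g y) \<le> L0 * norm (x - y)"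
    by (rule g_locally_lipschitz) (rule that)
  define L where "L = max L0 1"
  have L: "L > 0" by (simp add: L_def)
  have lip: "norm (g x - g y) \<le> L * norm (x - y)" if "x \<in> ball p \<rho>" "y \<in> ball p \<rho>" for x y
    using \<rho>(3)[OF that] mult_right_mono[of L0 L "norm (x - y)"] by (simp add: L_def)
  have "\<forall>\<^sub>F u in at t0 within {0..t}. z u \<in> ball p \<rho>" "\<forall>\<^sub>F u in at t0 within {0..t}. z' u \<in> ball p \<rho>"
  proof -
    have "(z \<longlongrightarrow> p) (at t0 within {0..t})" "(z' \<longlongrightarrow> p) (at t0 within {0..t})"
      using bspec[OF cont(1)[unfolded continuous_on_def], of t0] bspec[OF cont(2)[unfolded continuous_on_def], of t0] t0(1-3)
      by (simp_all add: p_def)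
    then show "\<forall>\<^sub>F u in at t0 within {0..t}. z u \<in> ball p \<rho>" "\<forall>\<^sub>F u in at t0 within {0..t}. z' u \<in> ball p \<rho>"
      using \<rho>(1) by (auto simp: dist_commute dest: tendstoD)
  qed
  then have "\<forall>\<^sub>F u in at t0 within {0..t}. z u \<in> ball p \<rho> \<and> z' u \<in> ball p \<rho>" by (rule eventually_conj)
  then obtain \<eta> where \<eta>: "0 < \<eta>" "\<And>u. u \<in> {0..t} \<Longrightarrow> u \<noteq> t0 \<Longrightarrow> dist u t0 < \<eta> \<Longrightarrow> z u \<in> ball p \<rho> \<and> z' u \<in> ball p \<rho>"
    unfolding eventually_at by blast
  \<comment> \<open>Length \<eta> / 2 keeps both solutions in the ball; length 1 / (2 L) produces
    the factor 1/2.\<close>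
  define t3 where "t3 = min t (t0 + min (\<eta> / 2) (1 / (2 * L)))"
  have t3: "t0 < t3" "t3 \<le> t" "t3 < t0 + \<eta>" "t3 - t0 \<le> 1 / (2 * L)" using \<open>t0 < t\<close> \<eta>(1) L by (auto simp: t3_def)
  have in_ball: "z u \<in> ball p \<rho> \<and> z' u \<in> ball p \<rho>" if "u \<in> {t0..t3}" for u
  proof (cases "u = t0")
    case True then show ?thesis using \<rho>(1) t0(3) by (simp add: p_def)
  next
    case False then show ?thesis using that t3 t0 by (intro \<eta>(2)) (auto simp: dist_real_def)
  qed
  have "continuous_on {t0..t3} (\<lambda>u. norm (z u - z' u))"
    using t0 t3 by (intro continuous_intros continuous_on_subset[OF cont(1)] continuous_on_subset[OF cont(2)]) auto
  then obtain t4 where t4: "t4 \<in> {t0..t3}" "\<And>u. u \<in> {t0..t3} \<Longrightarrow> norm (z u - z' u) \<le> norm (z t4 - z' t4)"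
    using continuous_attains_sup[of "{t0..t3}" "\<lambda>u. norm (z u - z' u)"] t3 by auto
  define d where "d = norm (z t4 - z' t4)"
  obtain Z where Z: "negligible Z" "\<And>a b t. {a..b} \<subseteq> {0..<T} \<Longrightarrow> t \<in> {a..b} - Z \<Longrightarrow> z t \<noteq> 0 \<Longrightarrow>
    (z has_vector_derivative g (z t)) (at t within {a..b})"
    by (rule weak_solutionE[OF z]) (rule that)
  obtain Z' where Z': "negligible Z'" "\<And>a b t. {a..b} \<subseteq> {0..<T} \<Longrightarrow> t \<in> {a..b} - Z' \<Longrightarrow> z' t \<noteq> 0 \<Longrightarrow>
    (z' has_vector_derivative g (z' t)) (at t within {a..b})"
    by (rule weak_solutionE[OF z']) (rule that)
  have sub: "{t0..t4} \<subseteq> {0..<T}" using t t0 t3 t4 by auto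
  have "norm ((z t4 - z' t4) - (z t0 - z' t0)) \<le> (L * d) * (t4 - t0)"
  proof (rule abs_cont_norm_increment_le[where Z="Z \<union> Z'"])
    show "abs_cont_on {t0..t4} (\<lambda>t. z t - z' t)"
      using z z' sub by (intro abs_cont_on_diff) (auto simp: weak_solution_def)
    fix u assume u: "u \<in> {t0..t4} - (Z \<union> Z')"
    have b: "z u \<in> ball p \<rho>" "z' u \<in> ball p \<rho>" using in_ball[of u] u t4 by auto
    have "((\<lambda>t. z t - z' t) has_vector_derivative g (z u) - g (z' u)) (at u within {t0..t4})"
      using u \<rho>(2)[OF b(1)] \<rho>(2)[OF b(2)] by (intro derivative_intros Z(2)[OF sub] Z'(2)[OF sub]) auto
    moreover have "norm (g (z u) - g (z' u)) \<le> L * d"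
      using u t4 L unfolding d_def by (intro order_trans[OF lip[OF b]] mult_left_mono t4(2)) auto
    ultimately show "\<exists>d'. norm d' \<le> L * d \<and> ((\<lambda>t. z t - z' t) has_vector_derivative d') (at u within {t0..t4})"
      by blast
  qed (use t4 Z(1) Z'(1) in auto)
  then have "d \<le> (L * d) * (t4 - t0)" using t0(3) by (simp add: d_def)
  also have "\<dots> \<le> (L * d) * (1 / (2 * L))"
    using L t4 t3 by (intro mult_left_mono) (auto simp: d_def)
  also have "\<dots> = d / 2" using L by simp
  finally have "d = 0" by (simp add: d_def)
  then have "z t3 = z' t3" using t4(2)[of t3] t3 by (simp add: d_def)
  then show False using t0(4)[of t3] t3 by blast
qed

end

section \<open>Existence and finite settling time\<close>

lemma norm_dl_decay:
  assumes "\<And>k. m \<le> r k" "s \<le> 0"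
  shows "norm (dl r s y) \<le> exp (s * m) * norm y"
  using assms by (intro norm_le_nth_mult) (auto simp: abs_mult intro!: mult_right_mono mult_left_mono_neg)

lemma dl_small:
  fixes r :: "'n::finite \<Rightarrow> real"
  assumes "\<And>k. 0 < r k" "0 < \<epsilon>" "0 \<le> W"
  obtains s0 where "\<And>s y. s \<le> s0 \<Longrightarrow> norm y \<le> W \<Longrightarrow> norm (dl r s y) < \<epsilon>"
proof -
  define m where "m = Min (range r)"
  have m: "0 < m" "\<And>k. m \<le> r k" using assms(1) by (auto simp: m_def)
  \<comment> \<open>The denominator \<open>W + 1\<close> allows W = 0 and makes the final inequality
    strict; \<open>norm_dl_decay\<close> requires a nonpositive parameter.\<close>
  define s0 where "s0 = min 0 (ln (\<epsilon> / (W + 1)) / m)"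
  show thesis
  proof (rule that)
    fix s and y :: "real^'n" assume s: "s \<le> s0" and y: "norm y \<le> W"
    have "s * m \<le> ln (\<epsilon> / (W + 1))" using s m(1) by (simp add: s0_def field_simps)
    then have "exp (s * m) \<le> exp (ln (\<epsilon> / (W + 1)))" by simp
    also have "\<dots> = \<epsilon> / (W + 1)" using assms by simp
    finally have e: "exp (s * m) \<le> \<epsilon> / (W + 1)" .
    have "norm (dl r s y) \<le> exp (s * m) * norm y" using s by (intro norm_dl_decay m(2)) (simp add: s0_def)
    also have "\<dots> \<le> \<epsilon> / (W + 1) * W" using e y assms by (intro mult_mono) auto
    also have "\<dots> < \<epsilon>" using assms by (simp add: field_simps)
    finally show "norm (dl r s y) < \<epsilon>" .
  qed
qed

lemma bilinear_form_diff_le: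
  fixes f :: "real^'n \<Rightarrow> real^'n" and P :: "real^'n^'n"
  assumes f: "linear f"
  obtains c where "0 < c" "\<And>x y. \<bar>(P *v x) \<bullet> f x - (P *v y) \<bullet> f y\<bar> \<le> c * norm (x - y) * (norm x + norm y)"
proof -
  obtain a where a: "0 < a" "\<And>x. norm (P *v x) \<le> norm x * a"
    using bounded_linear.pos_bounded[OF matrix_vector_mul_bounded_linear] by blast
  obtain b where b: "0 < b" "\<And>x. norm (f x) \<le> norm x * b"
    using bounded_linear.pos_bounded[OF linear_linear[THEN iffD2, OF f]] by blast
  show thesis
  proof (rule that[of "a * b"])
    fix x y
    have "(P *v x) \<bullet> f x - (P *v y) \<bullet> f y = (P *v (x - y)) \<bullet> f x + (P *v y) \<bullet> f (x - y)"
      by (simp add: linear_diff[OF f] matrix_vector_mult_diff_distrib inner_diff_left inner_diff_right)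
    also have "\<bar>\<dots>\<bar> \<le> \<bar>(P *v (x - y)) \<bullet> f x\<bar> + \<bar>(P *v y) \<bullet> f (x - y)\<bar>" by (rule abs_triangle_ineq)
    also have "\<dots> \<le> norm (P *v (x - y)) * norm (f x) + norm (P *v y) * norm (f (x - y))"
      by (intro add_mono Cauchy_Schwarz_ineq2)
    also have "\<dots> \<le> (norm (x - y) * a) * (norm x * b) + (norm y * a) * (norm (x - y) * b)"
      using a(1) b(1) by (intro add_mono mult_mono a b) auto
    finally show "\<bar>(P *v x) \<bullet> f x - (P *v y) \<bullet> f y\<bar> \<le> a * b * norm (x - y) * (norm x + norm y)"
      by (simp add: algebra_simps)
  qed (use a b in simp)
qed

section \<open>Polar coordinates and the flow on the unit sphere\<close>

context homogeneous_loop
begin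

text \<open>The radial speed in rescaled time: the multiple of the generator that has to be
  subtracted from \<open>H y\<close> to leave a vector tangent to the level set of \<open>q\<close>.
  At 0 the quotient is 0 by convention.\<close>

definition \<kappa> :: "real^'n \<Rightarrow> real" where
  "\<kappa> y = ((P *v y) \<bullet> H y) / ((P *v y) \<bullet> scl r y)"

definition h :: "real^'n \<Rightarrow> real^'n" where
  "h y = H y - \<kappa> y *\<^sub>R scl r y"

lemma h_tangent: "(P *v y) \<bullet> h y = 0"
  using scl_pos[of y] by (cases "y = 0") (auto simp: h_def \<kappa>_def inner_diff_right)

text \<open>\<open>\<kappa>\<close> is homogeneous of degree 0 and hence \<open>h\<close> of degree
  1, so a Lipschitz bound can hold on the whole space and no cut-off around the sphere is needed.
  Differences of \<open>\<kappa>\<close> blow up like 1 / norm at 0, but they are multiplied by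
  \<open>scl r z\<close>, which compensates.\<close>

lemma h_lipschitz:
  obtains L where "\<And>x y. norm (h x - h y) \<le> L * norm (x - y)"
proof -
  let ?num = "\<lambda>y. (P *v y) \<bullet> H y" and ?den = "\<lambda>y. (P *v y) \<bullet> scl r y"
  obtain c0 where c0: "0 < c0" "\<And>x. c0 * (norm x)\<^sup>2 \<le> q x" by (rule norm_sq_le_q) (rule that)
  obtain C where C: "0 < C" "\<And>x y. \<bar>?num x - ?num y\<bar> \<le> C * norm (x - y) * (norm x + norm y)"
    by (rule bilinear_form_diff_le[OF linear_H, of P]) (rule that)
  obtain D where D: "0 < D" "\<And>x y. \<bar>?den x - ?den y\<bar> \<le> D * norm (x - y) * (norm x + norm y)"
    by (rule bilinear_form_diff_le[OF linear_scl, of P]) (rule that)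
  obtain b where b: "0 < b" "\<And>x. norm (H x) \<le> b * norm x" by (rule H_bound) (rule that)
  define c where "c = c_r * c0"
  define R where "R = (\<Sum>k\<in>UNIV. \<bar>r k\<bar>)"
  have R: "0 \<le> R" "\<And>x. norm (scl r x) \<le> R * norm x" by (auto simp: R_def sum_nonneg norm_scl_le)
  have c: "0 < c" "c * (norm x)\<^sup>2 \<le> ?den x" for x
  proof -
    have "c_r * (c0 * (norm x)\<^sup>2) \<le> c_r * q x" using c_r(1) c0(2) by (intro mult_left_mono) auto
    then show "c * (norm x)\<^sup>2 \<le> ?den x" using c_r(2)[of x] by (simp add: c_def)
  qed (use c_r c0 in \<open>simp add: c_def\<close>)
  have kb: "\<bar>\<kappa> y\<bar> \<le> C / c" for y
  proof (cases "y = 0")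
    case False
    have "\<bar>?num y\<bar> \<le> C * (norm y)\<^sup>2" using C(2)[of y 0] by (simp add: power2_eq_square)
    moreover have "0 < c * (norm y)\<^sup>2" using c(1) False by simp
    ultimately have "\<bar>?num y\<bar> / ?den y \<le> C * (norm y)\<^sup>2 / (c * (norm y)\<^sup>2)"
      using c(2)[of y] C(1) by (intro frac_le) auto
    then show ?thesis using False scl_pos[OF False] by (simp add: \<kappa>_def abs_div_pos[symmetric] abs_divide)
  qed (use C c in \<open>simp add: \<kappa>_def\<close>)
  define L1 where "L1 = (2 * C / c + 2 * C * D / (c * c)) * R"
  \<comment> \<open>Dividing by the form at the longer vector \<open>y\<close> leaves a factor 1 /
    norm y, which cancels against the norm of the shorter vector \<open>z\<close>.\<close>
  have kd: "\<bar>\<kappa> y - \<kappa> z\<bar> * norm (scl r z) \<le> L1 * norm (y - z)" if le: "norm z \<le> norm y" for y z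
  proof (cases "z = 0")
    case True then show ?thesis using C c D R by (simp add: L1_def linear_0[OF linear_scl])
  next
    case False
    then have y: "y \<noteq> 0" "0 < norm y" using le by auto
    have dy: "0 < ?den y" "0 < ?den z" "c * (norm y)\<^sup>2 \<le> ?den y" using scl_pos y False c(2) by auto
    have cy: "0 < c * (norm y)\<^sup>2" using c(1) y by simp
    have n1: "\<bar>?num y - ?num z\<bar> \<le> C * norm (y - z) * (2 * norm y)"
      using le C(1) by (intro order_trans[OF C(2)] mult_left_mono) auto
    have n2: "\<bar>?den z - ?den y\<bar> \<le> D * norm (y - z) * (2 * norm y)"
      unfolding abs_minus_commute[of "?den z"] using le D(1) by (intro order_trans[OF D(2)] mult_left_mono) auto
    have "\<kappa> y - \<kappa> z = (?num y - ?num z) / ?den y + \<kappa> z * ((?den z - ?den y) / ?den y)"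
      using dy by (simp add: \<kappa>_def field_simps)
    also have "\<bar>\<dots>\<bar> \<le> \<bar>?num y - ?num z\<bar> / ?den y + \<bar>\<kappa> z\<bar> * (\<bar>?den z - ?den y\<bar> / ?den y)"
      using dy by (intro order_trans[OF abs_triangle_ineq]) (simp add: abs_mult)
    also have "\<dots> \<le> C * norm (y - z) * (2 * norm y) / (c * (norm y)\<^sup>2) + C / c * (D * norm (y - z) * (2 * norm y) / (c * (norm y)\<^sup>2))"
      using C(1) D(1) c(1) cy dy(3) by (intro add_mono frac_le mult_mono kb n1 n2 divide_nonneg_pos dy(1)) auto
    also have "\<dots> = (2 * C / c + 2 * C * D / (c * c)) * norm (y - z) / norm y"
      using y c by (simp add: field_simps power2_eq_square)
    finally have *: "\<bar>\<kappa> y - \<kappa> z\<bar> \<le> \<dots>" .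
    have "\<bar>\<kappa> y - \<kappa> z\<bar> * norm (scl r z) \<le> ((2 * C / c + 2 * C * D / (c * c)) * norm (y - z) / norm y) * (R * norm y)"
      using C D c R y le by (intro mult_mono * order_trans[OF R(2)] mult_left_mono) auto
    also have "\<dots> = L1 * norm (y - z)" using y by (simp add: L1_def)
    finally show ?thesis .
  qed
  have main: "norm (h y - h z) \<le> (b + C / c * R + L1) * norm (y - z)" if le: "norm z \<le> norm y" for y z
  proof -
    have "h y - h z = H (y - z) - (\<kappa> y *\<^sub>R scl r (y - z) + (\<kappa> y - \<kappa> z) *\<^sub>R scl r z)"
      by (simp add: h_def linear_diff[OF linear_H] linear_diff[OF linear_scl] algebra_simps)
    also have "norm \<dots> \<le> norm (H (y - z)) + (norm (\<kappa> y *\<^sub>R scl r (y - z)) + norm ((\<kappa> y - \<kappa> z) *\<^sub>R scl r z))"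
      by (intro order_trans[OF norm_triangle_ineq4] add_left_mono norm_triangle_ineq)
    also have "\<dots> \<le> b * norm (y - z) + (C / c * (R * norm (y - z)) + L1 * norm (y - z))"
      unfolding norm_scaleR real_norm_def using C(1) c(1) by (intro add_mono b(2) kd le mult_mono kb R) auto
    finally show ?thesis by (simp add: algebra_simps)
  qed
  show thesis
  proof (rule that)
    fix x y
    show "norm (h x - h y) \<le> (b + C / c * R + L1) * norm (x - y)"
      using main[of y x] main[of x y] by (cases "norm y \<le> norm x") (auto simp: norm_minus_commute)
  qed
qed

text \<open>Numerator and denominator are both comparable to the squared norm. The uniform c makes
  the logarithmic norm fall at least linearly in rescaled time.\<close>

lemma \<kappa>_neg:
  obtains c where "0 < c" "\<And>y. y \<noteq> 0 \<Longrightarrow> \<kappa> y \<le> - c"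
proof -
  have "linear (\<lambda>x. - H x)" using linear_H by (simp add: linear_compose_neg)
  then obtain c1 where c1: "0 < c1" "\<And>x. c1 * q x \<le> (P *v x) \<bullet> - H x"
    by (rule form_bound) (use H_neg in auto)
  obtain D where D: "0 < D" "\<And>x y. \<bar>(P *v x) \<bullet> scl r x - (P *v y) \<bullet> scl r y\<bar> \<le> D * norm (x - y) * (norm x + norm y)"
    by (rule bilinear_form_diff_le[OF linear_scl, of P]) (rule that)
  obtain c0 where c0: "0 < c0" "\<And>x. c0 * (norm x)\<^sup>2 \<le> q x" by (rule norm_sq_le_q) (rule that)
  show thesis
  proof (rule that)
    show "0 < c1 * c0 / D" using c1 c0 D by simp
    fix y :: "real^'n" assume y: "y \<noteq> 0"
    let ?den = "(P *v y) \<bullet> scl r y"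
    have "c1 * c0 / D * ?den \<le> c1 * c0 / D * (D * (norm y)\<^sup>2)"
      using D(2)[of y 0] c1(1) c0(1) D(1) by (intro mult_left_mono) (auto simp: power2_eq_square)
    also have "\<dots> \<le> c1 * q y" using c1(1) c0(2)[of y] D(1) by simp
    also have "\<dots> \<le> - ((P *v y) \<bullet> H y)" using c1(2)[of y] by simp
    finally show "\<kappa> y \<le> - (c1 * c0 / D)" using scl_pos[OF y] by (simp add: \<kappa>_def pos_divide_le_eq)
  qed
qed

text \<open>The equation is solved in the whole space; by tangency \<open>q\<close> is a first
  integral, which keeps the solution on the sphere.\<close>

lemma sphere_flow:
  assumes "q y0 = 1"
  obtains y where "y 0 = y0" "\<And>\<tau>. 0 \<le> \<tau> \<Longrightarrow> (y has_vector_derivative h (y \<tau>)) (at \<tau>)" "\<And>\<tau>. 0 \<le> \<tau> \<Longrightarrow> q (y \<tau>) = 1"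
proof -
  obtain L where "\<And>x y. norm (h x - h y) \<le> L * norm (x - y)" by (rule h_lipschitz) (rule that)
  then obtain y where y: "y 0 = y0" "\<And>t. (y has_vector_derivative h (y (max 0 t))) (at t)"
    by (rule lipschitz_ode_solution[of h L y0]) (rule that)
  have y': "(y has_vector_derivative h (y \<tau>)) (at \<tau>)" if "0 \<le> \<tau>" for \<tau> using y(2)[of \<tau>] that by simp
  have "\<exists>c. \<forall>\<tau>\<in>{0..}. q (y \<tau>) = c"
  proof (rule has_field_derivative_zero_constant)
    fix \<tau> :: real assume "\<tau> \<in> {0..}"
    then have "(y has_vector_derivative h (y \<tau>)) (at \<tau> within {0..})"
      using y' by (auto intro: has_vector_derivative_at_within)
    from q_has_real_derivative[OF this] show "((\<lambda>\<tau>. q (y \<tau>)) has_real_derivative 0) (at \<tau> within {0..})"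
      by (simp add: h_tangent)
  qed simp
  then have "q (y \<tau>) = 1" if "0 \<le> \<tau>" for \<tau> using that y(1) assms by fastforce
  then show thesis using that y(1) y' by blast
qed

lemma continuous_on_\<kappa>:
  assumes "continuous_on S f" "\<And>x. x \<in> S \<Longrightarrow> f x \<noteq> 0"
  shows "continuous_on S (\<lambda>x. \<kappa> (f x))"
proof -
  have "(P *v f x) \<bullet> scl r (f x) \<noteq> 0" if "x \<in> S" for x using scl_pos assms(2)[OF that] by fastforce
  then show ?thesis
    unfolding \<kappa>_def
    by (intro continuous_intros assms(1) bounded_linear.continuous_on[OF matrix_vector_mul_bounded_linear]
        bounded_linear.continuous_on[OF linear_linear[THEN iffD2, OF linear_H]]
        bounded_linear.continuous_on[OF linear_linear[THEN iffD2, OF linear_scl]]) auto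
qed

text \<open>Writing a solution as a dilate of a point y of the unit sphere and rescaling time by the
  homogeneity degree, y satisfies an autonomous equation on the sphere, while the logarithm S of
  the homogeneous norm and the original time \<theta> are obtained from y by integration.\<close>

lemma rescaled_trajectory:
  assumes z0: "z0 \<noteq> 0"
  obtains \<zeta> S \<theta> c where "0 < c" "\<zeta> 0 = z0" "\<theta> 0 = (0::real)"
    "\<And>\<tau>. \<exists>d>0. (\<theta> has_real_derivative d) (at \<tau>)"
    "\<And>\<tau>. 0 \<le> \<tau> \<Longrightarrow> (\<theta> has_real_derivative exp (- \<mu> * S \<tau>)) (at \<tau>)"
    "\<And>\<tau>. 0 \<le> \<tau> \<Longrightarrow> (\<zeta> has_vector_derivative exp (- \<mu> * S \<tau>) *\<^sub>R g (\<zeta> \<tau>)) (at \<tau>)"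
    "\<And>\<tau>. 0 \<le> \<tau> \<Longrightarrow> \<zeta> \<tau> \<noteq> 0" "\<And>\<tau>. 0 \<le> \<tau> \<Longrightarrow> \<sigma> (\<zeta> \<tau>) = S \<tau>"
    "\<And>\<tau>. 0 \<le> \<tau> \<Longrightarrow> S \<tau> \<le> \<sigma> z0 - c * \<tau>"
proof -
  obtain y where y: "y 0 = dl r (- \<sigma> z0) z0" "\<And>\<tau>. 0 \<le> \<tau> \<Longrightarrow> (y has_vector_derivative h (y \<tau>)) (at \<tau>)"
    "\<And>\<tau>. 0 \<le> \<tau> \<Longrightarrow> q (y \<tau>) = 1"
    by (rule sphere_flow[OF q_sigma[OF z0]]) (rule that)
  have y0: "y \<tau> \<noteq> 0" if "0 \<le> \<tau>" for \<tau> using y(3)[OF that] by auto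
  have "continuous_on {0..} y"
    using y(2) by (intro continuous_at_imp_continuous_on) (auto intro: has_vector_derivative_continuous)
  then have "continuous_on {0..} (\<lambda>\<tau>. \<kappa> (y \<tau>))" using y0 by (intro continuous_on_\<kappa>) auto
  \<comment> \<open>Extended by its value at 0, so that \<open>S\<close> and \<open>\<theta>\<close>
    are defined on the whole line with two-sided derivatives at 0.\<close>
  then have kc: "continuous_on UNIV (\<lambda>\<tau>. \<kappa> (y (max 0 \<tau>)))"
    by (rule continuous_on_compose2) (auto intro!: continuous_intros)
  obtain \<Phi> where \<Phi>: "\<Phi> 0 = 0" "\<And>t. (\<Phi> has_vector_derivative \<kappa> (y (max 0 t))) (at t)"
    by (rule continuous_antiderivative[OF kc]) (rule that)
  define S where "S \<tau> = \<sigma> z0 + \<Phi> \<tau>" for \<tau>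
  have S': "(S has_real_derivative \<kappa> (y (max 0 \<tau>))) (at \<tau>)" for \<tau>
    unfolding S_def using \<Phi>(2)[of \<tau>]
    by (auto intro!: derivative_eq_intros simp: has_real_derivative_iff_has_vector_derivative[symmetric])
  have "continuous_on UNIV S"
    using S' by (intro continuous_at_imp_continuous_on) (auto intro: DERIV_isCont)
  then have tc: "continuous_on UNIV (\<lambda>\<tau>. exp (- \<mu> * S \<tau>))" by (intro continuous_intros)
  obtain \<theta> where \<theta>: "\<theta> 0 = 0" "\<And>t. (\<theta> has_vector_derivative exp (- \<mu> * S t)) (at t)"
    by (rule continuous_antiderivative[OF tc]) (rule that)
  obtain c where c: "0 < c" "\<And>y. y \<noteq> 0 \<Longrightarrow> \<kappa> y \<le> - c" by (rule \<kappa>_neg) (rule that)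
  define \<zeta> where "\<zeta> \<tau> = dl r (S \<tau>) (y \<tau>)" for \<tau>
  have \<sigma>: "\<sigma> (\<zeta> \<tau>) = S \<tau>" "\<zeta> \<tau> \<noteq> 0" if "0 \<le> \<tau>" for \<tau>
    using y(3)[OF that] y0[OF that] by (auto simp: \<zeta>_def intro!: sigma_eqI)
  have \<theta>': "(\<theta> has_real_derivative exp (- \<mu> * S \<tau>)) (at \<tau>)" for \<tau>
    using \<theta>(2) by (simp add: has_real_derivative_iff_has_vector_derivative)
  show thesis
  proof (rule that[OF c(1), of \<zeta> \<theta> S])
    show "\<zeta> 0 = z0" by (simp add: \<zeta>_def y(1) S_def \<Phi>(1))
    show "\<exists>d>0. (\<theta> has_real_derivative d) (at \<tau>)" for \<tau> using \<theta>' by (metis exp_gt_zero)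
    fix \<tau> :: real assume \<tau>: "0 \<le> \<tau>"
    \<comment> \<open>The generator commutes with the dilation, so the radial motion cancels the
      term subtracted in \<open>h\<close> and only \<open>H\<close> is left.\<close>
    have "scl r (dl r s x) = dl r s (scl r x)" for s x by (simp add: vec_eq_iff)
    then have "(\<zeta> has_vector_derivative dl r (S \<tau>) (H (y \<tau>))) (at \<tau>)"
      using dl_comp_has_vector_derivative[OF S'[of \<tau>] y(2)[OF \<tau>], of r] \<tau>
      by (simp add: \<zeta>_def[abs_def] h_def dl_diff dl_scaleR)
    \<comment> \<open>By \<open>dl_shift\<close> the field carries exactly the factor exp (\<mu> S)
      that the change of time removes.\<close>
    moreover have "exp (- \<mu> * S \<tau>) *\<^sub>R g (\<zeta> \<tau>) = dl r (S \<tau>) (H (y \<tau>))"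
      using \<sigma>[OF \<tau>] by (simp add: g_def dl_shift mult_exp_exp) (simp add: \<zeta>_def mult.commute)
    ultimately show "(\<zeta> has_vector_derivative exp (- \<mu> * S \<tau>) *\<^sub>R g (\<zeta> \<tau>)) (at \<tau>)" by simp
    have "S \<tau> + c * \<tau> \<le> S 0 + c * 0"
    proof (rule DERIV_nonpos_imp_nonincreasing[OF \<tau>])
      fix x :: real assume "0 \<le> x"
      then have "\<kappa> (y (max 0 x)) + c \<le> 0" using c(2)[OF y0[of x]] by simp
      moreover have "((\<lambda>\<tau>. S \<tau> + c * \<tau>) has_real_derivative \<kappa> (y (max 0 x)) + c) (at x)"
        using S'[of x] by (auto intro!: derivative_eq_intros)
      ultimately show "\<exists>d. ((\<lambda>\<tau>. S \<tau> + c * \<tau>) has_real_derivative d) (at x) \<and> d \<le> 0" by blast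
    qed
    then show "S \<tau> \<le> \<sigma> z0 - c * \<tau>" by (simp add: S_def \<Phi>(1))
  qed (use \<theta>(1) \<theta>' \<sigma> in auto)
qed

text \<open>A bounded trajectory has bounded velocity by \<open>g_bounded\<close>, hence is
  Lipschitz; continuity lets the fundamental theorem pass over finitely many bad times.\<close>

lemma abs_cont_on_solution:
  assumes cont: "continuous_on {a..b} z" and F: "finite F"
    and der: "\<And>t. t \<in> {a..b} - F \<Longrightarrow> (z has_vector_derivative g (z t)) (at t within {a..b})"
  shows "abs_cont_on {a..b} z"
proof -
  have "bounded (z ` {a..b})" using cont compact_Icc compact_continuous_image compact_imp_bounded by blast
  then obtain R where R: "\<And>t. t \<in> {a..b} \<Longrightarrow> norm (z t) \<le> R" unfolding bounded_iff by blast
  obtain B0 where "\<And>x. norm x \<le> R \<Longrightarrow> norm (g x) \<le> B0" by (rule g_bounded) (rule that)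
  then have B: "norm (g (z t)) \<le> max B0 0" if "t \<in> {a..b}" for t using R[OF that] by (simp add: le_max_iff_disj)
  have le: "norm (z v - z u) \<le> max B0 0 * (v - u)" if uv: "u \<le> v" "u \<in> {a..b}" "v \<in> {a..b}" for u v
  proof -
    have "((\<lambda>t. g (z t)) has_integral (z v - z u)) {u..v}"
    proof (rule fundamental_theorem_of_calculus_interior_strong[OF F uv(1)])
      show "continuous_on {u..v} z" using uv by (intro continuous_on_subset[OF cont]) auto
      fix x assume x: "x \<in> {u<..<v} - F"
      then have "(z has_vector_derivative g (z x)) (at x within {a..b})" using uv by (intro der) auto
      moreover have "at x within {a..b} = at x" using x uv by (intro at_within_Icc_at) auto
      ultimately show "(z has_vector_derivative g (z x)) (at x)" by simp
    qed
    then have "norm (z v - z u) \<le> max B0 0 * measure lborel {u..v}"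
      using uv by (intro has_integral_bound_real[where f="\<lambda>t. g (z t)" and S="{}"] B) auto
    then show ?thesis using uv by simp
  qed
  show ?thesis
  proof (rule abs_cont_on_lipschitz)
    fix x y assume "x \<in> {a..b}" "y \<in> {a..b}"
    then show "norm (z x - z y) \<le> max B0 0 * \<bar>x - y\<bar>"
      using le[of x y] le[of y x] by (cases "x \<le> y") (auto simp: norm_minus_commute)
  qed
qed

text \<open>The rescaled trajectory is followed for as long as its original time lasts, and
  continued by 0. The exceptional \<open>T\<close> is the settling time, where for \<mu> = -1 the
  velocity need not tend to 0. Invariance of the sublevel sets is phrased with \<open>q\<close> so
  that it includes the value 0.\<close>

lemma forward_solution:
  obtains z where "z 0 = z0" "continuous_on {0..} z"
    "\<exists>T. \<forall>t\<ge>0. t \<noteq> T \<longrightarrow> (z has_vector_derivative g (z t)) (at t within {0..})"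
    "(\<forall>k. 0 < r k + \<mu>) \<longrightarrow> (\<forall>t\<ge>0. (z has_vector_derivative g (z t)) (at t within {0..}))"
    "\<forall>t\<ge>0. \<forall>s. q (dl r (- s) z0) \<le> 1 \<longrightarrow> q (dl r (- s) (z t)) \<le> 1"
    "\<mu> < 0 \<longrightarrow> (\<exists>T\<ge>0. \<forall>t\<ge>T. z t = 0)"
proof (cases "z0 = 0")
  case True
  show thesis by (rule that[of "\<lambda>_. 0"]) (auto simp: True)
next
  case False
  show thesis
  proof (rule rescaled_trajectory[OF False])
    fix \<zeta> S \<theta> c
    assume c: "0 < c" and \<zeta>0: "\<zeta> 0 = z0" and \<theta>0: "\<theta> 0 = (0::real)"
      and \<theta>d: "\<And>\<tau>. \<exists>d>0. (\<theta> has_real_derivative d) (at \<tau>)"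
      and \<theta>': "\<And>\<tau>. 0 \<le> \<tau> \<Longrightarrow> (\<theta> has_real_derivative exp (- \<mu> * S \<tau>)) (at \<tau>)"
      and \<zeta>': "\<And>\<tau>. 0 \<le> \<tau> \<Longrightarrow> (\<zeta> has_vector_derivative exp (- \<mu> * S \<tau>) *\<^sub>R g (\<zeta> \<tau>)) (at \<tau>)"
      and \<zeta>: "\<And>\<tau>. 0 \<le> \<tau> \<Longrightarrow> \<zeta> \<tau> \<noteq> 0" "\<And>\<tau>. 0 \<le> \<tau> \<Longrightarrow> \<sigma> (\<zeta> \<tau>) = S \<tau>"
      and S: "\<And>\<tau>. 0 \<le> \<tau> \<Longrightarrow> S \<tau> \<le> \<sigma> z0 - c * \<tau>"
    have inc: "\<theta> a < \<theta> b" if "a < b" for a b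
      by (rule DERIV_pos_imp_increasing[OF that]) (use \<theta>d in metis)
    have inc_iff: "\<theta> a \<le> \<theta> b \<longleftrightarrow> a \<le> b" for a b using inc[of a b] inc[of b a] by (cases a b rule: linorder_cases) auto
    have cont: "continuous_on A \<theta>" for A
      by (intro continuous_at_imp_continuous_on ballI) (use \<theta>d DERIV_isCont in metis)
    have "inj \<theta>" using inc_iff by (metis antisym injI order_refl)
    define \<iota> where "\<iota> = inv \<theta>"
    have \<iota>: "\<iota> (\<theta> \<tau>) = \<tau>" for \<tau> by (simp add: \<iota>_def \<open>inj \<theta>\<close>)
    \<comment> \<open>The original times reached by the rescaled trajectory: the whole half line or
      a bounded initial piece, according to whether \<open>\<theta>\<close> is unbounded.\<close>
    define J where "J = \<theta> ` {0..}"
    have J: "0 \<le> t \<and> 0 \<le> \<iota> t \<and> \<theta> (\<iota> t) = t" if "t \<in> J" for t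
    proof -
      have "\<exists>\<tau>\<ge>0. t = \<theta> \<tau>" using that by (auto simp: J_def)
      then obtain \<tau> where \<tau>: "0 \<le> \<tau>" "t = \<theta> \<tau>" by blast
      have "\<theta> 0 \<le> \<theta> \<tau>" using inc_iff[of 0 \<tau>] \<tau>(1) by blast
      then show ?thesis using \<tau> by (simp add: \<theta>0 \<iota>)
    qed
    have J0: "0 \<in> J" using \<theta>0 by (force simp: J_def)
    have Jdown: "t \<in> J" if "0 \<le> t" "t \<le> t'" "t' \<in> J" for t t'
    proof -
      have "\<exists>\<tau>\<ge>0. \<tau> \<le> \<iota> t' \<and> \<theta> \<tau> = t" using that J[OF that(3)] \<theta>0 by (intro IVT' cont) auto
      then show ?thesis by (auto simp: J_def)
    qed
    define z where "z t = (if t \<in> J then \<zeta> (\<iota> t) else 0)" for t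
    have z\<sigma>: "z t \<noteq> 0" "\<sigma> (z t) \<le> \<sigma> z0 - c * \<iota> t" if "t \<in> J" for t
      using \<zeta>(1)[of "\<iota> t"] \<zeta>(2)[of "\<iota> t"] S[of "\<iota> t"] J[OF that] that by (simp_all add: z_def)
    have derJ: "(z has_vector_derivative g (z t)) (at t within {0..})" if t: "t \<in> J" for t
    proof -
      let ?\<tau> = "\<iota> t"
      have \<tau>: "0 \<le> ?\<tau>" "\<theta> ?\<tau> = t" "0 \<le> t" using J[OF t] by auto
      let ?e = "exp (- \<mu> * S ?\<tau>)"
      have "(\<iota> has_derivative (\<lambda>x. x / ?e)) (at (\<theta> ?\<tau>))"
      proof (rule has_derivative_inverse_strong[where S=UNIV and f'="\<lambda>x. ?e * x" and f=\<theta>])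
        show "(\<theta> has_derivative (\<lambda>x. ?e * x)) (at ?\<tau>)"
          using \<theta>'[OF \<tau>(1)] by (simp add: has_field_derivative_def)
      qed (auto simp: cont \<iota> fun_eq_iff)
      then have "(\<iota> has_vector_derivative 1 / ?e) (at t)"
        by (simp add: has_vector_derivative_def \<tau>(2))
      then have "((\<zeta> \<circ> \<iota>) has_vector_derivative (1 / ?e) *\<^sub>R (?e *\<^sub>R g (\<zeta> ?\<tau>))) (at t)"
        by (rule vector_diff_chain_at) (rule \<zeta>'[OF \<tau>(1)])
      then have "((\<zeta> \<circ> \<iota>) has_vector_derivative g (z t)) (at t within {0..})"
        using t by (simp add: z_def has_vector_derivative_at_within)
      then show ?thesis
      proof (rule has_vector_derivative_transform_within)
        \<comment> \<open>One more unit of rescaled time is still in \<open>J\<close>, so this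
          neighbourhood stays away from the continuation by 0.\<close>
        show "0 < \<theta> (?\<tau> + 1) - t" using inc[of ?\<tau> "?\<tau> + 1"] \<tau> by simp
        fix x assume x: "x \<in> {0..}" "dist x t < \<theta> (?\<tau> + 1) - t"
        have "\<theta> (?\<tau> + 1) \<in> J" using \<tau> by (auto simp: J_def)
        then have "x \<in> J" using x Jdown[of x "\<theta> (?\<tau> + 1)"] by (auto simp: dist_real_def)
        then show "(\<zeta> \<circ> \<iota>) x = z x" by (simp add: z_def)
      qed (use \<tau> in auto)
    qed
    have small: "\<exists>j\<in>J. \<forall>t\<ge>j. t \<in> J \<longrightarrow> \<sigma> (z t) \<le> s0" for s0
    proof -
      let ?\<tau> = "max 0 ((\<sigma> z0 - s0) / c)"
      have "\<sigma> (z t) \<le> s0" if "t \<in> J" "\<theta> ?\<tau> \<le> t" for t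
      proof -
        have "\<theta> ?\<tau> \<le> \<theta> (\<iota> t)" using that J by simp
        then have "(\<sigma> z0 - s0) / c \<le> \<iota> t" unfolding inc_iff by simp
        then have "\<sigma> z0 - s0 \<le> c * \<iota> t" using c by (simp add: field_simps)
        then show ?thesis using z\<sigma>(2)[OF that(1)] by simp
      qed
      moreover have "\<theta> ?\<tau> \<in> J" by (auto simp: J_def)
      ultimately show ?thesis by blast
    qed
    obtain W where W: "0 < W" "\<And>w. q w \<le> 1 \<Longrightarrow> norm w \<le> W" by (rule norm_le_of_q_le_1) (rule that)
    obtain b where b: "0 < b" "\<And>x. norm (H x) \<le> b * norm x" by (rule H_bound) (rule that)
    have z_small: "\<exists>j\<in>J. \<forall>t\<ge>j. norm (z t) < \<epsilon>" if "0 < \<epsilon>" for \<epsilon>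
    proof -
      obtain s0 where s0: "\<And>s y. s \<le> s0 \<Longrightarrow> norm y \<le> W \<Longrightarrow> norm (dl r s y) < \<epsilon>"
        by (rule dl_small[of r \<epsilon> W]) (use W r_pos \<open>0 < \<epsilon>\<close> that in auto)
      obtain j where j: "j \<in> J" "\<forall>t\<ge>j. t \<in> J \<longrightarrow> \<sigma> (z t) \<le> s0" using small by blast
      have "norm (z t) < \<epsilon>" if "t \<ge> j" for t
      proof (cases "t \<in> J")
        case True
        have "norm (dl r (\<sigma> (z t)) (dl r (- \<sigma> (z t)) (z t))) < \<epsilon>"
          using j that True q_sigma[OF z\<sigma>(1)[OF True]] by (intro s0 W) auto
        then show ?thesis by simp
      qed (use \<open>0 < \<epsilon>\<close> in \<open>simp add: z_def\<close>)
      then show ?thesis using j by blast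
    qed
    \<comment> \<open>With strictly positive weights the velocity itself tends to 0; this is what
      separates \<mu> > -1 from \<mu> = -1.\<close>
    have g_small: "\<exists>j\<in>J. \<forall>t\<ge>j. norm (g (z t)) < \<epsilon>" if \<epsilon>: "0 < \<epsilon>" and pos: "\<And>k. 0 < r k + \<mu>" for \<epsilon>
    proof -
      obtain s0 where s0: "\<And>s y. s \<le> s0 \<Longrightarrow> norm y \<le> b * W \<Longrightarrow> norm (dl (\<lambda>k. r k + \<mu>) s y) < \<epsilon>"
        by (rule dl_small[of "\<lambda>k. r k + \<mu>" \<epsilon> "b * W"]) (use W b pos \<epsilon> that in auto)
      obtain j where j: "j \<in> J" "\<forall>t\<ge>j. t \<in> J \<longrightarrow> \<sigma> (z t) \<le> s0" using small by blast
      have "norm (g (z t)) < \<epsilon>" if "t \<ge> j" for t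
      proof (cases "t \<in> J")
        case True
        have "norm (dl (\<lambda>k. r k + \<mu>) (\<sigma> (z t)) (H (dl r (- \<sigma> (z t)) (z t)))) < \<epsilon>"
          using j that True q_sigma[OF z\<sigma>(1)[OF True]] b(1)
          by (intro s0 order_trans[OF b(2)] mult_left_mono W) auto
        then show ?thesis using z\<sigma>(1)[OF True] by (simp add: g_def)
      qed (use \<open>0 < \<epsilon>\<close> in \<open>simp add: z_def\<close>)
      then show ?thesis using j by blast
    qed
    define N where "N = {0..} - J"
    \<comment> \<open>If all times are reached, -1 makes the exception vacuous for t \<ge>
      0.\<close>
    define T where "T = (if N = {} then -1 else Inf N)"
    have N: "0 \<le> t" "t \<notin> J" "z t = 0" "j < t" if "t \<in> N" "j \<in> J" for t j
      using that Jdown[of t j] by (force simp: N_def z_def)+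
    have N_der: "(z has_vector_derivative g (z t)) (at t within {0..})" if t: "t \<in> N" "t \<noteq> T" for t
    proof -
      have bdd: "bdd_below N" by (rule bdd_belowI[of _ 0]) (auto simp: N_def)
      then have "Inf N < t" using t cInf_lower[OF t(1) bdd] by (auto simp: T_def less_le split: if_splits)
      then obtain t' where t': "t' \<in> N" "t' < t" using cInf_lessD[of N t] t by auto
      have "((\<lambda>_. 0) has_vector_derivative g (z t)) (at t within {0..})"
        using N(3)[OF t(1) J0] by simp
      then show ?thesis
      proof (rule has_vector_derivative_transform_within)
        fix x assume "x \<in> {0..}" "dist x t < t - t'"
        then have "t' \<le> x" by (auto simp: dist_real_def)
        then have "x \<notin> J" using Jdown[of t' x] t' by (auto simp: N_def)
        then show "0 = z x" by (simp add: z_def)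
      qed (use t t' in \<open>auto simp: N_def\<close>)
    qed
    have contz: "continuous_on {0..} z"
      unfolding continuous_on_eq_continuous_within
    proof
      fix t :: real assume "t \<in> {0..}"
      show "continuous (at t within {0..}) z"
      proof (cases "t \<in> J")
        case True
        from has_vector_derivative_continuous[OF derJ[OF this]] show ?thesis .
      next
        case F: False
        then have t: "t \<in> N" using \<open>t \<in> {0..}\<close> by (simp add: N_def)
        show ?thesis
          unfolding continuous_within_eps_delta
        proof (intro allI impI)
          fix \<epsilon> :: real assume "0 < \<epsilon>"
          then obtain j where j: "j \<in> J" "\<forall>t\<ge>j. norm (z t) < \<epsilon>" using z_small by blast
          show "\<exists>d>0. \<forall>x'\<in>{0..}. dist x' t < d \<longrightarrow> dist (z x') (z t) < \<epsilon>"
            using N[OF t j(1)] j(2) by (intro exI[of _ "t - j"]) (auto simp: dist_real_def)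
        qed
      qed
    qed
    \<comment> \<open>Before \<open>T\<close> the mean value theorem passes the smallness of the
      velocity on to the difference quotient; after \<open>T\<close> the function is 0.\<close>
    have T_der: "(z has_vector_derivative g (z T)) (at T within {0..})" if T: "T \<in> N" and pos: "\<And>k. 0 < r k + \<mu>"
    proof -
      have zT: "z T = 0" using N(3)[OF T J0] .
      have before: "x \<in> J" if "0 \<le> x" "x < T" for x
      proof (rule ccontr)
        assume "x \<notin> J"
        then have "x \<in> N" using that by (simp add: N_def)
        moreover have "bdd_below N" by (rule bdd_belowI[of _ 0]) (auto simp: N_def)
        ultimately have "Inf N \<le> x" by (rule cInf_lower)
        then show False using that T by (auto simp: T_def split: if_splits)
      qed
      have after: "z x = 0" if "T \<le> x" for x
      proof -
        have "x \<notin> J" using Jdown[of T x] that T by (auto simp: N_def)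
        then show ?thesis by (simp add: z_def)
      qed
      show ?thesis
        unfolding has_vector_derivative_def has_derivative_within_alt
      proof (intro conjI allI impI)
        fix \<epsilon> :: real assume "0 < \<epsilon>"
        then obtain j where j: "j \<in> J" "\<forall>t\<ge>j. norm (g (z t)) < \<epsilon>" using g_small pos by blast
        have jT: "j < T" using N(4)[OF T j(1)] .
        have "norm (z u - z T - (u - T) *\<^sub>R g (z T)) \<le> \<epsilon> * norm (u - T)" if u: "u \<in> {0..}" "norm (u - T) < T - j" for u
        proof (cases "u < T")
          case True
          have "continuous_on {u..T} z" using u by (intro continuous_on_subset[OF contz]) auto
          moreover have "(z has_derivative (\<lambda>h. h *\<^sub>R g (z x))) (at x)" if x: "u < x" "x < T" for x
          proof -
            have "at x within {0..} = at x" using x u by (intro at_within_interior) (auto simp: interior_Ici)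
            moreover have "x \<in> J" using before x u by auto
            ultimately show ?thesis using derJ[of x] by (simp add: has_vector_derivative_def)
          qed
          ultimately obtain x where x: "x \<in> {u<..<T}" "norm (z T - z u) \<le> norm ((T - u) *\<^sub>R g (z x))"
            using mvt_general[OF True, of z "\<lambda>x h. h *\<^sub>R g (z x)"] by auto
          have "norm (g (z x)) \<le> \<epsilon>" using j(2) x(1) u True by (auto intro: less_imp_le)
          then have "norm ((T - u) *\<^sub>R g (z x)) \<le> (T - u) * \<epsilon>" using True by (auto intro: mult_left_mono)
          with x(2) have "norm (z T - z u) \<le> (T - u) * \<epsilon>" by (rule order_trans)
          then show ?thesis using zT True by (simp add: mult.commute)
        qed (use after zT \<open>0 < \<epsilon>\<close> in auto)
        then show "\<exists>d>0. \<forall>y\<in>{0..}. norm (y - T) < d \<longrightarrow> norm (z y - z T - (y - T) *\<^sub>R g (z T)) \<le> \<epsilon> * norm (y - T)"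
          using jT by (intro exI[of _ "T - j"]) auto
      qed (rule bounded_linear_scaleR_left)
    qed
    have cases: "t \<in> J \<or> t \<in> N" if "0 \<le> t" for t using that by (auto simp: N_def)
    show thesis
    proof (rule that)
      show "z 0 = z0" using J0 \<iota>[of 0] \<theta>0 \<zeta>0 by (simp add: z_def)
      show "\<exists>T. \<forall>t\<ge>0. t \<noteq> T \<longrightarrow> (z has_vector_derivative g (z t)) (at t within {0..})"
        using derJ N_der cases by blast
      show "(\<forall>k. 0 < r k + \<mu>) \<longrightarrow> (\<forall>t\<ge>0. (z has_vector_derivative g (z t)) (at t within {0..}))"
        using derJ N_der T_der cases by blast
      show "\<forall>t\<ge>0. \<forall>s. q (dl r (- s) z0) \<le> 1 \<longrightarrow> q (dl r (- s) (z t)) \<le> 1"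
      proof (intro allI impI)
        fix t s :: real assume "0 \<le> t" and s: "q (dl r (- s) z0) \<le> 1"
        show "q (dl r (- s) (z t)) \<le> 1"
        proof (cases "t \<in> J")
          case True
          have "0 \<le> c * \<iota> t" using c J[OF True] by simp
          then have "\<sigma> (z t) \<le> s" using z\<sigma>(2)[OF True] s sigma_le_iff[OF False, of s] by linarith
          then show ?thesis using sigma_le_iff[OF z\<sigma>(1)[OF True]] by blast
        qed (simp add: z_def)
      qed
      show "\<mu> < 0 \<longrightarrow> (\<exists>T\<ge>0. \<forall>t\<ge>T. z t = 0)"
      proof
        assume \<mu>: "\<mu> < 0"
        \<comment> \<open>The integral of exp (- \<mu> (\<sigma> z0 - c \<tau>)) over all \<tau>
          \<ge> 0, where the exponent contains the linear upper bound for \<open>S\<close>.\<close>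
        define K where "K = exp (- \<mu> * \<sigma> z0) / (- \<mu> * c)"
        have K: "0 < K" using \<mu> c by (simp add: K_def mult_neg_pos divide_pos_neg)
        have "\<theta> \<tau> < K" if \<tau>: "0 \<le> \<tau>" for \<tau>
        proof -
          \<comment> \<open>The term compared with \<open>\<theta>\<close> is the same integral up
            to \<tau>.\<close>
          have "\<theta> \<tau> - K * (1 - exp (\<mu> * c * \<tau>)) \<le> \<theta> 0 - K * (1 - exp (\<mu> * c * 0))"
          proof (rule DERIV_nonpos_imp_nonincreasing[OF \<tau>])
            fix x :: real assume x: "0 \<le> x"
            have "((\<lambda>\<tau>. \<theta> \<tau> - K * (1 - exp (\<mu> * c * \<tau>))) has_real_derivative
                exp (- \<mu> * S x) + K * (exp (\<mu> * c * x) * (\<mu> * c))) (at x)"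
              by (auto intro!: derivative_eq_intros \<theta>'[OF x])
            moreover have "K * (exp (\<mu> * c * x) * (\<mu> * c)) = - exp (- \<mu> * (\<sigma> z0 - c * x))"
              using \<mu> c by (simp add: K_def field_simps flip: exp_add)
            moreover have "exp (- \<mu> * S x) \<le> exp (- \<mu> * (\<sigma> z0 - c * x))"
              using S[OF x] \<mu> by (subst exp_le_cancel_iff) (intro mult_left_mono, auto)
            ultimately show "\<exists>d. ((\<lambda>\<tau>. \<theta> \<tau> - K * (1 - exp (\<mu> * c * \<tau>))) has_real_derivative d) (at x) \<and> d \<le> 0"
              by (metis add.inverse_inverse diff_le_0_iff_le diff_minus_eq_add)
          qed
          then have "\<theta> \<tau> \<le> K * (1 - exp (\<mu> * c * \<tau>))" using \<theta>0 by simp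
          also have "\<dots> < K" using K by (simp add: algebra_simps)
          finally show ?thesis .
        qed
        then have "z t = 0" if "K \<le> t" for t using that by (force simp: z_def J_def)
        then show "\<exists>T\<ge>0. \<forall>t\<ge>T. z t = 0" using K by (intro exI[of _ K]) auto
      qed
    qed (rule contz)
  qed
qed

section \<open>The network of followers\<close>

definition F :: "(real^'n)^'m::finite \<Rightarrow> (real^'n)^'m" where
  "F e = (\<chi> i. g (e $ i))"

text \<open>Closed balls are convex, so continuity of \<open>g\<close> at a nonzero component pins
  that component of the regularization, whatever the vanishing components do.\<close>

lemma filippov_F_nth:
  fixes e y :: "(real^'n)^'m::finite"
  assumes y: "y \<in> filippov F e" and ne: "e $ i \<noteq> 0"
  shows "y $ i = g (e $ i)"
proof -
  have "dist (y $ i) (g (e $ i)) \<le> \<epsilon>" if "0 < \<epsilon>" for \<epsilon>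
  proof -
    obtain \<delta> where \<delta>: "0 < \<delta>" "\<And>x. dist x (e $ i) < \<delta> \<Longrightarrow> dist (g x) (g (e $ i)) < \<epsilon>"
      using isCont_g[OF ne] \<open>0 < \<epsilon>\<close> unfolding continuous_at_eps_delta by blast
    let ?C = "(\<lambda>y. y $ i) -` cball (g (e $ i)) \<epsilon>"
    have lin: "bounded_linear (\<lambda>y :: (real^'n)^'m. y $ i)" by (rule bounded_linear_vec_nth)
    have "F ` ball e \<delta> \<subseteq> ?C"
    proof
      fix w assume "w \<in> F ` ball e \<delta>"
      then obtain x where x: "dist e x < \<delta>" "w = F x" by auto
      then have "dist (x $ i) (e $ i) < \<delta>" using dist_vec_nth_le[of x i e] by (simp add: dist_commute)
      then show "w \<in> ?C" using \<delta>(2)[of "x $ i"] x by (simp add: F_def dist_commute less_imp_le)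
    qed
    moreover have "convex ?C" by (rule convex_linear_vimage[OF bounded_linear.linear[OF lin]]) simp
    moreover have "closed ?C" by (rule closed_vimage) (auto intro: linear_continuous_on[OF lin])
    ultimately have "closure (convex hull (F ` ball e \<delta>)) \<subseteq> ?C" by (intro closure_minimal hull_minimal)
    moreover have "y \<in> closure (convex hull (F ` (ball e \<delta> - {})))"
      using y \<delta>(1) unfolding filippov_def by blast
    ultimately show ?thesis by (auto simp: dist_commute)
  qed
  then have "dist (y $ i) (g (e $ i)) \<le> 0" by (rule field_le_epsilon[of _ 0, simplified])
  then show ?thesis by simp
qed

text \<open>At a zero component the oddness of g is used: averaging F over a point and its reflection in
  the zero components of e cancels these components.\<close>

lemma F_in_filippov: "F e \<in> filippov F (e :: (real^'n)^'m::finite)"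
proof -
  define R where "R x = (\<chi> i. if e $ i = 0 then - (x $ i) else x $ i)" for x :: "(real^'n)^'m"
  \<comment> \<open>The average of \<open>F x\<close> and \<open>F (R x)\<close>. Unlike
    \<open>F\<close> it is continuous at \<open>e\<close>, since the components that could jump are
    gone.\<close>
  define M where "M x = (\<chi> i. if e $ i = 0 then 0 else g (x $ i))" for x :: "(real^'n)^'m"
  have R: "R (R x) = x" "R e = e" "R (x - y) = R x - R y" "norm (R x) = norm x" for x y
    by (auto simp: R_def vec_eq_iff norm_vec_def intro!: arg_cong[where f="\<lambda>f. L2_set f UNIV"])
  have linR: "linear R" by (rule linearI) (auto simp: R_def vec_eq_iff)
  have mid: "(1/2) *\<^sub>R F x + (1/2) *\<^sub>R F (R x) = M x" for x
    by (auto simp: F_def M_def R_def vec_eq_iff g_minus simp flip: scaleR_add_left)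
  have Me: "M e = F e" by (auto simp: M_def F_def intro!: arg_cong[where f=vec_lambda])
  have Mc: "isCont M e"
    unfolding isCont_def
  proof (rule vec_tendstoI)
    fix i
    show "((\<lambda>x. M x $ i) \<longlongrightarrow> M e $ i) (at e)"
    proof (cases "e $ i = 0")
      case False
      have "isCont (\<lambda>x. g (x $ i)) e"
        using isCont_o2[OF bounded_linear.isCont[OF bounded_linear_vec_nth continuous_ident] isCont_g[OF False]] .
      then show ?thesis using False by (simp add: M_def isCont_def)
    qed (simp add: M_def)
  qed
  have "F e \<in> closure (convex hull (F ` (ball e \<delta> - Z)))" if "0 < \<delta>" "negligible Z" for \<delta> Z
    unfolding closure_approachable
  proof (intro allI impI)
    fix \<epsilon> :: real assume "0 < \<epsilon>"
    then obtain \<eta> where \<eta>: "0 < \<eta>" "\<And>x. dist x e < \<eta> \<Longrightarrow> dist (M x) (M e) < \<epsilon>"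
      using Mc unfolding continuous_at_eps_delta by blast
    \<comment> \<open>Both \<open>x\<close> and \<open>R x\<close> have to avoid \<open>Z\<close>;
      the linear image of a null set is null, while a ball is not.\<close>
    have "negligible (Z \<union> R ` Z)"
      using that(2) linR by (intro negligible_Un negligible_differentiable_image_negligible linear_imp_differentiable_on) auto
    moreover have "\<not> negligible (ball e (min \<eta> \<delta>))"
      using \<eta>(1) that(1) by (intro open_not_negligible) auto
    ultimately obtain x where x: "x \<in> ball e (min \<eta> \<delta>)" "x \<notin> Z" "x \<notin> R ` Z"
      using negligible_subset by blast
    have "R x \<notin> Z" using x(3) R(1)[of x] by (metis image_eqI)
    moreover have "dist e (R x) = dist e x" using R(2) R(3)[of e x] R(4)[of "e - x"] by (simp add: dist_norm)
    ultimately have "R x \<in> ball e \<delta> - Z" "x \<in> ball e \<delta> - Z" using x by auto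
    then have "(1/2) *\<^sub>R F x + (1/2) *\<^sub>R F (R x) \<in> convex hull (F ` (ball e \<delta> - Z))"
      by (intro convexD[OF convex_convex_hull]) (auto intro!: hull_inc)
    moreover have "dist (M x) (F e) < \<epsilon>" using \<eta>(2)[of x] x(1) by (simp add: Me dist_commute)
    ultimately show "\<exists>y\<in>convex hull (F ` (ball e \<delta> - Z)). dist y (F e) < \<epsilon>"
      unfolding mid by blast
  qed
  then show ?thesis by (simp add: filippov_def)
qed

section \<open>From single followers to solutions of the network\<close>

lemma weak_solution_subset:
  assumes "weak_solution S z" "S' \<subseteq> S"
  shows "weak_solution S' z"
proof -
  obtain Z where "negligible Z" "\<forall>t\<in>S - Z. z t \<noteq> 0 \<longrightarrow> (z has_vector_derivative g (z t)) (at t within S)"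
    using assms(1) by (auto simp: weak_solution_def)
  moreover have "(z has_vector_derivative g (z t)) (at t within S')" if "(z has_vector_derivative g (z t)) (at t within S)" for t
    using that assms(2) by (rule has_vector_derivative_within_subset)
  ultimately show ?thesis using assms unfolding weak_solution_def by (meson Diff_iff subsetD subset_trans)
qed

text \<open>For Filippov solutions the velocity is determined only in nonzero components, which is
  all that is asked; for classical ones absolute continuity comes from the bounded velocity.\<close>

lemma solution_imp_weak_solution:
  fixes e :: "real \<Rightarrow> (real^'n)^'m::finite"
  assumes "solution \<mu> F S e"
  shows "weak_solution S (\<lambda>t. e t $ i)"
proof (cases "\<mu> = -1")
  case True
  then have f: "filippov_solution F S e" using assms by (simp add: solution_def)
  then obtain Z where Z: "negligible Z" "\<And>t. t \<in> S - Z \<Longrightarrow> \<exists>y\<in>filippov F (e t). (e has_vector_derivative y) (at t within S)"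
    unfolding filippov_solution_def by blast
  have "((\<lambda>t. e t $ i) has_vector_derivative g (e t $ i)) (at t within S)" if "t \<in> S - Z" "e t $ i \<noteq> 0" for t
    using Z(2)[OF that(1)] filippov_F_nth that(2) by (metis has_vector_derivative_vec_iff)
  moreover have "abs_cont_on {a..b} (\<lambda>t. e t $ i)" if "{a..b} \<subseteq> S" for a b
  proof (rule abs_cont_on_lipschitz_comp[where C=1])
    show "abs_cont_on {a..b} e" using f that by (simp add: filippov_solution_def)
    show "norm (e x $ i - e y $ i) \<le> 1 * norm (e x - e y)" for x y
      using Finite_Cartesian_Product.norm_nth_le[of "e x - e y" i] by simp
  qed
  ultimately show ?thesis using Z(1) unfolding weak_solution_def by blast
next
  case False
  then have d: "((\<lambda>t. e t $ i) has_vector_derivative g (e t $ i)) (at t within S)" if "t \<in> S" for t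
    using assms that by (auto simp: solution_def classical_solution_def has_vector_derivative_vec_iff F_def)
  have "abs_cont_on {a..b} (\<lambda>t. e t $ i)" if ab: "{a..b} \<subseteq> S" for a b
  proof (rule abs_cont_on_solution[where F="{}"])
    have d': "((\<lambda>t. e t $ i) has_vector_derivative g (e t $ i)) (at t within {a..b})" if "t \<in> {a..b}" for t
      using d[of t] that ab has_vector_derivative_within_subset by blast
    then show "continuous_on {a..b} (\<lambda>t. e t $ i)"
      unfolding continuous_on_eq_continuous_within by (blast intro: has_vector_derivative_continuous)
    show "((\<lambda>t. e t $ i) has_vector_derivative g (e t $ i)) (at t within {a..b})" if "t \<in> {a..b} - {}" for t
      using that d' by simp
  qed simp
  then show ?thesis using d unfolding weak_solution_def by (intro conjI exI[of _ "{}"]) auto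
qed

lemma solution_unique:
  fixes e e' :: "real \<Rightarrow> (real^'n)^'m::finite"
  assumes "solution \<mu> F S e" "solution \<mu> F S' e'" "{0..<T} \<subseteq> S" "{0..<T} \<subseteq> S'" "e 0 = e' 0" "t \<in> {0..<T}"
  shows "e t = e' t"
proof -
  have "e t $ i = e' t $ i" for i
    using weak_solution_unique[OF weak_solution_subset[OF solution_imp_weak_solution[OF assms(1), of i] assms(3)]
        weak_solution_subset[OF solution_imp_weak_solution[OF assms(2), of i] assms(4)] _ assms(6)] assms(5) by simp
  then show ?thesis by (simp add: vec_eq_iff)
qed

lemma solution_exists:
  fixes e0 :: "(real^'n)^'m::finite"
  assumes \<mu>: "\<mu> \<noteq> -1 \<longrightarrow> (\<forall>k. 0 < r k + \<mu>)"
  obtains e where "solution \<mu> F {0..} e" "e 0 = e0"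
    "\<And>t s i. 0 \<le> t \<Longrightarrow> q (dl r (- s) (e0 $ i)) \<le> 1 \<Longrightarrow> q (dl r (- s) (e t $ i)) \<le> 1"
    "\<mu> < 0 \<Longrightarrow> \<exists>T\<ge>0. \<forall>t\<ge>T. e t = 0"
proof -
  define Q where "Q i z \<longleftrightarrow> z 0 = e0 $ i \<and>
      (\<exists>T. \<forall>t\<ge>0. t \<noteq> T \<longrightarrow> (z has_vector_derivative g (z t)) (at t within {0..})) \<and>
      ((\<forall>k. 0 < r k + \<mu>) \<longrightarrow> (\<forall>t\<ge>0. (z has_vector_derivative g (z t)) (at t within {0..}))) \<and>
      (\<forall>t\<ge>0. \<forall>s. q (dl r (- s) (e0 $ i)) \<le> 1 \<longrightarrow> q (dl r (- s) (z t)) \<le> 1) \<and>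
      (\<mu> < 0 \<longrightarrow> (\<exists>T\<ge>0. \<forall>t\<ge>T. z t = 0))" for i and z :: "real \<Rightarrow> real^'n"
  have "\<forall>i. \<exists>z. continuous_on {0..} z \<and> Q i z"
  proof
    fix i
    show "\<exists>z. continuous_on {0..} z \<and> Q i z"
      unfolding Q_def by (rule forward_solution[of "e0 $ i"]) (rule exI, (rule conjI | assumption)+)
  qed
  from choice[OF this] obtain z where zQ: "\<forall>i. continuous_on {0..} (z i) \<and> Q i (z i)" by (elim exE)
  have z: "z i 0 = e0 $ i" "continuous_on {0..} (z i)"
      "\<exists>T. \<forall>t\<ge>0. t \<noteq> T \<longrightarrow> (z i has_vector_derivative g (z i t)) (at t within {0..})"
      "(\<forall>k. 0 < r k + \<mu>) \<longrightarrow> (\<forall>t\<ge>0. (z i has_vector_derivative g (z i t)) (at t within {0..}))"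
      "\<forall>t\<ge>0. \<forall>s. q (dl r (- s) (e0 $ i)) \<le> 1 \<longrightarrow> q (dl r (- s) (z i t)) \<le> 1"
      "\<mu> < 0 \<longrightarrow> (\<exists>T\<ge>0. \<forall>t\<ge>T. z i t = 0)" for i
    using spec[OF zQ, of i] unfolding Q_def by blast+
  define e where "e t = (\<chi> i. z i t)" for t
  show thesis
  proof (rule that[of e])
    show "solution \<mu> F {0..} e"
    proof (cases "\<mu> = -1")
      case False
      then show ?thesis using z(4) \<mu>
        by (auto simp: solution_def classical_solution_def has_vector_derivative_vec_iff F_def e_def)
    next
      case True
      have "\<forall>i. \<exists>T. \<forall>t\<ge>0. t \<noteq> T \<longrightarrow> (z i has_vector_derivative g (z i t)) (at t within {0..})"
        using z(3) by blast
      from choice[OF this] obtain T where T: "\<forall>i. \<forall>t\<ge>0. t \<noteq> T i \<longrightarrow> (z i has_vector_derivative g (z i t)) (at t within {0..})"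
        by (elim exE)
      have "abs_cont_on {a..b} (z i)" if ab: "{a..b} \<subseteq> {0..}" for a b i
      proof (rule abs_cont_on_solution[where F="{T i}"])
        show "continuous_on {a..b} (z i)" using z(2) ab by (rule continuous_on_subset)
        fix t assume t: "t \<in> {a..b} - {T i}"
        then have "0 \<le> t" using ab by auto
        then have "(z i has_vector_derivative g (z i t)) (at t within {0..})" using T t by auto
        then show "(z i has_vector_derivative g (z i t)) (at t within {a..b})"
          using ab by (rule has_vector_derivative_within_subset)
      qed simp
      then have "abs_cont_on {a..b} e" if "{a..b} \<subseteq> {0..}" for a b
        unfolding e_def using that by (intro abs_cont_on_vec_lambda) blast
      \<comment> \<open>Each follower has at most one bad time, so the exceptional set is
        finite.\<close>
      moreover have "\<exists>y\<in>filippov F (e t). (e has_vector_derivative y) (at t within {0..})" if "t \<in> {0..} - range T" for t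
      proof
        show "(e has_vector_derivative F (e t)) (at t within {0..})"
          using T that by (auto simp: has_vector_derivative_vec_iff F_def e_def)
      qed (rule F_in_filippov)
      moreover have "negligible (range T)" by (intro negligible_finite) simp
      ultimately have "filippov_solution F {0..} e" unfolding filippov_solution_def by blast
      then show ?thesis using True by (simp add: solution_def)
    qed
    show "e 0 = e0" by (simp add: e_def z(1))
    show "q (dl r (- s) (e t $ i)) \<le> 1" if "0 \<le> t" "q (dl r (- s) (e0 $ i)) \<le> 1" for t s i
      using z(5)[of i] that by (simp add: e_def)
    assume "\<mu> < 0"
    then have "\<forall>i. \<exists>T\<ge>0. \<forall>t\<ge>T. z i t = 0" using z(6) by blast
    from choice[OF this] obtain T where T: "\<forall>i. 0 \<le> T i \<and> (\<forall>t\<ge>T i. z i t = 0)" by (elim exE)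
    have "e t = 0" if "Max (insert 0 (range T)) \<le> t" for t
      using T that by (auto simp: e_def vec_eq_iff)
    then show "\<exists>T\<ge>0. \<forall>t\<ge>T. e t = 0" by (intro exI[of _ "Max (insert 0 (range T))"]) auto
  qed
qed

lemma unique_forward_solutions_F:
  assumes \<mu>: "\<mu> \<noteq> -1 \<longrightarrow> (\<forall>k. 0 < r k + \<mu>)"
  shows "unique_forward_solutions (solution \<mu> (F :: (real^'n)^'m::finite \<Rightarrow> _))"
  unfolding unique_forward_solutions_def
proof
  fix e0 :: "(real^'n)^'m"
  obtain e where e: "solution \<mu> F {0..} e" "e 0 = e0" by (rule solution_exists[OF \<mu>]) (rule that)
  have "e' t = e t" if "solution \<mu> F {0..<T} e'" "e' 0 = e0" "t \<in> {0..<T}" for T e' t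
    by (rule solution_unique[of "{0..<T}" e' "{0..}" e T t]) (use that e in auto)
  then show "\<exists>e. solution \<mu> F {0..} e \<and> e 0 = e0 \<and>
      (\<forall>T>0. \<forall>e'. solution \<mu> F {0..<T} e' \<and> e' 0 = e0 \<longrightarrow> (\<forall>t\<in>{0..<T}. e' t = e t))"
    using e by blast
qed

text \<open>By uniqueness every solution is the constructed one and inherits its settling time.
  Stability holds because sublevel sets of the homogeneous norm are invariant and form arbitrarily
  small neighbourhoods of 0.\<close>

lemma globally_finite_time_stable_F:
  assumes \<mu>: "\<mu> \<noteq> -1 \<longrightarrow> (\<forall>k. 0 < r k + \<mu>)" and neg: "\<mu> < 0"
  shows "globally_finite_time_stable (solution \<mu> (F :: (real^'n)^'m::finite \<Rightarrow> _))"
  unfolding globally_finite_time_stable_def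
proof
  have same: "e t = e' t" if "solution \<mu> F {0..} e" "solution \<mu> F {0..} e'" "e 0 = e' 0" "0 \<le> t"
    for e e' :: "real \<Rightarrow> (real^'n)^'m" and t
    \<comment> \<open>Uniqueness concerns half-open intervals, so t is enclosed in one ending at t +
      1.\<close>
    by (rule solution_unique[of "{0..}" e "{0..}" e' "t + 1" t]) (use that in auto)
  show "lyapunov_stable (solution \<mu> (F :: (real^'n)^'m \<Rightarrow> _))"
    unfolding lyapunov_stable_def
  proof (intro allI impI)
    fix \<epsilon> :: real assume "0 < \<epsilon>"
    \<comment> \<open>The norm of the network state is at most the sum of the norms of the
      followers.\<close>
    define \<epsilon>' where "\<epsilon>' = \<epsilon> / real CARD('m)"
    have \<epsilon>': "0 < \<epsilon>'" using \<open>0 < \<epsilon>\<close> by (simp add: \<epsilon>'_def)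
    obtain W where W: "0 < W" "\<And>w. q w \<le> 1 \<Longrightarrow> norm w \<le> W" by (rule norm_le_of_q_le_1) (rule that)
    obtain s where s: "\<And>s' y. s' \<le> s \<Longrightarrow> norm y \<le> W \<Longrightarrow> norm (dl r s' y) < \<epsilon>'"
      by (rule dl_small[of r \<epsilon>' W]) (use W r_pos \<epsilon>' that in auto)
    have small: "norm z < \<epsilon>'" if "q (dl r (- s) z) \<le> 1" for z
      using s[OF order_refl W(2)[OF that]] by simp
    have "continuous_on UNIV (\<lambda>z. q (dl r (- s) z))"
      by (intro continuous_on_compose2[OF continuous_q[of UNIV]] linear_continuous_on linear_linear[THEN iffD2] linear_dl) auto
    then have "open {z. q (dl r (- s) z) < 1}" by (intro open_Collect_less) auto
    moreover have "0 \<in> {z. q (dl r (- s) z) < 1}" by simp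
    ultimately obtain \<delta> where \<delta>: "0 < \<delta>" "ball 0 \<delta> \<subseteq> {z. q (dl r (- s) z) < 1}" by (meson open_contains_ball)
    show "\<exists>\<delta>>0. \<forall>e. solution \<mu> F {0..} e \<and> norm (e 0) < \<delta> \<longrightarrow> (\<forall>t\<ge>0. norm (e t :: (real^'n)^'m) < \<epsilon>)"
    proof (intro exI[of _ \<delta>] conjI allI impI)
      fix e :: "real \<Rightarrow> (real^'n)^'m" and t :: real assume e: "solution \<mu> F {0..} e \<and> norm (e 0) < \<delta>" and t: "0 \<le> t"
      obtain e' where e': "solution \<mu> F {0..} e'" "e' 0 = e 0"
        "\<And>t s i. 0 \<le> t \<Longrightarrow> q (dl r (- s) (e 0 $ i)) \<le> 1 \<Longrightarrow> q (dl r (- s) (e' t $ i)) \<le> 1"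
        by (rule solution_exists[OF \<mu>, of "e 0"]) (rule that)
      have et: "e t = e' t" by (rule same) (use e e'(1,2) t in auto)
      have "norm (e' t $ i) < \<epsilon>'" for i
      proof -
        have "e 0 $ i \<in> ball 0 \<delta>" using e Finite_Cartesian_Product.norm_nth_le[of "e 0" i] by auto
        then have "q (dl r (- s) (e 0 $ i)) \<le> 1" using \<delta>(2) by (auto intro: less_imp_le)
        then show ?thesis using small e'(3)[OF t] by blast
      qed
      then have "(\<Sum>i\<in>UNIV. norm (e' t $ i)) < (\<Sum>i\<in>(UNIV::'m set). \<epsilon>')" by (intro sum_strict_mono) auto
      moreover have "norm (e' t) \<le> (\<Sum>i\<in>UNIV. norm (e' t $ i))" unfolding norm_vec_def by (rule L2_set_le_sum) simp
      ultimately show "norm (e t) < \<epsilon>" by (simp add: et \<epsilon>'_def)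
    qed (rule \<delta>(1))
  qed
  have "\<forall>e0. \<exists>T\<ge>0. \<forall>e :: real \<Rightarrow> (real^'n)^'m. solution \<mu> F {0..} e \<and> e 0 = e0 \<longrightarrow> (\<forall>t\<ge>T. e t = 0)"
  proof
    fix e0 :: "(real^'n)^'m"
    obtain e' where e': "solution \<mu> F {0..} e'" "e' 0 = e0" "\<mu> < 0 \<Longrightarrow> \<exists>T\<ge>0. \<forall>t\<ge>T. e' t = 0"
      by (rule solution_exists[OF \<mu>, of e0]) (rule that)
    then obtain T where T: "0 \<le> T" "\<forall>t\<ge>T. e' t = 0" using neg by blast
    have "e t = 0" if "solution \<mu> F {0..} e" "e 0 = e0" "T \<le> t" for e t
      using same[OF that(1) e'(1), of t] that T e'(2) by auto
    then show "\<exists>T\<ge>0. \<forall>e :: real \<Rightarrow> (real^'n)^'m. solution \<mu> F {0..} e \<and> e 0 = e0 \<longrightarrow> (\<forall>t\<ge>T. e t = 0)"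
      using T(1) by blast
  qed
  from choice[OF this] show "\<exists>T. (\<forall>e0. 0 \<le> T e0) \<and> (\<forall>e. solution \<mu> F {0..} e \<longrightarrow> (\<forall>t\<ge>T (e 0). e t = (0 :: (real^'n)^'m)))"
    by blast
qed

end

section \<open>The transmitted vectors\<close>

text \<open>Maximum principle: the defect of v is at each follower an average of its values at the
  neighbours, so the set where its norm is maximal propagates backwards along paths to the leader.\<close>

lemma transmitted_iff:
  fixes x v :: "'m::finite option \<Rightarrow> real^'n"
  assumes E: "leader_graph E"
  shows "transmitted E x v \<longleftrightarrow> v = (\<lambda>i. x i - x None)"
proof -
  define W where "W i = (\<Sum>j\<in>UNIV. weight E (Some i) j)" for i
  have W: "0 < W i" for i
  proof -
    have "(None, Some i) \<in> (E\<inverse>)\<^sup>+" using E by (simp add: leader_graph_def)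
    then obtain j where "(Some i, j) \<in> E" by (cases rule: tranclE) auto
    then show ?thesis unfolding W_def by (intro sum_pos2[of _ j]) (auto simp: weight_def)
  qed
  \<comment> \<open>In the equation for this defect the positions cancel, because the weights of row
    \<open>i\<close> add up to \<open>W i\<close>.\<close>
  define D where "D i = v i - (x i - x None)" for i
  have eq: "v (Some i) = (1 / W i) *\<^sub>R (\<Sum>j\<in>UNIV. weight E (Some i) j *\<^sub>R (x (Some i) - x j + v j))
      \<longleftrightarrow> W i *\<^sub>R D (Some i) = (\<Sum>j\<in>UNIV. weight E (Some i) j *\<^sub>R D j)" for i
  proof -
    have "(\<Sum>j\<in>UNIV. weight E (Some i) j *\<^sub>R (x (Some i) - x j + v j))
        = (\<Sum>j\<in>UNIV. weight E (Some i) j *\<^sub>R D j + weight E (Some i) j *\<^sub>R (x (Some i) - x None))"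
      by (intro sum.cong) (simp_all add: D_def algebra_simps)
    also have "\<dots> = (\<Sum>j\<in>UNIV. weight E (Some i) j *\<^sub>R D j) + W i *\<^sub>R (x (Some i) - x None)"
      unfolding sum.distrib W_def scaleR_sum_left ..
    finally have S: "(\<Sum>j\<in>UNIV. weight E (Some i) j *\<^sub>R (x (Some i) - x j + v j)) = \<dots>" .
    have "v (Some i) = (1 / W i) *\<^sub>R y \<longleftrightarrow> W i *\<^sub>R v (Some i) = y" for y
      using W[of i] by auto
    moreover have "W i *\<^sub>R D (Some i) = W i *\<^sub>R v (Some i) - W i *\<^sub>R (x (Some i) - x None)"
      unfolding D_def by (rule scaleR_diff_right)
    ultimately show ?thesis unfolding S by (simp only: diff_eq_eq)
  qed
  have "transmitted E x v \<longleftrightarrow> D None = 0 \<and> (\<forall>i. W i *\<^sub>R D (Some i) = (\<Sum>j\<in>UNIV. weight E (Some i) j *\<^sub>R D j))"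
    unfolding transmitted_def eq[symmetric] by (simp add: D_def W_def)
  also have "\<dots> \<longleftrightarrow> D = (\<lambda>_. 0)"
  proof
    assume D: "D None = 0 \<and> (\<forall>i. W i *\<^sub>R D (Some i) = (\<Sum>j\<in>UNIV. weight E (Some i) j *\<^sub>R D j))"
    define m where "m = Max (range (\<lambda>i. norm (D i)))"
    have le: "norm (D i) \<le> m" for i unfolding m_def by (rule Max_ge) auto
    have step: "norm (D j) = m" if "norm (D (Some i)) = m" "(Some i, j) \<in> E" for i j
    proof (rule ccontr)
      assume "norm (D j) \<noteq> m"
      then have "norm (D j) < m" using le[of j] by simp
      have "W i * m = norm (\<Sum>j\<in>UNIV. weight E (Some i) j *\<^sub>R D j)"
        using D that(1) W[of i] by (metis abs_of_pos norm_scaleR)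
      also have "\<dots> \<le> (\<Sum>j\<in>UNIV. weight E (Some i) j * norm (D j))"
        by (rule order_trans[OF norm_sum]) (simp add: weight_def)
      also have "\<dots> < (\<Sum>j\<in>UNIV. weight E (Some i) j * m)"
        using le that(2) \<open>norm (D j) < m\<close>
        by (intro sum_strict_mono_ex1) (auto simp: weight_def intro!: bexI[of _ j])
      finally show False by (simp add: W_def sum_distrib_right)
    qed
    have None: "norm (D None) = m" if "norm (D (Some i)) = m" for i
    proof -
      have "(None, Some i) \<in> (E\<inverse>)\<^sup>+" using E by (simp add: leader_graph_def)
      then show ?thesis
      proof (induction rule: converse_trancl_induct)
        case (base y) then show ?case using step[OF that] by auto
      next
        case (step y z)
        \<comment> \<open>The leader receives nothing, so an intermediate vertex of the path is a
          follower, to which the propagation applies.\<close>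
        then obtain k where "z = Some k" using E by (cases z) (auto simp: leader_graph_def)
        then show ?case using step \<open>\<And>i j. norm (D (Some i)) = m \<Longrightarrow> (Some i, j) \<in> E \<Longrightarrow> norm (D j) = m\<close> by auto
      qed
    qed
    obtain i where "norm (D i) = m"
    proof -
      have "m \<in> range (\<lambda>i. norm (D i))" unfolding m_def by (rule Max_in) auto
      then show thesis using that by auto
    qed
    then have "m = 0" using None D by (cases i) auto
    then show "D = (\<lambda>_. 0)" using le by (auto simp: fun_eq_iff)
  qed auto
  also have "\<dots> \<longleftrightarrow> v = (\<lambda>i. x i - x None)" by (auto simp: D_def fun_eq_iff)
  finally show ?thesis .
qed

text \<open>Since (V) determines \<open>v\<close> as the error, all states with the same error lead
  to the same value, and the description can be evaluated at one of them.\<close>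

lemma error_field_eq:
  assumes "leader_graph E"
  shows "error_field E \<mu> P K e = (\<chi> i. chain_A *v (e $ i) + chain_B *v vec (feedback \<mu> P K (e $ i)))"
  unfolding error_field_def
proof (rule the_equality)
  \<comment> \<open>With the leader placed at the origin, the state is its own transmitted
    vector.\<close>
  define x where "x = case_option 0 (\<lambda>i. e $ i)"
  have "consensus_error x = e" by (simp add: consensus_error_def x_def vec_eq_iff)
  moreover have "transmitted E x x" by (simp add: transmitted_iff[OF assms] x_def)
  moreover have "control \<mu> P K x (\<lambda>i. feedback \<mu> P K (e $ i))" by (simp add: control_def x_def)
  ultimately show "\<exists>x v u. consensus_error x = e \<and> transmitted E x v \<and> control \<mu> P K v u \<and>
      (\<chi> i. chain_A *v (e $ i) + chain_B *v vec (feedback \<mu> P K (e $ i)))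
        = (\<chi> i. chain_A *v (e $ i) + chain_B *v vec (u i))" by blast
next
  fix y assume "\<exists>x v u. consensus_error x = e \<and> transmitted E x v \<and> control \<mu> P K v u \<and>
      y = (\<chi> i. chain_A *v (e $ i) + chain_B *v vec (u i))"
  then show "y = (\<chi> i. chain_A *v (e $ i) + chain_B *v vec (feedback \<mu> P K (e $ i)))"
    by (auto simp: transmitted_iff[OF assms] control_def consensus_error_def)
qed

section \<open>The integrator chain\<close>

text \<open>The diagonal of the generator: weight 1 at the input coordinate, and a change by \<mu>
  from each coordinate to the next.\<close>

definition wt :: "real \<Rightarrow> 'n::{finite,linorder} \<Rightarrow> real" where
  "wt \<mu> k = 1 - \<mu> * (real CARD('n) - real (idx k))"

lemma idx_bounds: "1 \<le> idx k" "idx (k :: 'n::{finite,linorder}) \<le> CARD('n)"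
proof -
  have "0 < card {j. j \<le> k}" by (rule card_gt_0_iff[THEN iffD2]) auto
  then show "1 \<le> idx k" by (simp add: idx_def)
  show "idx k \<le> CARD('n)" unfolding idx_def by (rule card_mono) auto
qed

text \<open>For positive \<mu> the smallest weight is 1 - \<mu> (n - 1), at the first coordinate,
  and the bound on \<mu> is its positivity.\<close>

lemma wt_pos:
  assumes "CARD('n) > 1 \<longrightarrow> \<mu> < 1 / (real CARD('n) - 1)"
  shows "0 < wt \<mu> (k :: 'n::{finite,linorder})"
proof -
  define d where "d = real CARD('n) - real (idx k)"
  have d: "0 \<le> d" "d \<le> real CARD('n) - 1" using idx_bounds[of k] by (auto simp: d_def)
  have "\<mu> * d < 1"
  proof (cases "\<mu> \<le> 0 \<or> CARD('n) = 1")
    case True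
    then have "\<mu> * d \<le> 0" using d by (auto intro: mult_nonpos_nonneg)
    then show ?thesis by simp
  next
    case False
    moreover have "0 < CARD('n)" by (rule zero_less_card_finite)
    ultimately have c: "CARD('n) > 1" "0 < \<mu>" by linarith+
    then have "\<mu> * d \<le> \<mu> * (real CARD('n) - 1)" using d by (intro mult_left_mono) auto
    also have "\<dots> < 1" using assms c by (simp add: field_simps)
    finally show ?thesis .
  qed
  then show ?thesis by (simp add: wt_def d_def)
qed

text \<open>For negative \<mu> all weights are at least 1, so the sum can vanish only for \<mu> =
  -1; there it does so at the coordinate carrying the input.\<close>

lemma wt_add_pos:
  assumes "CARD('n) > 1 \<longrightarrow> \<mu> < 1 / (real CARD('n) - 1)" "-1 \<le> \<mu>"
  shows "0 \<le> wt \<mu> (k :: 'n::{finite,linorder}) + \<mu>" "\<mu> \<noteq> -1 \<Longrightarrow> 0 < wt \<mu> k + \<mu>"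
proof -
  have "0 < wt \<mu> k" by (rule wt_pos[OF assms(1)])
  moreover have "1 \<le> wt \<mu> k" if "\<mu> < 0"
    using idx_bounds[of k] that by (auto simp: wt_def intro!: mult_nonpos_nonneg)
  ultimately show "0 \<le> wt \<mu> k + \<mu>" "\<mu> \<noteq> -1 \<Longrightarrow> 0 < wt \<mu> k + \<mu>"
    using assms(2) by (cases "\<mu> < 0"; force)+
qed

lemma dil_gen_mult: "dil_gen \<mu> *v z = scl (wt \<mu>) z"
  by (simp add: vec_eq_iff matrix_vector_mult_def dil_gen_def wt_def if_distrib if_distribR cong: if_cong)

text \<open>Powers of a diagonal matrix are diagonal, so the matrix series is the scalar exponential
  series on the diagonal and 0 elsewhere.\<close>

lemma dil_mult:
  fixes z :: "'n::{finite,linorder} rvec"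
  shows "dil \<mu> s *v z = dl (wt \<mu>) s z"
proof -
  define M :: "'n sqmat" where "M = s *\<^sub>R dil_gen \<mu>"
  have pow: "mat_pow M k $ i $ j = (if i = j then (s * wt \<mu> i) ^ k else 0)" for k i j
  proof (induction k arbitrary: i j)
    case (Suc k)
    then show ?case
      by (simp add: matrix_matrix_mult_def M_def dil_gen_def wt_def if_distrib if_distribR cong: if_cong)
  qed (simp add: mat_def)
  have "(\<lambda>k. (1 / fact k) *\<^sub>R mat_pow M k) sums (\<chi> i j. if i = j then exp (s * wt \<mu> i) else 0)"
    unfolding sums_def
  proof (intro vec_tendstoI)
    fix i j :: 'n
    have "(\<lambda>k. if i = j then (s * wt \<mu> i) ^ k /\<^sub>R fact k else 0) sums (if i = j then exp (s * wt \<mu> i) else 0)"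
      using exp_converges[of "s * wt \<mu> i"] by auto
    then show "(\<lambda>n. (\<Sum>k<n. (1 / fact k) *\<^sub>R mat_pow M k) $ i $ j) \<longlonglongrightarrow> (\<chi> i j. if i = j then exp (s * wt \<mu> i) else 0) $ i $ j"
      unfolding sums_def by (simp add: pow divide_inverse if_distrib cong: if_cong)
  qed
  then have D: "(dil \<mu> s :: 'n sqmat) = (\<chi> i j. if i = j then exp (s * wt \<mu> i :: real) else 0)"
    using sums_unique by (fastforce simp: dil_def mat_exp_def M_def)
  show ?thesis
    unfolding D by (simp add: vec_eq_iff matrix_vector_mult_def if_distrib if_distribR cong: if_cong)
qed

lemma pos_def_matrix_inv:
  assumes "pos_def X"
  shows "X ** matrix_inv X = mat 1"
proof -
  have "x = 0" if "X *v x = 0" for x using assms that by (force simp: pos_def_def)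
  then have "inj ((*v) X)" using linear_injective_0[OF matrix_vector_mul_linear] by blast
  then have "invertible X" using matrix_left_invertible_injective invertible_left_inverse by blast
  then have "\<exists>A'. X ** A' = mat 1 \<and> A' ** X = mat 1" by (simp add: invertible_def)
  from someI_ex[OF this] show ?thesis by (simp add: matrix_inv_def)
qed

lemma inner_transpose: "x \<bullet> (A *v y) = (transpose A *v x) \<bullet> y"
  for A :: "real^'n^'m"
  by (simp add: dot_lmul_matrix)

text \<open>The matrix inequalities are evaluated at \<xi> = P x, where X \<xi> = x and Y \<xi> = K
  x. Transposed terms contribute equally, so each gives twice the form required by the
  locale.\<close>

lemma homogeneous_loop_chain:
  fixes X P :: "'n::{finite,linorder} sqmat" and Y K :: "'n rowmat"
  assumes mu: "-1 \<le> \<mu>" "CARD('n) > 1 \<longrightarrow> \<mu> < 1 / (real CARD('n) - 1)"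
    and X: "pos_def X" and GX: "pos_def (dil_gen \<mu> ** X + X ** dil_gen \<mu>)"
    and lmi: "neg_def (chain_A ** X + X ** transpose chain_A
                - chain_B ** Y - transpose Y ** transpose chain_B)"
    and P: "P = matrix_inv X" and K: "K = Y ** matrix_inv X"
  shows "homogeneous_loop (wt \<mu>) \<mu> P (\<lambda>x. chain_A *v x - chain_B *v (K *v x))"
proof (rule homogeneous_loop.intro)
  have XP: "X *v (P *v x) = x" for x
    using pos_def_matrix_inv[OF X] by (simp add: P matrix_vector_mul_assoc)
  have KP: "K *v x = Y *v (P *v x)" for x by (simp add: K P matrix_vector_mul_assoc)
  have sym: "x \<bullet> (X *v y) = (X *v x) \<bullet> y" for x y
    using X inner_transpose[of x X y] by (simp add: pos_def_def)
  have ne: "P *v x \<noteq> 0" if "x \<noteq> 0" for x using XP[of x] that by auto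
  show "linear (\<lambda>x. chain_A *v x - chain_B *v (K *v x))"
    by (rule linearI) (simp_all add: matrix_vector_right_distrib matrix_vector_mult_scaleR algebra_simps)
  show "x \<bullet> (P *v y) = y \<bullet> (P *v x)" for x y
    using sym[of "P *v x" "P *v y"] by (simp add: XP inner_commute)
  show "0 < x \<bullet> (P *v x)" if "x \<noteq> 0" for x
    using X ne[OF that] XP[of x] unfolding pos_def_def by (metis inner_commute)
  show "0 < (P *v x) \<bullet> scl (wt \<mu>) x" if "x \<noteq> 0" for x
  proof -
    let ?\<xi> = "P *v x"
    have "0 < ?\<xi> \<bullet> ((dil_gen \<mu> ** X + X ** dil_gen \<mu>) *v ?\<xi>)"
      using GX ne[OF that] by (simp add: pos_def_def)
    also have "\<dots> = ?\<xi> \<bullet> scl (wt \<mu>) x + x \<bullet> scl (wt \<mu>) ?\<xi>"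
      by (simp add: matrix_vector_mult_add_rdistrib inner_add_right XP dil_gen_mult sym flip: matrix_vector_mul_assoc)
    also have "x \<bullet> scl (wt \<mu>) ?\<xi> = ?\<xi> \<bullet> scl (wt \<mu>) x"
      by (simp add: inner_vec_def mult_ac)
    finally show ?thesis by simp
  qed
  show "(P *v x) \<bullet> (chain_A *v x - chain_B *v (K *v x)) < 0" if "x \<noteq> 0" for x
  proof -
    let ?\<xi> = "P *v x"
    have "?\<xi> \<bullet> ((chain_A ** X + X ** transpose chain_A - chain_B ** Y - transpose Y ** transpose chain_B) *v ?\<xi>)
        = ?\<xi> \<bullet> (chain_A *v x) + x \<bullet> (transpose chain_A *v ?\<xi>) - ?\<xi> \<bullet> (chain_B *v (Y *v ?\<xi>))
          - ?\<xi> \<bullet> (transpose Y *v (transpose chain_B *v ?\<xi>))"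
      by (simp only: matrix_vector_mult_add_rdistrib matrix_vector_mult_diff_rdistrib inner_add_right inner_diff_right
          XP sym flip: matrix_vector_mul_assoc)
    also have "x \<bullet> (transpose chain_A *v ?\<xi>) = ?\<xi> \<bullet> (chain_A *v x)"
      using inner_transpose[of x "transpose chain_A" ?\<xi>] by (simp only: transpose_transpose inner_commute)
    also have "?\<xi> \<bullet> (transpose Y *v (transpose chain_B *v ?\<xi>)) = ?\<xi> \<bullet> (chain_B *v (Y *v ?\<xi>))"
      using inner_transpose[of ?\<xi> "transpose Y" "transpose chain_B *v ?\<xi>"]
        inner_transpose[of "Y *v ?\<xi>" "transpose chain_B" ?\<xi>]
      by (simp only: transpose_transpose inner_commute)
    finally have "2 * (?\<xi> \<bullet> (chain_A *v x - chain_B *v (K *v x)))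
        = ?\<xi> \<bullet> ((chain_A ** X + X ** transpose chain_A - chain_B ** Y - transpose Y ** transpose chain_B) *v ?\<xi>)"
      by (simp add: inner_diff_right KP)
    also have "\<dots> < 0" using lmi ne[OF that] unfolding neg_def_def by blast
    finally show ?thesis by simp
  qed
  show "0 < wt \<mu> (k :: 'n)" for k by (rule wt_pos[OF mu(2)])
  show "0 \<le> wt \<mu> (k :: 'n) + \<mu>" for k by (rule wt_add_pos[OF mu(2,1)])
qed

lemma wnorm_eq_1_iff: "wnorm P x = 1 \<longleftrightarrow> x \<bullet> (P *v x) = 1"
  by (simp add: wnorm_def)

text \<open>Homogeneity of the chain: \<open>chain_A\<close> moves a coordinate to the previous one,
  whose weight raised by \<mu> is the weight it came with, and \<open>chain_B\<close> acts only at
  weight 1, whence the power 1 + \<mu> of the homogeneous norm in the control.\<close>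

lemma chain_feedback_eq:
  fixes P :: "'n::{finite,linorder} sqmat" and K :: "'n rowmat"
  assumes "homogeneous_loop (wt \<mu>) \<mu> P (\<lambda>x. chain_A *v x - chain_B *v (K *v x))"
  shows "chain_A *v z + chain_B *v vec (feedback \<mu> P K z)
    = homogeneous_loop.g (wt \<mu>) \<mu> P (\<lambda>x. chain_A *v x - chain_B *v (K *v x)) z"
proof -
  interpret L: homogeneous_loop "wt \<mu>" \<mu> P "\<lambda>x. chain_A *v x - chain_B *v (K *v x)" by (rule assms)
  show ?thesis
  proof (cases "z = 0")
    case True
    have "vec 0 = (0 :: real^1)" by (simp add: vec_eq_iff)
    then show ?thesis unfolding True L.g_0 by (simp add: feedback_def)
  next
    case False
    define s where "s = L.\<sigma> z"
    have hn: "hnorm \<mu> P z = exp s"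
      using False by (simp add: hnorm_def s_def L.\<sigma>_def wnorm_eq_1_iff dil_mult L.q_def)
    define w where "w = dl (wt \<mu>) (- s) z"
    have fb: "feedback \<mu> P K z = - exp (s * (1 + \<mu>)) * (K *v w) $ 1"
      using False by (simp add: feedback_def hn dil_mult w_def powr_def mult.commute)
    have A: "exp (s * (wt \<mu> k + \<mu>)) * (chain_A *v w) $ k = (chain_A *v z) $ k" for k
    proof -
      have j: "exp (s * (wt \<mu> k + \<mu>)) * (chain_A $ k $ j * w $ j) = chain_A $ k $ j * z $ j" for j
      proof (cases "idx j = idx k + 1")
        case True
        then have "wt \<mu> j = wt \<mu> k + \<mu>" by (simp add: wt_def algebra_simps)
        then show ?thesis using True by (simp add: chain_A_def w_def mult_exp_exp flip: mult.assoc)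
      qed (simp add: chain_A_def)
      show ?thesis
        unfolding matrix_vector_mult_def vec_lambda_beta sum_distrib_left by (rule sum.cong[OF refl j])
    qed
    have B: "exp (s * (wt \<mu> k + \<mu>)) * (chain_B *v u) $ k = exp (s * (1 + \<mu>)) * (chain_B $ k $ 1 * u $ 1)" for k u
    proof -
      have "(chain_B *v u) $ k = chain_B $ k $ 1 * u $ 1" by (simp add: matrix_vector_mult_def sum_1)
      moreover have "chain_B $ k $ (1::1) = 0 \<or> wt \<mu> k = 1" by (simp add: chain_B_def wt_def)
      ultimately show ?thesis by auto
    qed
    have "(chain_A *v z + chain_B *v vec (feedback \<mu> P K z)) $ k
        = (dl (\<lambda>k. wt \<mu> k + \<mu>) s (chain_A *v w - chain_B *v (K *v w))) $ k" for k
      by (simp add: right_diff_distrib A B fb) (simp add: matrix_vector_mult_def sum_1)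
    then have "chain_A *v z + chain_B *v vec (feedback \<mu> P K z)
        = dl (\<lambda>k. wt \<mu> k + \<mu>) s (chain_A *v w - chain_B *v (K *v w))"
      unfolding vec_eq_iff by blast
    then show ?thesis using False by (simp add: L.g_def s_def w_def)
  qed
qed

theorem theorem1:
  fixes E :: "('m::finite option \<times> 'm option) set"
    and \<mu> :: real
    and X P :: "'n::{finite,linorder} sqmat"
    and Y K :: "'n rowmat"
  assumes graph: "leader_graph E"
    and mu_ge: "-1 \<le> \<mu>"
    and mu_less: "CARD('n) > 1 \<longrightarrow> \<mu> < 1 / (real CARD('n) - 1)"
    and X_pos: "pos_def X"
    and GX_pos: "pos_def (dil_gen \<mu> ** X + X ** dil_gen \<mu>)"
    and lmi: "neg_def (chain_A ** X + X ** transpose chain_A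
                - chain_B ** Y - transpose Y ** transpose chain_B)"
    and P_eq: "P = matrix_inv X"
    and K_eq: "K = Y ** matrix_inv X"
  shows "((\<forall>x :: 'm option \<Rightarrow> 'n rvec. \<exists>!v. transmitted E x v)
          \<and> (\<forall>z :: 'n rvec. z \<noteq> 0 \<longrightarrow> (\<exists>!s. wnorm P (dil \<mu> (- s) *v z) = 1))
          \<and> (\<forall>x v. transmitted E x v \<longrightarrow> (\<exists>!u. control \<mu> P K v u))
          \<and> unique_forward_solutions (solution \<mu> (error_field E \<mu> P K)))
       \<and> (\<mu> < 0 \<longrightarrow> globally_finite_time_stable (solution \<mu> (error_field E \<mu> P K)))"
proof -
  note loop = homogeneous_loop_chain[OF mu_ge mu_less X_pos GX_pos lmi P_eq K_eq]
  interpret L: homogeneous_loop "wt \<mu>" \<mu> P "\<lambda>x. chain_A *v x - chain_B *v (K *v x)" by (rule loop)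
  have field: "error_field E \<mu> P K = L.F"
    by (simp add: fun_eq_iff error_field_eq[OF graph] L.F_def chain_feedback_eq[OF loop])
  have pos: "\<mu> \<noteq> -1 \<longrightarrow> (\<forall>k :: 'n. 0 < wt \<mu> k + \<mu>)"
    using wt_add_pos(2)[OF mu_less mu_ge] by blast
  have "\<exists>!s. wnorm P (dil \<mu> (- s) *v z) = 1" if "z \<noteq> 0" for z
    using L.ex1_dilation[OF that] by (simp add: wnorm_eq_1_iff dil_mult L.q_def)
  moreover have "\<exists>!v. transmitted E x v" for x :: "'m option \<Rightarrow> 'n rvec"
    by (simp add: transmitted_iff[OF graph])
  moreover have "\<exists>!u. control \<mu> P K v u" for v :: "'m option \<Rightarrow> 'n rvec"
    unfolding control_def by (rule ex1I[of _ "\<lambda>i. feedback \<mu> P K (v (Some i))"]) auto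
  ultimately show ?thesis
    unfolding field using L.unique_forward_solutions_F[OF pos] L.globally_finite_time_stable_F[OF pos] by blast
qed

end
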